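(* Suppose there is an algorithm that, on any graph with $O(k^2)$ edges and no degree-$0$ vertices, either finds a $k$-matching or reports that none exists, in time $\alpha(k^2)$ and simultaneously in space $O(k^2)$. Then for any $\epsilon > 0$ there is a randomized algorithm that, with probability at least $1-\epsilon$, solves the p-UGM problem on an input $(G,k)$ with $G$ of size $N$ in time $O(N + k^2 \log k + k\log(1/\epsilon) + \alpha(k^2))$ and space $O(k^2)$.
   Context: Graphs are undirected, given in adjacency-list format; the size of $G=(V,E)$ is $N=|V|+|E|$. A $k$-matching is a set of exactly $k$ edges no two of which share an endpoint. The p-UGM problem: given an unweighted graph $G$ and integer $k$, either return a $k$-matching in $G$ or report that none exists. Computational model: word-RAM with constant-time basic word operations; the input is word-addressable and read-only; time and space are counted in words, space referring to working space beyond the read-only input. *)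

theory Defs
  imports "HOL-Probability.Probability_Mass_Function"
begin

unbundle bit_operations_syntax

section \<open>A randomized word-RAM with read-only input\<close>

text \<open>
  Words are the naturals below \<open>2 ^ w\<close>, where the word size \<open>w\<close> is a parameter of the semantics
  and never visible to a program other than through its arithmetic. A program is a fixed list of
  commands over finitely many registers; the commands are in three-address form, so that every
  command executes a constant number of basic word operations.
\<close>

datatype wop = Add | Sub | Mult | Div | Mod | And | Or | Xor | Shl | Shr | Eq | Less

fun eval_wop :: "nat \<Rightarrow> wop \<Rightarrow> nat \<Rightarrow> nat \<Rightarrow> nat" where
  "eval_wop w Add a b = (a + b) mod 2 ^ w"
| "eval_wop w Sub a b = (a + (2 ^ w - b)) mod 2 ^ w"
| "eval_wop w Mult a b = (a * b) mod 2 ^ w"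
| "eval_wop w Div a b = a div b"
| "eval_wop w Mod a b = a mod b"
| "eval_wop w And a b = (a AND b)"
| "eval_wop w Or a b = (a OR b)"
| "eval_wop w Xor a b = (a XOR b)"
| "eval_wop w Shl a b = (a * 2 ^ b) mod 2 ^ w"
| "eval_wop w Shr a b = a div 2 ^ b"
| "eval_wop w Eq a b = (if a = b then 1 else 0)"
| "eval_wop w Less a b = (if a < b then 1 else 0)"

text \<open>
  \<open>'r\<close> is the type of register names; the set function \<open>regs\<close> of the datatype collects the
  registers occurring in a command. A word counts as true iff it is nonzero.
\<close>

datatype (regs: 'r) com =
    Lit 'r nat           \<comment> \<open>\<open>Lit r c\<close>: \<open>r := c\<close> (modulo \<open>2 ^ w\<close>)\<close>
  | Op wop 'r 'r 'r      \<comment> \<open>\<open>Op f r a b\<close>: \<open>r := f a b\<close>\<close>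
  | Input 'r 'r          \<comment> \<open>\<open>Input r a\<close>: \<open>r := input[a]\<close>\<close>
  | Load 'r 'r           \<comment> \<open>\<open>Load r a\<close>: \<open>r := memory[a]\<close>\<close>
  | Store 'r 'r          \<comment> \<open>\<open>Store a r\<close>: \<open>memory[a] := r\<close>\<close>
  | Rand 'r              \<comment> \<open>\<open>Rand r\<close>: \<open>r :=\<close> a fresh uniformly random word\<close>
  | Cond 'r "'r com list" "'r com list"
  | While 'r "'r com list"

type_synonym prog = "nat com list"

fun rand_free :: "'r com \<Rightarrow> bool" where
  "rand_free (Rand r) = False"
| "rand_free (Cond r P Q) = ((\<forall>c\<in>set P. rand_free c) \<and> (\<forall>c\<in>set Q. rand_free c))"
| "rand_free (While r P) = (\<forall>c\<in>set P. rand_free c)"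
| "rand_free _ = True"

definition deterministic :: "prog \<Rightarrow> bool" where
  "deterministic P \<longleftrightarrow> (\<forall>c\<in>set P. rand_free c)"

text \<open>
  \<open>extent\<close> is one more than the largest address of working memory accessed so far. Counting
  this, and not just the number of accessed cells, rules out sparse tables over the whole
  address space.
\<close>

record state =
  reg :: "nat \<Rightarrow> nat"
  mem :: "nat \<Rightarrow> nat"
  extent :: nat

definition init_state :: state where
  "init_state = \<lparr>reg = (\<lambda>_. 0), mem = (\<lambda>_. 0), extent = 0\<rparr>"

definition set_reg :: "nat \<Rightarrow> nat \<Rightarrow> state \<Rightarrow> state" where
  "set_reg r v s = s\<lparr>reg := (reg s)(r := v)\<rparr>"

definition touch :: "nat \<Rightarrow> state \<Rightarrow> state" where
  "touch a s = s\<lparr>extent := max (extent s) (a + 1)\<rparr>"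

text \<open>
  A configuration consists of the commands still to be executed and the state; it has halted
  when no command is left. Each step takes unit time.
\<close>

type_synonym config = "prog \<times> state"

fun step :: "nat \<Rightarrow> nat list \<Rightarrow> config \<Rightarrow> config pmf" where
  "step w x ([], s) = return_pmf ([], s)"
| "step w x (Lit r c # K, s) = return_pmf (K, set_reg r (c mod 2 ^ w) s)"
| "step w x (Op f r a b # K, s) =
     return_pmf (K, set_reg r (eval_wop w f (reg s a) (reg s b)) s)"
| "step w x (Input r a # K, s) =
     return_pmf (K, set_reg r ((if reg s a < length x then x ! reg s a else 0) mod 2 ^ w) s)"
| "step w x (Load r a # K, s) =
     return_pmf (K, touch (reg s a) (set_reg r (mem s (reg s a)) s))"
| "step w x (Store a r # K, s) =
     return_pmf (K, touch (reg s a) (s\<lparr>mem := (mem s)(reg s a := reg s r)\<rparr>))"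
| "step w x (Rand r # K, s) =
     map_pmf (\<lambda>v. (K, set_reg r v s)) (pmf_of_set {..<2 ^ w})"
| "step w x (Cond r P Q # K, s) = return_pmf ((if reg s r \<noteq> 0 then P else Q) @ K, s)"
| "step w x (While r P # K, s) =
     return_pmf (if reg s r \<noteq> 0 then P @ While r P # K else K, s)"

fun steps :: "nat \<Rightarrow> nat list \<Rightarrow> nat \<Rightarrow> config \<Rightarrow> config pmf" where
  "steps w x 0 c = return_pmf c"
| "steps w x (Suc t) c = bind_pmf (step w x c) (steps w x t)"

definition run :: "nat \<Rightarrow> prog \<Rightarrow> nat list \<Rightarrow> nat \<Rightarrow> config pmf" where
  "run w P x t = steps w x t (P, init_state)"

text \<open>Working space in words: the registers of the program plus the extent of memory.\<close>

definition space_used :: "prog \<Rightarrow> state \<Rightarrow> nat" where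
  "space_used P s = card (\<Union>c\<in>set P. regs c) + extent s"

text \<open>Time and space bounds are worst case over all random choices.\<close>

definition runs_within :: "nat \<Rightarrow> prog \<Rightarrow> nat list \<Rightarrow> nat \<Rightarrow> real \<Rightarrow> bool" where
  "runs_within w P x t S \<longleftrightarrow>
     (\<forall>(K, s) \<in> set_pmf (run w P x t). K = [] \<and> real (space_used P s) \<le> S)"

section \<open>Graphs and matchings\<close>

definition ugraph :: "nat \<Rightarrow> nat set set \<Rightarrow> bool" where
  "ugraph n E \<longleftrightarrow> (\<forall>e\<in>E. \<exists>u v. u < n \<and> v < n \<and> u \<noteq> v \<and> e = {u, v})"

definition gsize :: "nat \<Rightarrow> nat set set \<Rightarrow> nat" where
  "gsize n E = n + card E"

definition degree :: "nat set set \<Rightarrow> nat \<Rightarrow> nat" where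
  "degree E v = card {e \<in> E. v \<in> e}"

definition k_matching :: "nat set set \<Rightarrow> nat \<Rightarrow> nat set set \<Rightarrow> bool" where
  "k_matching E k M \<longleftrightarrow>
     M \<subseteq> E \<and> finite M \<and> card M = k \<and> (\<forall>e\<in>M. \<forall>f\<in>M. e \<noteq> f \<longrightarrow> e \<inter> f = {})"

text \<open>The order of the neighbours within each list is arbitrary.\<close>

definition adjacency_lists :: "nat \<Rightarrow> nat set set \<Rightarrow> nat list list \<Rightarrow> bool" where
  "adjacency_lists n E L \<longleftrightarrow>
     length L = n \<and> (\<forall>u<n. distinct (L ! u) \<and> set (L ! u) = {v. {u, v} \<in> E})"

text \<open>
  The input array for \<open>(G, k)\<close>: the words \<open>k\<close> and \<open>n\<close>, then \<open>n + 1\<close> addresses, then the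
  concatenated adjacency lists. The list of vertex \<open>u\<close> occupies the positions \<open>p\<close> with
  \<open>x ! (u + 2) \<le> p < x ! (u + 3)\<close> of the input array \<open>x\<close>.
\<close>

definition encode :: "nat list list \<Rightarrow> nat \<Rightarrow> nat list" where
  "encode L k = [k, length L]
     @ map (\<lambda>i. length L + 3 + (\<Sum>j<i. length (L ! j))) [0..<length L + 1]
     @ concat L"

text \<open>
  The answer is read off the final state: register \<open>0\<close> tells whether a matching is returned, and
  if so the first \<open>2 * k\<close> words of memory list the endpoints of its edges.
\<close>

definition returned_edges :: "nat \<Rightarrow> state \<Rightarrow> nat set set" where
  "returned_edges k s = {{mem s (2 * i), mem s (2 * i + 1)} | i. i < k}"

definition correct_answer :: "nat set set \<Rightarrow> nat \<Rightarrow> state \<Rightarrow> bool" where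
  "correct_answer E k s \<longleftrightarrow>
     (if reg s 0 \<noteq> 0 then k_matching E k (returned_edges k s)
      else \<not> (\<exists>M. k_matching E k M))"

definition success_prob :: "nat \<Rightarrow> prog \<Rightarrow> nat list \<Rightarrow> nat \<Rightarrow> nat set set \<Rightarrow> nat \<Rightarrow> real" where
  "success_prob w P x t E k =
     measure_pmf.prob (run w P x t) {(K, s). K = [] \<and> correct_answer E k s}"

text \<open>
  The word size is at least logarithmic in the numbers describing the input, with a constant
  factor that the algorithm may choose.
\<close>

definition word_size_ok :: "real \<Rightarrow> nat \<Rightarrow> nat set set \<Rightarrow> nat \<Rightarrow> nat \<Rightarrow> bool" where
  "word_size_ok \<kappa> n E k w \<longleftrightarrow> real w \<ge> \<kappa> * log 2 (real (gsize n E + k + 2))"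

text \<open>
  A deterministic algorithm for graphs with \<open>O(k\<^sup>2)\<close> edges and no vertex of degree \<open>0\<close>: for every
  constant hidden in the bound on the edges, the running time is \<open>O(\<alpha>(k\<^sup>2))\<close> and the space is
  \<open>O(k\<^sup>2)\<close>. Here and below \<open>k\<^sup>2 + 1\<close> is only to allow for constant space if \<open>k = 0\<close>.
\<close>

definition sparse_matching_algorithm :: "(nat \<Rightarrow> real) \<Rightarrow> prog \<Rightarrow> bool" where
  "sparse_matching_algorithm \<alpha> A \<longleftrightarrow>
     deterministic A \<and>
     (\<forall>c::real. \<exists>C \<kappa>. \<forall>n E L k w.
        ugraph n E \<and> adjacency_lists n E L \<and> real (card E) \<le> c * real (k\<^sup>2) \<and>
        (\<forall>v<n. degree E v \<noteq> 0) \<and> word_size_ok \<kappa> n E k w \<longrightarrow>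
        (\<exists>t. real t \<le> C * \<alpha> (k\<^sup>2) \<and>
             runs_within w A (encode L k) t (C * (real (k\<^sup>2) + 1)) \<and>
             (\<forall>(K, s) \<in> set_pmf (run w A (encode L k) t). correct_answer E k s)))"

end

theory Submission imports Defs begin

text \<open>
  No randomness is needed, because degrees can be read off the offset table in constant time.
  Call a vertex high if its degree is at least \<open>2 * k\<close>. High vertices can be matched greedily at the
  end, so only their number matters (and only up to \<open>k\<close>), and each of them is replaced by an isolated
  edge. Among the other vertices all degrees are below \<open>2 * k\<close>, so \<open>4 * k\<^sup>2\<close> edges already force a
  \<open>k\<close>-matching, and the graph can be cut off at the first vertex where that many edges have been seen.
  What remains is a kernel with at most \<open>7 * k\<^sup>2\<close> edges. Scanning the vertices in increasing order
  produces its vertex set as a sorted array, in which binary search yields the new vertex names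
  within the \<open>k\<^sup>2 log k\<close> term. The given algorithm is simulated on the kernel, and its answer is
  translated back and extended by the high vertices, the used vertices being kept in a sorted array.
\<close>

section \<open>A structured language compiled to word-RAM programs\<close>

text \<open>The threshold \<open>2 * k\<close> comes from a count made at the very end. If
  \<open>d\<close> edges stem from the kernel and \<open>r = k - d\<close> high vertices remain to
  be matched, then the vertices blocked for the next of them are \<open>2 * d\<close> endpoints, the
  \<open>r\<close> high vertices themselves and fewer than \<open>r\<close> partners chosen so far.
  These are fewer than \<open>2 * k\<close>, so any \<open>2 * k\<close> neighbours include a free
  one. Conversely, the edges of a \<open>k\<close>-matching that touch high vertices can be charged
  to different high vertices, so one isolated edge for each is a faithful substitute. The number
  \<open>4 * k\<^sup>2\<close> is \<open>2 * (2 * k) * k\<close>: a greedily chosen edge spoils at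
  most \<open>2 * (2 * k)\<close> edges. The cost of the given algorithm is known only at
  \<open>k\<^sup>2\<close>, on properly encoded graphs without vertices of degree \<open>0\<close>.
  Hence the parameter must stay \<open>k\<close>, and the kernel must be written out under
  consecutive names instead of being a mask on the input. The main burden is the machine: each step,
  address and possible overflow counts. It is carried by a small verified compiler whose weakest
  preconditions also count steps.\<close>

text \<open>All code to be analysed is free of \<open>Rand\<close>, so a run is a point mass and can
  be handled like the run of a deterministic machine.\<close>

definition exec :: "nat \<Rightarrow> nat list \<Rightarrow> nat \<Rightarrow> config \<Rightarrow> config \<Rightarrow> bool" where
  "exec w x t c c' \<longleftrightarrow> steps w x t c = return_pmf c'"

lemma steps_add: "steps w x (t1 + t2) c = bind_pmf (steps w x t1 c) (steps w x t2)"
proof (induction t1 arbitrary: c)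
  case (Suc t1)
  then have "steps w x (t1 + t2) = (\<lambda>c. bind_pmf (steps w x t1 c) (steps w x t2))" by blast
  then show ?case by (simp add: bind_assoc_pmf)
qed (simp add: bind_return_pmf)

lemma exec_trans: "exec w x t1 c c1 \<Longrightarrow> exec w x t2 c1 c2 \<Longrightarrow> exec w x (t1 + t2) c c2"
  by (simp add: exec_def steps_add bind_return_pmf)

lemma exec_0: "exec w x 0 c c"
  by (simp add: exec_def)

datatype exp = Num nat | Var nat | Bin wop exp exp | Inp exp | Arr nat exp

text \<open>\<open>Out\<close> is the only statement that writes to a raw address. The answer must
  occupy the first words of memory, whereas \<open>Wr\<close> addresses a cell of one of the
  interleaved arrays.\<close>

datatype stm = Asg nat exp | Wr nat exp exp | Out exp exp | Cnd exp "stm list" "stm list"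
  | Whl exp "stm list"

type_synonym vars = "nat \<Rightarrow> nat"
type_synonym arrs = "nat \<Rightarrow> nat \<Rightarrow> nat"

text \<open>Arithmetic on unbounded numbers; \<open>ideal_ok\<close> states when the word operation
  agrees with it. The default \<open>0\<close> is harmless, because \<open>ideal_ok\<close> is false
  for the remaining operators.\<close>

fun ideal :: "wop \<Rightarrow> nat \<Rightarrow> nat \<Rightarrow> nat" where
  "ideal Add a b = a + b"
| "ideal Mult a b = a * b"
| "ideal Div a b = a div b"
| "ideal Less a b = (if a < b then 1 else 0)"
| "ideal Eq a b = (if a = b then 1 else 0)"
| "ideal _ a b = 0"

fun ideal_ok :: "nat \<Rightarrow> wop \<Rightarrow> nat \<Rightarrow> nat \<Rightarrow> bool" where
  "ideal_ok w Add a b = (a + b < 2 ^ w)"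
| "ideal_ok w Mult a b = (a * b < 2 ^ w)"
| "ideal_ok w Div a b = True"
| "ideal_ok w Less a b = True"
| "ideal_ok w Eq a b = True"
| "ideal_ok w _ a b = False"

lemma eval_wop_ideal: "ideal_ok w f a b \<Longrightarrow> eval_wop w f a b = ideal f a b"
  by (cases f) auto

primrec val :: "nat list \<Rightarrow> exp \<Rightarrow> vars \<Rightarrow> arrs \<Rightarrow> nat" where
  "val x (Num c) v a = c"
| "val x (Var r) v a = v r"
| "val x (Bin f e1 e2) v a = ideal f (val x e1 v a) (val x e2 v a)"
| "val x (Inp e) v a = x ! val x e v a"
| "val x (Arr j e) v a = a j (val x e v a)"

primrec ok :: "nat \<Rightarrow> nat \<Rightarrow> nat list \<Rightarrow> exp \<Rightarrow> vars \<Rightarrow> arrs \<Rightarrow> bool" where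
  "ok w Z x (Num c) v a = (c < 2 ^ w)"
| "ok w Z x (Var r) v a = True"
| "ok w Z x (Bin f e1 e2) v a =
     (ok w Z x e1 v a \<and> ok w Z x e2 v a \<and> ideal_ok w f (val x e1 v a) (val x e2 v a))"
| "ok w Z x (Inp e) v a =
     (ok w Z x e v a \<and> val x e v a < length x \<and> x ! val x e v a < 2 ^ w)"
| "ok w Z x (Arr j e) v a = (ok w Z x e v a \<and> j < 8 \<and> val x e v a < Z)"

primrec cost :: "exp \<Rightarrow> nat" where
  "cost (Num c) = 1"
| "cost (Var r) = 1"
| "cost (Bin f e1 e2) = cost e1 + cost e2 + 1"
| "cost (Inp e) = cost e + 1"
| "cost (Arr j e) = cost e + 5"

text \<open>Register \<open>3 * r\<close> holds the variable \<open>r\<close>, register \<open>3 * d + 1\<close> is the temporary \<open>d\<close>, and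
  register \<open>3 * r + 2\<close> is reserved for the register \<open>r\<close> of the simulated program. Cell \<open>i\<close> of the
  array \<open>j < 8\<close> has the address \<open>8 * i + j\<close>, so that no array needs a size bound in advance.\<close>

definition addr :: "nat \<Rightarrow> nat \<Rightarrow> nat \<Rightarrow> prog" where
  "addr j r d = [Lit (3 * d + 4) 8, Op Mult (3 * d + 1) r (3 * d + 4),
     Lit (3 * d + 4) j, Op Add (3 * d + 1) (3 * d + 1) (3 * d + 4)]"

text \<open>\<open>d\<close> is the height of a stack known at compile time: the value ends up in
  temporary \<open>d\<close>, and the temporaries below it survive. The machine has no move command,
  hence the \<open>And\<close> of a register with itself.\<close>

primrec compile_exp :: "exp \<Rightarrow> nat \<Rightarrow> prog" where
  "compile_exp (Num c) d = [Lit (3 * d + 1) c]"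
| "compile_exp (Var r) d = [Op And (3 * d + 1) (3 * r) (3 * r)]"
| "compile_exp (Bin f e1 e2) d =
     compile_exp e1 d @ compile_exp e2 (d + 1) @ [Op f (3 * d + 1) (3 * d + 1) (3 * d + 4)]"
| "compile_exp (Inp e) d = compile_exp e d @ [Input (3 * d + 1) (3 * d + 1)]"
| "compile_exp (Arr j e) d = compile_exp e d @ addr j (3 * d + 1) d @ [Load (3 * d + 1) (3 * d + 1)]"

text \<open>\<open>While\<close> tests a register, so the guard of a loop is compiled twice: once in
  front of the loop and once at the end of its body.\<close>

fun compile :: "stm list \<Rightarrow> prog" where
  "compile [] = []"
| "compile (Asg r e # Ps) = compile_exp e 0 @ [Op And (3 * r) 1 1] @ compile Ps"
| "compile (Wr j e1 e2 # Ps) = compile_exp e1 0 @ addr j 1 0 @ compile_exp e2 1 @ [Store 1 4] @ compile Ps"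
| "compile (Out e1 e2 # Ps) = compile_exp e1 0 @ compile_exp e2 1 @ [Store 1 4] @ compile Ps"
| "compile (Cnd e P Q # Ps) = compile_exp e 0 @ [Cond 1 (compile P) (compile Q)] @ compile Ps"
| "compile (Whl e P # Ps) = compile_exp e 0 @ [While 1 (compile P @ compile_exp e 0)] @ compile Ps"

definition upd :: "arrs \<Rightarrow> nat \<Rightarrow> nat \<Rightarrow> nat \<Rightarrow> arrs" where
  "upd a j i y = a(j := (a j)(i := y))"

lemma upd_apply: "upd a j i y j' i' = (if j' = j \<and> i' = i then y else a j' i')"
  by (simp add: upd_def)

context
  fixes w Z :: nat and x :: "nat list"
begin

text \<open>Weakest preconditions with a step counter as the last argument. The existentially quantified
  invariant of a loop is indexed by a natural number that decreases with each iteration.\<close>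

primrec vc1 :: "stm \<Rightarrow> (vars \<Rightarrow> arrs \<Rightarrow> nat \<Rightarrow> bool) \<Rightarrow> vars \<Rightarrow> arrs \<Rightarrow> nat \<Rightarrow> bool" where
  "vc1 (Asg r e) = (\<lambda>Q v a n. ok w Z x e v a \<and> Q (v(r := val x e v a)) a (n + (cost e + 1)))"
| "vc1 (Wr j e1 e2) = (\<lambda>Q v a n. ok w Z x e1 v a \<and> ok w Z x e2 v a \<and> j < 8 \<and>
     val x e1 v a < Z \<and>
     Q v (upd a j (val x e1 v a) (val x e2 v a)) (n + (cost e1 + cost e2 + 5)))"
| "vc1 (Out e1 e2) = (\<lambda>Q v a n. ok w Z x e1 v a \<and> ok w Z x e2 v a \<and>
     val x e1 v a < 8 * Z \<and>
     Q v (upd a (val x e1 v a mod 8) (val x e1 v a div 8) (val x e2 v a))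
       (n + (cost e1 + cost e2 + 1)))"
| "vc1 (Cnd e P P') = (\<lambda>Q v a n. ok w Z x e v a \<and>
     (if val x e v a \<noteq> 0 then foldr id (map vc1 P) Q v a (n + (cost e + 1))
      else foldr id (map vc1 P') Q v a (n + (cost e + 1))))"
| "vc1 (Whl e P) = (\<lambda>Q v a n. \<exists>I. (\<exists>f::nat. I f v a n) \<and>
     (\<forall>f v a n. I f v a n \<longrightarrow> ok w Z x e v a \<and>
       (if val x e v a \<noteq> 0
        then foldr id (map vc1 P) (\<lambda>v a n. \<exists>f'<f. I f' v a n) v a (n + (cost e + 1))
        else Q v a (n + (cost e + 1)))))"

definition vc :: "stm list \<Rightarrow> (vars \<Rightarrow> arrs \<Rightarrow> nat \<Rightarrow> bool) \<Rightarrow> vars \<Rightarrow> arrs \<Rightarrow> nat \<Rightarrow> bool"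
  where "vc P Q = foldr id (map vc1 P) Q"

lemma vc_simps:
  "vc [] Q = Q"
  "vc (Asg r e # Ps) Q v a n \<longleftrightarrow> ok w Z x e v a \<and>
     vc Ps Q (v(r := val x e v a)) a (n + (cost e + 1))"
  "vc (Wr j e1 e2 # Ps) Q v a n \<longleftrightarrow> ok w Z x e1 v a \<and> ok w Z x e2 v a \<and> j < 8 \<and>
     val x e1 v a < Z \<and>
     vc Ps Q v (upd a j (val x e1 v a) (val x e2 v a)) (n + (cost e1 + cost e2 + 5))"
  "vc (Out e1 e2 # Ps) Q v a n \<longleftrightarrow> ok w Z x e1 v a \<and> ok w Z x e2 v a \<and>
     val x e1 v a < 8 * Z \<and>
     vc Ps Q v (upd a (val x e1 v a mod 8) (val x e1 v a div 8) (val x e2 v a))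
       (n + (cost e1 + cost e2 + 1))"
  "vc (Cnd e P P' # Ps) Q v a n \<longleftrightarrow> ok w Z x e v a \<and>
     (if val x e v a \<noteq> 0 then vc P (vc Ps Q) v a (n + (cost e + 1))
      else vc P' (vc Ps Q) v a (n + (cost e + 1)))"
  by (simp_all add: vc_def)

lemma vc_Whl:
  "vc (Whl e P # Ps) Q v a n \<longleftrightarrow> (\<exists>I. (\<exists>f::nat. I f v a n) \<and>
     (\<forall>f v a n. I f v a n \<longrightarrow> ok w Z x e v a \<and>
       (if val x e v a \<noteq> 0 then vc P (\<lambda>v a n. \<exists>f'<f. I f' v a n) v a (n + (cost e + 1))
        else vc Ps Q v a (n + (cost e + 1)))))"
  by (simp add: vc_def)

lemma vc_append: "vc (P @ P') Q = vc P (vc P' Q)"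
  by (simp add: vc_def)

text \<open>In the loop case the old invariant is kept, and only the condition after the exit is
  weakened.\<close>

lemma vc_mono:
  "vc P Q v a n \<Longrightarrow> (\<And>v a n. Q v a n \<Longrightarrow> Q' v a n) \<Longrightarrow> vc P Q' v a n"
proof (induction P arbitrary: Q Q' v a n rule: compile.induct)
  case (5 e P P' Ps)
  then show ?case by (auto simp: vc_simps split: if_splits)
next
  case (6 e P Ps)
  obtain I where I0: "(\<exists>f::nat. I f v a n) \<and> (\<forall>f v a n. I f v a n \<longrightarrow> ok w Z x e v a \<and>
       (if val x e v a \<noteq> 0 then vc P (\<lambda>v a n. \<exists>f'<f. I f' v a n) v a (n + (cost e + 1))
        else vc Ps Q v a (n + (cost e + 1))))"
    using vc_Whl[THEN iffD1, OF 6(3)] by (rule exE)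
  note I = I0[THEN conjunct1] I0[THEN conjunct2, rule_format]
  have J: "ok w Z x e v a \<and>
       (if val x e v a \<noteq> 0 then vc P (\<lambda>v a n. \<exists>f'<f. I f' v a n) v a (n + (cost e + 1))
        else vc Ps Q' v a (n + (cost e + 1)))" if "I f v a n" for f v a n
  proof -
    have "vc Ps Q v a (n + (cost e + 1)) \<Longrightarrow> vc Ps Q' v a (n + (cost e + 1))"
      by (rule 6(2)) (assumption, rule 6(4))
    then show ?thesis using I(2)[OF that] by presburger
  qed
  have "\<forall>f v a n. I f v a n \<longrightarrow> ok w Z x e v a \<and>
       (if val x e v a \<noteq> 0 then vc P (\<lambda>v a n. \<exists>f'<f. I f' v a n) v a (n + (cost e + 1))
        else vc Ps Q' v a (n + (cost e + 1)))" by (intro allI impI J)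
  with I(1) show ?case by (intro vc_Whl[THEN iffD2] exI[of _ I] conjI)
qed (auto simp: vc_simps)

end

section \<open>Correctness of the compiler\<close>

text \<open>Temporaries are left unconstrained, so any code may overwrite them. The function
  \<open>g\<close> describes the registers of the simulated program, which compiled code must leave
  alone.\<close>

definition rep :: "nat \<Rightarrow> vars \<Rightarrow> arrs \<Rightarrow> (nat \<Rightarrow> nat) \<Rightarrow> state \<Rightarrow> bool" where
  "rep Z v a g s \<longleftrightarrow> (\<forall>r. reg s (3 * r) = v r) \<and> (\<forall>r. reg s (3 * r + 2) = g r) \<and>
     (\<forall>p. mem s p = a (p mod 8) (p div 8)) \<and> extent s \<le> 8 * Z"

lemma cell_iff: "j < 8 \<Longrightarrow> p mod 8 = j \<and> p div 8 = i \<longleftrightarrow> p = 8 * i + j" for p i j :: nat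
  using mult_div_mod_eq[of 8 p] by auto

lemma reg_layout_neq [simp]:
  "3 * r \<noteq> Suc (3 * d)" "3 * r \<noteq> 3 * d + 4" "Suc (Suc (3 * r)) \<noteq> 3 * d" "3 * r \<noteq> Suc (Suc (3 * d))"
  "Suc (Suc (3 * r)) \<noteq> 3 * d + 4" "3 * d + 4 \<noteq> 3 * r"
  "3 * d + 4 \<noteq> Suc (Suc (3 * r))" "3 * d \<noteq> Suc 0" "Suc (3*r) \<noteq> 3 * d" "3 * d \<noteq> 4"
  "Suc (Suc (3 * r)) \<noteq> 4" "3 * d \<noteq> 2"
  for r d :: nat by presburger+

lemma exec_addr:
  assumes "reg s r = i" "8 * i + j < 2 ^ w" "8 < (2::nat) ^ w" "r \<noteq> 3 * d + 4"
  shows "\<exists>s'. exec w x 4 (addr j r d @ K, s) (K, s') \<and> reg s' (3 * d + 1) = 8 * i + j \<and>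
    mem s' = mem s \<and> extent s' = extent s \<and>
    (\<forall>r. r \<noteq> 3 * d + 1 \<longrightarrow> r \<noteq> 3 * d + 4 \<longrightarrow> reg s' r = reg s r)"
proof -
  have "8 * i < 2 ^ w" "j < 2 ^ w" using assms by auto
  then have "i * 8 < 2 ^ w" "i * 8 + j < 2 ^ w" using assms by auto
  then show ?thesis using assms
    by (auto simp: exec_def addr_def set_reg_def bind_return_pmf eval_nat_numeral(2,3))
qed

text \<open>The clause on lower temporaries is what the binary case lives on: the first operand
  waits in temporary \<open>d\<close> while the second is computed into temporary
  \<open>d + 1\<close>.\<close>

lemma exec_compile_exp:
  assumes "ok w Z x e v a" "rep Z v a g s" "8 * Z \<le> 2 ^ w" "8 < (2::nat) ^ w"
  shows "\<exists>s'. exec w x (cost e) (compile_exp e d @ K, s) (K, s') \<and> reg s' (3 * d + 1) = val x e v a \<and>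
    rep Z v a g s' \<and> (\<forall>d'<d. reg s' (3 * d' + 1) = reg s (3 * d' + 1))"
  using assms(1,2)
proof (induction e arbitrary: d s K)
  case (Num c)
  then show ?case
    by (auto simp: exec_def set_reg_def bind_return_pmf rep_def)
next
  case (Var r)
  then show ?case
    by (auto simp: exec_def set_reg_def bind_return_pmf rep_def)
next
  case (Bin f e1 e2)
  let ?K = "Op f (3 * d + 1) (3 * d + 1) (3 * d + 4) # K"
  obtain s1 where s1: "exec w x (cost e1) (compile_exp e1 d @ compile_exp e2 (d + 1) @ ?K, s) (compile_exp e2 (d + 1) @ ?K, s1)"
    "reg s1 (3 * d + 1) = val x e1 v a" "rep Z v a g s1" "\<forall>d'<d. reg s1 (3 * d' + 1) = reg s (3 * d' + 1)"
    using Bin.IH(1)[OF _ Bin.prems(2), where d = d and K = "compile_exp e2 (d + 1) @ ?K"] Bin.prems(1)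
    unfolding ok.simps by blast
  obtain s2 where s2: "exec w x (cost e2) (compile_exp e2 (d + 1) @ ?K, s1) (?K, s2)"
    "reg s2 (3 * (d + 1) + 1) = val x e2 v a" "rep Z v a g s2" "\<forall>d'<d + 1. reg s2 (3 * d' + 1) = reg s1 (3 * d' + 1)"
    using Bin.IH(2)[OF _ s1(3), where d = "d + 1" and K = ?K] Bin.prems(1)
    unfolding ok.simps by blast
  let ?s3 = "set_reg (3 * d + 1) (ideal f (val x e1 v a) (val x e2 v a)) s2"
  have "step w x (?K, s2) = return_pmf (K, ?s3)"
    using s1 s2 Bin.prems(1) by (simp add: eval_wop_ideal eval_nat_numeral)
  then have "exec w x 1 (?K, s2) (K, ?s3)"
    by (simp add: exec_def bind_return_pmf)
  from exec_trans[OF s1(1) exec_trans[OF s2(1) this]]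
  have "exec w x (cost (Bin f e1 e2)) (compile_exp (Bin f e1 e2) d @ K, s) (K, ?s3)"
    by (simp add: add.assoc)
  moreover have "rep Z v a g ?s3" using s2 by (auto simp: rep_def set_reg_def)
  moreover have "\<forall>d'<d. reg ?s3 (3 * d' + 1) = reg s (3 * d' + 1)"
    using s1 s2 by (auto simp: set_reg_def)
  ultimately show ?case
    by (intro exI[of _ ?s3]) (auto simp: set_reg_def)
next
  case (Inp e)
  let ?K = "Input (3 * d + 1) (3 * d + 1) # K"
  obtain s1 where s1: "exec w x (cost e) (compile_exp e d @ ?K, s) (?K, s1)"
    "reg s1 (3 * d + 1) = val x e v a" "rep Z v a g s1" "\<forall>d'<d. reg s1 (3 * d' + 1) = reg s (3 * d' + 1)"
    using Inp.IH[OF _ Inp.prems(2), where d = d and K = ?K] Inp.prems(1)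
    unfolding ok.simps by blast
  let ?s3 = "set_reg (3 * d + 1) (x ! val x e v a) s1"
  have "step w x (?K, s1) = return_pmf (K, ?s3)"
    using s1 Inp.prems(1) by simp
  then have "exec w x 1 (?K, s1) (K, ?s3)"
    by (simp add: exec_def bind_return_pmf)
  from exec_trans[OF s1(1) this]
  have "exec w x (cost (Inp e)) (compile_exp (Inp e) d @ K, s) (K, ?s3)"
    by simp
  moreover have "rep Z v a g ?s3" using s1 by (auto simp: rep_def set_reg_def)
  moreover have "\<forall>d'<d. reg ?s3 (3 * d' + 1) = reg s (3 * d' + 1)"
    using s1 by (auto simp: set_reg_def)
  ultimately show ?case
    by (intro exI[of _ ?s3]) (auto simp: set_reg_def)
next
  case (Arr j e)
  let ?K = "Load (3 * d + 1) (3 * d + 1) # K"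
  obtain s1 where s1: "exec w x (cost e) (compile_exp e d @ addr j (3 * d + 1) d @ ?K, s) (addr j (3 * d + 1) d @ ?K, s1)"
    "reg s1 (3 * d + 1) = val x e v a" "rep Z v a g s1" "\<forall>d'<d. reg s1 (3 * d' + 1) = reg s (3 * d' + 1)"
    using Arr.IH[OF _ Arr.prems(2), where d = d and K = "addr j (3 * d + 1) d @ ?K"] Arr.prems(1)
    unfolding ok.simps by blast
  let ?i = "val x e v a"
  have ij: "?i < Z" "j < 8" using Arr.prems by auto
  then have lt: "8 * ?i + j < 8 * Z" "8 * ?i + j < 2 ^ w" using assms(3) by linarith+
  obtain s2 where s2: "exec w x 4 (addr j (3 * d + 1) d @ ?K, s1) (?K, s2)" "reg s2 (3 * d + 1) = 8 * ?i + j"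
    "mem s2 = mem s1" "extent s2 = extent s1" "\<forall>r. r \<noteq> 3 * d + 1 \<longrightarrow> r \<noteq> 3 * d + 4 \<longrightarrow> reg s2 r = reg s1 r"
    using exec_addr[OF s1(2) lt(2) assms(4), of d x ?K] by auto
  let ?s3 = "touch (8 * ?i + j) (set_reg (3 * d + 1) (a j ?i) s2)"
  have m: "mem s2 (8 * ?i + j) = a j ?i" using s1(3) s2(3) ij(2) by (simp add: rep_def)
  have "step w x (?K, s2) = return_pmf (K, ?s3)"
    using s2 m by simp
  then have "exec w x 1 (?K, s2) (K, ?s3)"
    by (simp add: exec_def bind_return_pmf)
  from exec_trans[OF s1(1) exec_trans[OF s2(1) this]]
  have "exec w x (cost (Arr j e)) (compile_exp (Arr j e) d @ K, s) (K, ?s3)"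
    by simp
  moreover have "rep Z v a g ?s3" using s1 s2 lt by (auto simp: rep_def set_reg_def touch_def)
  moreover have "\<forall>d'<d. reg ?s3 (3 * d' + 1) = reg s (3 * d' + 1)"
    using s1 s2 by (auto simp: set_reg_def touch_def)
  ultimately show ?case
    by (intro exI[of _ ?s3]) (auto simp: set_reg_def touch_def)
qed

text \<open>Time, variables and arrays of the outcome are fixed before the machine state and the
  continuation \<open>K\<close> are quantified. The outcome therefore does not depend on leftover
  temporaries or on simulated registers, and pieces of code compose by instantiating
  \<open>K\<close>.\<close>

definition wp :: "nat \<Rightarrow> nat \<Rightarrow> nat list \<Rightarrow> prog \<Rightarrow> (vars \<Rightarrow> arrs \<Rightarrow> nat \<Rightarrow> bool) \<Rightarrow>
    vars \<Rightarrow> arrs \<Rightarrow> nat \<Rightarrow> bool" where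
  "wp w Z x P Q v a n \<longleftrightarrow> (\<exists>t v' a'. Q v' a' (n + t) \<and>
     (\<forall>s K g. rep Z v a g s \<longrightarrow> (\<exists>s'. rep Z v' a' g s' \<and> exec w x t (P @ K, s) (K, s'))))"

lemma wp_Nil: "Q v a n \<Longrightarrow> wp w Z x [] Q v a n"
  unfolding wp_def by (intro exI[of _ 0]) (use exec_0 in force)

lemma wp_mono: "wp w Z x P Q v a n \<Longrightarrow> (\<And>v a n. Q v a n \<Longrightarrow> Q' v a n) \<Longrightarrow> wp w Z x P Q' v a n"
  unfolding wp_def by blast

lemma wp_append:
  assumes "wp w Z x P (wp w Z x P' Q) v a n"
  shows "wp w Z x (P @ P') Q v a n"
proof -
  from assms obtain t v' a' where 1: "wp w Z x P' Q v' a' (n + t)"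
    "\<And>s K g. rep Z v a g s \<Longrightarrow> \<exists>s'. rep Z v' a' g s' \<and> exec w x t (P @ K, s) (K, s')"
    unfolding wp_def by blast
  from 1(1) obtain t2 v2 a2 where 2: "Q v2 a2 (n + t + t2)"
    "\<And>s K g. rep Z v' a' g s \<Longrightarrow> \<exists>s'. rep Z v2 a2 g s' \<and> exec w x t2 (P' @ K, s) (K, s')"
    unfolding wp_def by blast
  have "\<exists>s'. rep Z v2 a2 g s' \<and> exec w x (t + t2) ((P @ P') @ K, s) (K, s')" if "rep Z v a g s" for s K g
    using 1(2)[OF that, of "P' @ K"] 2(2)[of g _ K] exec_trans by (metis append.assoc)
  then show ?thesis unfolding wp_def using 2(1) by (metis add.assoc)
qed

lemma wpI:
  assumes "\<And>s K g. rep Z v a g s \<Longrightarrow> \<exists>s'. rep Z v' a' g s' \<and> exec w x t (P @ K, s) (P2 @ K, s')"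
    and "wp w Z x P2 Q v' a' (n + t)"
  shows "wp w Z x P Q v a n"
proof -
  from assms(2) obtain t2 v2 a2 where 2: "Q v2 a2 (n + t + t2)"
    "\<And>s K g. rep Z v' a' g s \<Longrightarrow> \<exists>s'. rep Z v2 a2 g s' \<and> exec w x t2 (P2 @ K, s) (K, s')"
    unfolding wp_def by blast
  have "\<exists>s'. rep Z v2 a2 g s' \<and> exec w x (t + t2) (P @ K, s) (K, s')" if "rep Z v a g s" for s K g
    using assms(1)[OF that, of K] 2(2)[of g _ K] exec_trans by metis
  then show ?thesis unfolding wp_def using 2(1) by (metis add.assoc)
qed

theorem vc_sound:
  assumes "8 * Z \<le> 2 ^ w" "8 < (2::nat) ^ w"
  shows "vc w Z x P Q v a n \<Longrightarrow> wp w Z x (compile P) Q v a n"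
proof (induction P arbitrary: Q v a n rule: compile.induct)
  case 1
  then show ?case by (simp add: wp_Nil vc_simps)
next
  case (2 r e Ps)
  let ?y = "val x e v a"
  show ?case unfolding compile.simps
  proof (rule wpI)
    show "wp w Z x (compile Ps) Q (v(r := ?y)) a (n + (cost e + 1))" using 2 by (auto simp: vc_simps)
    fix s K g assume rp: "rep Z v a g s"
    let ?K = "Op And (3 * r) 1 1 # compile Ps @ K"
    obtain s1 where s1: "exec w x (cost e) (compile_exp e 0 @ ?K, s) (?K, s1)"
      "reg s1 1 = ?y" "rep Z v a g s1"
      using exec_compile_exp[OF _ rp assms, of x e 0 ?K] 2(2) by (auto simp: vc_simps)
    let ?s3 = "set_reg (3 * r) ?y s1"
    have "exec w x 1 (?K, s1) (compile Ps @ K, ?s3)"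
      using s1 by (simp add: exec_def bind_return_pmf)
    from exec_trans[OF s1(1) this] have "exec w x (cost e + 1) ((compile_exp e 0 @ [Op And (3 * r) 1 1] @ compile Ps) @ K, s) (compile Ps @ K, ?s3)"
      by simp
    moreover have "rep Z (v(r := ?y)) a g ?s3" using s1(3) by (auto simp: rep_def set_reg_def)
    ultimately show "\<exists>s'. rep Z (v(r := ?y)) a g s' \<and>
        exec w x (cost e + 1) ((compile_exp e 0 @ [Op And (3 * r) 1 1] @ compile Ps) @ K, s) (compile Ps @ K, s')" by blast
  qed
next
  case (3 j e1 e2 Ps)
  let ?i = "val x e1 v a" let ?y = "val x e2 v a"
  have ij: "?i < Z" "j < 8" using 3 by (auto simp: vc_simps)
  then have lt: "8 * ?i + j < 8 * Z" "8 * ?i + j < 2 ^ w" using assms(1) by linarith+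
  show ?case unfolding compile.simps
  proof (rule wpI)
    show "wp w Z x (compile Ps) Q v (upd a j ?i ?y) (n + (cost e1 + (4 + (cost e2 + 1))))" using 3
      by (simp add: vc_simps add.commute add.left_commute)
    fix s K g assume rp: "rep Z v a g s"
    let ?K3 = "Store 1 4 # compile Ps @ K"
    let ?K2 = "compile_exp e2 1 @ ?K3"
    let ?K1 = "addr j 1 0 @ ?K2"
    obtain s1 where s1: "exec w x (cost e1) (compile_exp e1 0 @ ?K1, s) (?K1, s1)"
      "reg s1 1 = ?i" "rep Z v a g s1"
      using exec_compile_exp[OF _ rp assms, of x e1 0 ?K1] 3(2) by (auto simp: vc_simps)
    obtain s2 where s2: "exec w x 4 (?K1, s1) (?K2, s2)" "reg s2 1 = 8 * ?i + j"
      "mem s2 = mem s1" "extent s2 = extent s1" "\<forall>r. r \<noteq> 1 \<longrightarrow> r \<noteq> 4 \<longrightarrow> reg s2 r = reg s1 r"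
      using exec_addr[OF s1(2) lt(2) assms(2), of 0 x ?K2] by auto
    have rp2: "rep Z v a g s2" using s1(3) s2 by (auto simp: rep_def)
    obtain s3 where s3: "exec w x (cost e2) (?K2, s2) (?K3, s3)" "reg s3 4 = ?y" "rep Z v a g s3" "reg s3 1 = reg s2 1"
      using exec_compile_exp[OF _ rp2 assms, of x e2 1 ?K3] 3(2) by (auto simp: vc_simps)
    let ?s4 = "touch (8 * ?i + j) (s3\<lparr>mem := (mem s3)(8 * ?i + j := ?y)\<rparr>)"
    have "exec w x 1 (?K3, s3) (compile Ps @ K, ?s4)"
      using s2 s3 by (simp add: exec_def bind_return_pmf)
    from exec_trans[OF s1(1) exec_trans[OF s2(1) exec_trans[OF s3(1) this]]]
    have "exec w x (cost e1 + (4 + (cost e2 + 1))) ((compile_exp e1 0 @ addr j 1 0 @ compile_exp e2 1 @ [Store 1 4] @ compile Ps) @ K, s) (compile Ps @ K, ?s4)"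
      by simp
    moreover have "(p mod 8 = j \<and> p div 8 = ?i) \<longleftrightarrow> p = 8 * ?i + j" for p using cell_iff[OF ij(2)] .
    then have "rep Z v (upd a j ?i ?y) g ?s4" using s3 lt(1) by (auto simp: rep_def touch_def upd_apply)
    ultimately show "\<exists>s'. rep Z v (upd a j ?i ?y) g s' \<and>
        exec w x (cost e1 + (4 + (cost e2 + 1))) ((compile_exp e1 0 @ addr j 1 0 @ compile_exp e2 1 @ [Store 1 4] @ compile Ps) @ K, s) (compile Ps @ K, s')" by blast
  qed
next
  case (4 e1 e2 Ps)
  let ?i = "val x e1 v a" let ?y = "val x e2 v a"
  show ?case unfolding compile.simps
  proof (rule wpI)
    show "wp w Z x (compile Ps) Q v (upd a (?i mod 8) (?i div 8) ?y) (n + (cost e1 + (cost e2 + 1)))" using 4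
      by (simp add: vc_simps add.commute add.left_commute)
    fix s K g assume rp: "rep Z v a g s"
    let ?K3 = "Store 1 4 # compile Ps @ K"
    let ?K2 = "compile_exp e2 1 @ ?K3"
    obtain s1 where s1: "exec w x (cost e1) (compile_exp e1 0 @ ?K2, s) (?K2, s1)"
      "reg s1 1 = ?i" "rep Z v a g s1"
      using exec_compile_exp[OF _ rp assms, of x e1 0 ?K2] 4(2) by (auto simp: vc_simps)
    obtain s3 where s3: "exec w x (cost e2) (?K2, s1) (?K3, s3)" "reg s3 4 = ?y" "rep Z v a g s3" "reg s3 1 = reg s1 1"
      using exec_compile_exp[OF _ s1(3) assms, of x e2 1 ?K3] 4(2) by (auto simp: vc_simps)
    let ?s4 = "touch ?i (s3\<lparr>mem := (mem s3)(?i := ?y)\<rparr>)"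
    have "exec w x 1 (?K3, s3) (compile Ps @ K, ?s4)"
      using s1 s3 by (simp add: exec_def bind_return_pmf)
    from exec_trans[OF s1(1) exec_trans[OF s3(1) this]]
    have "exec w x (cost e1 + (cost e2 + 1)) ((compile_exp e1 0 @ compile_exp e2 1 @ [Store 1 4] @ compile Ps) @ K, s) (compile Ps @ K, ?s4)"
      by simp
    moreover have "(p mod 8 = ?i mod 8 \<and> p div 8 = ?i div 8) \<longleftrightarrow> p = ?i" for p
      by (metis div_mult_mod_eq)
    then have "rep Z v (upd a (?i mod 8) (?i div 8) ?y) g ?s4" using s3 4(2) by (auto simp: vc_simps rep_def touch_def upd_apply)
    ultimately show "\<exists>s'. rep Z v (upd a (?i mod 8) (?i div 8) ?y) g s' \<and>
        exec w x (cost e1 + (cost e2 + 1)) ((compile_exp e1 0 @ compile_exp e2 1 @ [Store 1 4] @ compile Ps) @ K, s) (compile Ps @ K, s')" by blast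
  qed
next
  case (5 e P P' Ps)
  let ?P = "if val x e v a \<noteq> 0 then compile P else compile P'"
  show ?case unfolding compile.simps
  proof (rule wpI)
    show "wp w Z x (?P @ compile Ps) Q v a (n + (cost e + 1))"
    proof (rule wp_append)
      show "wp w Z x ?P (wp w Z x (compile Ps) Q) v a (n + (cost e + 1))"
        using 5(1,2)[of "vc w Z x Ps Q" v a "n + (cost e + 1)"] 5(3,4)
        by (cases "val x e v a = 0") (auto simp: vc_simps elim!: wp_mono)
    qed
    fix s K g assume rp: "rep Z v a g s"
    let ?K = "Cond 1 (compile P) (compile P') # compile Ps @ K"
    obtain s1 where s1: "exec w x (cost e) (compile_exp e 0 @ ?K, s) (?K, s1)"
      "reg s1 1 = val x e v a" "rep Z v a g s1"
      using exec_compile_exp[OF _ rp assms, of x e 0 ?K] 5 by (auto simp: vc_simps)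
    have "exec w x 1 (?K, s1) ((?P @ compile Ps) @ K, s1)"
      using s1 by (simp add: exec_def bind_return_pmf)
    from exec_trans[OF s1(1) this]
    have "exec w x (cost e + 1) ((compile_exp e 0 @ [Cond 1 (compile P) (compile P')] @ compile Ps) @ K, s) ((?P @ compile Ps) @ K, s1)"
      by simp
    then show "\<exists>s'. rep Z v a g s' \<and>
       exec w x (cost e + 1) ((compile_exp e 0 @ [Cond 1 (compile P) (compile P')] @ compile Ps) @ K, s) ((?P @ compile Ps) @ K, s')"
      using s1(3) by blast
  qed
next
  case (6 e P Ps)
  obtain I where I0: "(\<exists>f::nat. I f v a n) \<and> (\<forall>f v a n. I f v a n \<longrightarrow> ok w Z x e v a \<and>
       (if val x e v a \<noteq> 0 then vc w Z x P (\<lambda>v a n. \<exists>f'<f. I f' v a n) v a (n + (cost e + 1))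
        else vc w Z x Ps Q v a (n + (cost e + 1))))"
    using vc_Whl[THEN iffD1, OF 6(3)] by (rule exE)
  note I = I0[THEN conjunct1] I0[THEN conjunct2, rule_format]
  let ?W = "While 1 (compile P @ compile_exp e 0)"
  have "I f v a n \<Longrightarrow> wp w Z x (compile (Whl e P # Ps)) Q v a n" for f v a n
  proof (induction f arbitrary: v a n rule: less_induct)
    case (less f)
    note I' = I(2)[OF less(2)]
    \<comment> \<open>A successful test of \<open>While\<close> leaves the body, the guard and the
      same \<open>While\<close>, which is the body followed by the whole compiled loop. The
      induction hypothesis thus applies after the body, at a smaller measure.\<close>
    let ?P = "if val x e v a \<noteq> 0 then compile P @ compile (Whl e P # Ps) else compile Ps"
    show ?case unfolding compile.simps
    proof (rule wpI)
      show "wp w Z x ?P Q v a (n + (cost e + 1))"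
      proof (cases "val x e v a \<noteq> 0")
        case True
        then have "wp w Z x (compile P) (\<lambda>v a n. \<exists>f'<f. I f' v a n) v a (n + (cost e + 1))"
          using I' 6(1) by auto
        then have "wp w Z x (compile P) (wp w Z x (compile (Whl e P # Ps)) Q) v a (n + (cost e + 1))"
          by (rule wp_mono) (use less in blast)
        then show ?thesis using True by (simp add: wp_append del: compile.simps)
      next
        case False
        then show ?thesis using I' 6(2) by auto
      qed
      fix s K g assume rp: "rep Z v a g s"
      let ?K = "?W # compile Ps @ K"
      obtain s1 where s1: "exec w x (cost e) (compile_exp e 0 @ ?K, s) (?K, s1)"
        "reg s1 1 = val x e v a" "rep Z v a g s1"
        using exec_compile_exp[OF _ rp assms, of x e 0 ?K] I' by auto
      have "exec w x 1 (?K, s1) (?P @ K, s1)"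
        using s1 by (simp add: exec_def bind_return_pmf)
      from exec_trans[OF s1(1) this]
      have "exec w x (cost e + 1) ((compile_exp e 0 @ [?W] @ compile Ps) @ K, s) (?P @ K, s1)"
        by simp
      then show "\<exists>s'. rep Z v a g s' \<and>
         exec w x (cost e + 1) ((compile_exp e 0 @ [?W] @ compile Ps) @ K, s) (?P @ K, s')"
        using s1(3) by blast
    qed
  qed
  then show ?case using I(1) by blast
qed

section \<open>Counting loops\<close>

definition For :: "nat \<Rightarrow> exp \<Rightarrow> stm list \<Rightarrow> stm" where
  "For r e P = Whl (Bin Less (Var r) e) (P @ [Asg r (Bin Add (Var r) (Num 1))])"

text \<open>The measure is \<open>hi - i\<close>. The numbers are exact costs:
  \<open>cost e + 3\<close> for evaluating and testing the guard, and \<open>4\<close> for the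
  increment.\<close>

lemma vc_For:
  assumes "I lo v a n" "v r = lo" "lo \<le> hi"
    and bound: "\<And>i v a n. I i v a n \<Longrightarrow> v r = i \<Longrightarrow> lo \<le> i \<Longrightarrow> i \<le> hi \<Longrightarrow> ok w Z x e v a \<and> val x e v a = hi"
    and "hi < 2 ^ w" "1 < (2::nat) ^ w"
    and body: "\<And>i v a n. I i v a n \<Longrightarrow> v r = i \<Longrightarrow> lo \<le> i \<Longrightarrow> i < hi \<Longrightarrow>
      vc w Z x P (\<lambda>v a n. v r = i \<and> I (Suc i) (v(r := Suc i)) a (n + 4)) v a (n + (cost e + 3))"
    and fin: "\<And>v a n. I hi v a n \<Longrightarrow> v r = hi \<Longrightarrow> vc w Z x Ps Q v a (n + (cost e + 3))"
  shows "vc w Z x (For r e P # Ps) Q v a n"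
  unfolding For_def
proof (rule vc_Whl[THEN iffD2],
    rule exI[of _ "\<lambda>f v a n. \<exists>i. lo \<le> i \<and> i \<le> hi \<and> f = hi - i \<and> v r = i \<and> I i v a n"],
    intro conjI allI impI)
  let ?J = "\<lambda>f v a n. \<exists>i. lo \<le> i \<and> i \<le> hi \<and> f = hi - i \<and> v r = i \<and> I i v a n"
  let ?e = "Bin Less (Var r) e"
  show "\<exists>f. ?J f v a n" using assms by blast
  fix f v a n assume "?J f v a n"
  then obtain i where i: "lo \<le> i" "i \<le> hi" "f = hi - i" "v r = i" "I i v a n" by blast
  note b = bound[OF i(5,4,1,2)]
  have ce: "n + (cost ?e + 1) = n + (cost e + 3)" by simp
  show "ok w Z x ?e v a" using b by simp
  show "if val x ?e v a \<noteq> 0 then vc w Z x (P @ [Asg r (Bin Add (Var r) (Num 1))])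
      (\<lambda>v a n. \<exists>f'<f. ?J f' v a n) v a (n + (cost ?e + 1)) else vc w Z x Ps Q v a (n + (cost ?e + 1))"
  proof (cases "i < hi")
    case True
    have "vc w Z x P (vc w Z x [Asg r (Bin Add (Var r) (Num 1))] (\<lambda>v a n. \<exists>f'<f. ?J f' v a n)) v a (n + (cost e + 3))"
    proof (rule vc_mono[OF body[OF i(5,4,1) True]])
      fix v a n assume "v r = i \<and> I (Suc i) (v(r := Suc i)) a (n + 4)"
      then show "vc w Z x [Asg r (Bin Add (Var r) (Num 1))] (\<lambda>v a n. \<exists>f'<f. ?J f' v a n) v a n"
        using True i assms(5,6)
        by (auto simp: vc_simps eval_nat_numeral intro!: exI[of _ "hi - Suc i"])
    qed
    then show ?thesis using True b i(4) unfolding ce vc_append by simp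
  next
    case False
    then have "i = hi" using i by simp
    then show ?thesis using fin[of v a n] i b unfolding ce by simp
  qed
qed

text \<open>The simulated program finds its input in array \<open>2\<close>, the length of which is in variable \<open>14\<close>,
  and uses array \<open>3\<close> as its memory. Reading the input out of range yields \<open>0\<close> without touching any
  memory, hence the comparison.\<close>

primrec simulate :: "nat com \<Rightarrow> prog" where
  "simulate (Lit r c) = [Lit (3 * r + 2) c]"
| "simulate (Op f r a b) = [Op f (3 * r + 2) (3 * a + 2) (3 * b + 2)]"
| "simulate (Input r a) = [Op Less 1 (3 * a + 2) 42,
     Cond 1 (addr 2 (3 * a + 2) 0 @ [Load (3 * r + 2) 1]) [Lit (3 * r + 2) 0]]"
| "simulate (Load r a) = addr 3 (3 * a + 2) 0 @ [Load (3 * r + 2) 1]"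
| "simulate (Store a r) = addr 3 (3 * a + 2) 0 @ [Store 1 (3 * r + 2)]"
| "simulate (Rand r) = []"
| "simulate (Cond r P Q) = [Cond (3 * r + 2) (concat (map simulate P)) (concat (map simulate Q))]"
| "simulate (While r P) = [While (3 * r + 2) (concat (map simulate P))]"

section \<open>Correctness of the simulation\<close>

lemma step_extent: "(K', s') \<in> set_pmf (step w x (K, s)) \<Longrightarrow> extent s \<le> extent s'"
  by (cases "(w, x, (K, s))" rule: step.cases) (auto simp: set_reg_def touch_def)

text \<open>The space bound of the given algorithm speaks of final states only. Monotonicity carries
  it back to every access on the way, as needed to keep the simulated addresses in range.\<close>

lemma steps_extent: "(K', s') \<in> set_pmf (steps w x t (K, s)) \<Longrightarrow> extent s \<le> extent s'"
proof (induction t arbitrary: K s)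
  case (Suc t)
  then obtain K1 s1 where "(K1, s1) \<in> set_pmf (step w x (K, s))" "(K', s') \<in> set_pmf (steps w x t (K1, s1))"
    by auto
  then show ?case using Suc.IH step_extent le_trans by blast
qed simp

lemma exec_addr_rep:
  assumes "rep Z v a g s" "reg s r = i" "i < Z" "j < 8" "8 * Z \<le> 2 ^ w" "8 < (2::nat) ^ w" "r \<noteq> 4"
  shows "\<exists>s'. exec w x 4 (addr j r 0 @ K, s) (K, s') \<and> reg s' 1 = 8 * i + j \<and> rep Z v a g s'"
proof -
  have "8 * i + j < 2 ^ w" using assms by linarith
  from exec_addr[OF assms(2) this assms(6), of 0 x K] assms(7) obtain s' where
    s': "exec w x 4 (addr j r 0 @ K, s) (K, s')" "reg s' 1 = 8 * i + j"
    "mem s' = mem s" "extent s' = extent s" "\<forall>r. r \<noteq> 1 \<longrightarrow> r \<noteq> 4 \<longrightarrow> reg s' r = reg s r"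
    by auto
  then have "rep Z v a g s'" using assms(1) by (auto simp: rep_def)
  then show ?thesis using s' by blast
qed

lemma array_lt_8: "2 < (8::nat)" "3 < (8::nat)" by simp_all

lemma cell_mod_div: "j < 8 \<Longrightarrow> (8 * i + j) mod 8 = j" "j < 8 \<Longrightarrow> (8 * i + j) div 8 = i" for i j :: nat
  using cell_iff[of j "8 * i + j" i] by auto

text \<open>Both programs run with the same word size, so arithmetic carries over unchanged. Seven
  steps are the price of the dearest command, an \<open>Input\<close> within range: comparison,
  branch, four steps of address arithmetic and the load.\<close>

lemma exec_simulate_step:
  assumes st: "step w y (c # K, sA) = return_pmf (K1, sA1)" and rf: "rand_free c"
    and ext: "extent sA1 \<le> Z"
    and rp: "rep Z v (a(3 := mem sA)) (reg sA) s"
    and inp: "\<And>i. i < length y \<Longrightarrow> a 2 i = y ! i \<and> y ! i < 2 ^ w" "v 14 = length y" "length y \<le> Z"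
    and w: "8 * Z \<le> 2 ^ w" "8 < (2::nat) ^ w"
  shows "\<exists>t\<le>7. \<exists>s1. exec w x t (concat (map simulate (c # K)) @ R, s) (concat (map simulate K1) @ R, s1) \<and>
    rep Z v (a(3 := mem sA1)) (reg sA1) s1"
proof (cases c)
  case (Lit r c)
  let ?s = "set_reg (3 * r + 2) (c mod 2 ^ w) s"
  have "exec w x 1 (concat (map simulate (Lit r c # K)) @ R, s) (concat (map simulate K1) @ R, ?s) \<and>
      rep Z v (a(3 := mem sA1)) (reg sA1) ?s"
    using st rp Lit by (auto simp: exec_def bind_return_pmf rep_def set_reg_def)
  then show ?thesis using Lit by (intro exI[of _ 1] conjI exI) auto
next
  case (Op f r b d)
  let ?s = "set_reg (3 * r + 2) (eval_wop w f (reg sA b) (reg sA d)) s"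
  have "exec w x 1 (concat (map simulate (Op f r b d # K)) @ R, s) (concat (map simulate K1) @ R, ?s) \<and>
      rep Z v (a(3 := mem sA1)) (reg sA1) ?s"
    using st rp Op by (auto simp: exec_def bind_return_pmf rep_def set_reg_def)
  then show ?thesis using Op by (intro exI[of _ 1] conjI exI) auto
next
  case (Input r b)
  let ?i = "reg sA b"
  let ?K = "concat (map simulate K) @ R"
  let ?P = "addr 2 (3 * b + 2) 0 @ [Load (3 * r + 2) 1]"
  let ?C = "Cond 1 ?P [Lit (3 * r + 2) 0]"
  have K1: "K1 = K" using st Input by simp
  \<comment> \<open>Register \<open>42\<close> is \<open>3 * 14\<close>, the home of variable
    \<open>14\<close>.\<close>
  have r42: "reg s 42 = length y"
  proof -
    have "\<And>r. reg s (3 * r) = v r" using rp by (auto simp: rep_def)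
    from this[of 14] show ?thesis using inp(2) by simp
  qed
  let ?s1 = "set_reg 1 (if ?i < length y then 1 else 0) s"
  have rp1: "rep Z v (a(3 := mem sA)) (reg sA) ?s1" using rp by (auto simp: rep_def set_reg_def)
  have rb: "reg s (3 * b + 2) = ?i" using rp by (auto simp: rep_def)
  have e1: "exec w x 1 (concat (map simulate (Input r b # K)) @ R, s) (?C # ?K, ?s1)"
    using r42 rb by (simp add: exec_def bind_return_pmf)
  show ?thesis
  proof (cases "?i < length y")
    case True
    then have e2: "exec w x 1 (?C # ?K, ?s1) (addr 2 (3 * b + 2) 0 @ Load (3 * r + 2) 1 # ?K, ?s1)"
      by (simp add: exec_def bind_return_pmf set_reg_def)
    have rb1: "reg ?s1 (3 * b + 2) = ?i" using rb by (simp add: set_reg_def)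
    obtain s2 where s2: "exec w x 4 (addr 2 (3 * b + 2) 0 @ Load (3 * r + 2) 1 # ?K, ?s1) (Load (3 * r + 2) 1 # ?K, s2)"
      "reg s2 1 = 8 * ?i + 2" "rep Z v (a(3 := mem sA)) (reg sA) s2"
      using exec_addr_rep[OF rp1 rb1 _ _ w, of 2 x "Load (3 * r + 2) 1 # ?K"] True inp(3) by auto
    let ?s3 = "touch (8 * ?i + 2) (set_reg (3 * r + 2) (y ! ?i) s2)"
    have "mem s2 (8 * ?i + 2) = (a(3 := mem sA)) ((8 * ?i + 2) mod 8) ((8 * ?i + 2) div 8)"
      using s2(3) unfolding rep_def by blast
    also have "\<dots> = y ! ?i" using inp(1)[OF True] unfolding cell_mod_div[OF array_lt_8(1)] by simp
    finally have m: "mem s2 (8 * ?i + 2) = y ! ?i" .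
    then have e3: "exec w x 1 (Load (3 * r + 2) 1 # ?K, s2) (?K, ?s3)"
      using s2(2) by (simp add: exec_def bind_return_pmf)
    have "rep Z v (a(3 := mem sA1)) (reg sA1) ?s3"
      using s2 st Input True inp(1)[OF True] inp(3) by (auto simp: rep_def set_reg_def touch_def)
    moreover have "exec w x (1 + (1 + (4 + 1))) (concat (map simulate (Input r b # K)) @ R, s) (concat (map simulate K1) @ R, ?s3)"
      using exec_trans[OF e1 exec_trans[OF e2 exec_trans[OF s2(1) e3]]] K1 by simp
    ultimately show ?thesis using Input by (intro exI[of _ 7]) auto
  next
    case False
    let ?s3 = "set_reg (3 * r + 2) 0 ?s1"
    have e2: "exec w x 2 (?C # ?K, ?s1) (?K, ?s3)"
      using False by (simp add: exec_def bind_return_pmf set_reg_def eval_nat_numeral)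
    have "rep Z v (a(3 := mem sA1)) (reg sA1) ?s3"
      using st Input False rp1 by (auto simp: rep_def set_reg_def)
    moreover have "exec w x (1 + 2) (concat (map simulate (Input r b # K)) @ R, s) (concat (map simulate K1) @ R, ?s3)"
      using exec_trans[OF e1 e2] K1 by simp
    ultimately show ?thesis using Input by (intro exI[of _ "1 + 2"]) auto
  qed
next
  case (Load r b)
  let ?i = "reg sA b"
  let ?K = "concat (map simulate K) @ R"
  have K1: "K1 = K" using st Load by simp
  have rb: "reg s (3 * b + 2) = ?i" using rp by (auto simp: rep_def)
  have iZ: "?i < Z" using ext st Load by (auto simp: touch_def)
  obtain s2 where s2: "exec w x 4 (addr 3 (3 * b + 2) 0 @ Load (3 * r + 2) 1 # ?K, s) (Load (3 * r + 2) 1 # ?K, s2)"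
      "reg s2 1 = 8 * ?i + 3" "rep Z v (a(3 := mem sA)) (reg sA) s2"
    using exec_addr_rep[OF rp rb iZ _ w, of 3 x "Load (3 * r + 2) 1 # ?K"] by auto
  let ?s3 = "touch (8 * ?i + 3) (set_reg (3 * r + 2) (mem sA ?i) s2)"
  have "mem s2 (8 * ?i + 3) = (a(3 := mem sA)) ((8 * ?i + 3) mod 8) ((8 * ?i + 3) div 8)"
    using s2(3) unfolding rep_def by blast
  also have "\<dots> = mem sA ?i" unfolding cell_mod_div[OF array_lt_8(2)] by simp
  finally have e3: "exec w x 1 (Load (3 * r + 2) 1 # ?K, s2) (?K, ?s3)"
    using s2(2) by (simp add: exec_def bind_return_pmf)
  have "rep Z v (a(3 := mem sA1)) (reg sA1) ?s3"
    using s2 st Load iZ by (auto simp: rep_def set_reg_def touch_def)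
  moreover have "exec w x (4 + 1) (concat (map simulate (Load r b # K)) @ R, s) (concat (map simulate K1) @ R, ?s3)"
    using exec_trans[OF s2(1) e3] K1 by simp
  ultimately show ?thesis using Load by (intro exI[of _ 5]) auto
next
  case (Store b r)
  let ?i = "reg sA b"
  let ?K = "concat (map simulate K) @ R"
  have K1: "K1 = K" using st Store by simp
  have rb: "reg s (3 * b + 2) = ?i" using rp by (auto simp: rep_def)
  have iZ: "?i < Z" using ext st Store by (auto simp: touch_def)
  obtain s2 where s2: "exec w x 4 (addr 3 (3 * b + 2) 0 @ Store 1 (3 * r + 2) # ?K, s) (Store 1 (3 * r + 2) # ?K, s2)"
      "reg s2 1 = 8 * ?i + 3" "rep Z v (a(3 := mem sA)) (reg sA) s2"
    using exec_addr_rep[OF rp rb iZ _ w, of 3 x "Store 1 (3 * r + 2) # ?K"] by auto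
  let ?s3 = "touch (8 * ?i + 3) (s2\<lparr>mem := (mem s2)(8 * ?i + 3 := reg sA r)\<rparr>)"
  have "reg s2 (3 * r + 2) = reg sA r" using s2(3) by (simp add: rep_def)
  then have e3: "exec w x 1 (Store 1 (3 * r + 2) # ?K, s2) (?K, ?s3)"
    using s2(2) by (simp add: exec_def bind_return_pmf)
  have "mem ?s3 p = (a(3 := mem sA1)) (p mod 8) (p div 8)" for p
    using s2(3) st Store cell_iff[of 3 p ?i] by (auto simp: rep_def touch_def)
  then have "rep Z v (a(3 := mem sA1)) (reg sA1) ?s3"
    using s2(3) st Store iZ by (auto simp: rep_def touch_def)
  moreover have "exec w x (4 + 1) (concat (map simulate (Store b r # K)) @ R, s) (concat (map simulate K1) @ R, ?s3)"
    using exec_trans[OF s2(1) e3] K1 by simp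
  ultimately show ?thesis using Store by (intro exI[of _ 5]) auto
next
  case (Rand r)
  then show ?thesis using rf by simp
next
  case (Cond r P Q)
  have "reg s (3 * r + 2) = reg sA r" using rp by (simp add: rep_def)
  then have "exec w x 1 (concat (map simulate (Cond r P Q # K)) @ R, s) (concat (map simulate K1) @ R, s) \<and>
      rep Z v (a(3 := mem sA1)) (reg sA1) s"
    using st rp Cond by (auto simp: exec_def bind_return_pmf)
  then show ?thesis using Cond by (intro exI[of _ 1] conjI exI) auto
next
  case (While r P)
  have "reg s (3 * r + 2) = reg sA r" using rp by (simp add: rep_def)
  then have "exec w x 1 (concat (map simulate (While r P # K)) @ R, s) (concat (map simulate K1) @ R, s) \<and>
      rep Z v (a(3 := mem sA1)) (reg sA1) s"
    using st rp While by (auto simp: exec_def bind_return_pmf)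
  then show ?thesis using While by (intro exI[of _ 1] conjI exI) auto
qed

lemma rand_free_step:
  assumes "\<forall>c\<in>set (c # K). rand_free c"
  shows "\<exists>K1 s1. step w y (c # K, s) = return_pmf (K1, s1) \<and> (\<forall>c\<in>set K1. rand_free c)"
  using assms by (cases c) auto

lemma exec_simulate:
  assumes "\<forall>c\<in>set K. rand_free c"
    and "\<forall>(K', s') \<in> set_pmf (steps w y t (K, sA)). K' = [] \<and> extent s' \<le> Z"
    and "rep Z v (a(3 := mem sA)) (reg sA) s"
    and inp: "\<And>i. i < length y \<Longrightarrow> a 2 i = y ! i \<and> y ! i < 2 ^ w" "v 14 = length y" "length y \<le> Z"
    and w: "8 * Z \<le> 2 ^ w" "8 < (2::nat) ^ w"
  shows "\<exists>sA' t' s'. steps w y t (K, sA) = return_pmf ([], sA') \<and> t' \<le> 7 * t \<and>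
    exec w x t' (concat (map simulate K) @ R, s) (R, s') \<and> rep Z v (a(3 := mem sA')) (reg sA') s'"
  using assms(1-3)
proof (induction t arbitrary: K sA s)
  case 0
  then show ?case by (intro exI[of _ sA] exI[of _ 0] exI[of _ s]) (auto simp: exec_0)
next
  case (Suc t)
  show ?case
  proof (cases K)
    case Nil
    \<comment> \<open>A halted configuration idles, so this step costs nothing in the
      simulation.\<close>
    then have eq: "steps w y (Suc t) (K, sA) = steps w y t (K, sA)"
      by (simp add: bind_return_pmf)
    obtain sA' t' s' where "steps w y t (K, sA) = return_pmf ([], sA')" "t' \<le> 7 * t"
      "exec w x t' (concat (map simulate K) @ R, s) (R, s')" "rep Z v (a(3 := mem sA')) (reg sA') s'"
      using Suc.IH[OF Suc.prems(1) Suc.prems(2)[unfolded eq] Suc.prems(3)] by blast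
    moreover from this(2) have "t' \<le> 7 * Suc t" by simp
    ultimately show ?thesis unfolding eq by blast
  next
    case (Cons c K0)
    obtain K1 s1 where s1: "step w y (c # K0, sA) = return_pmf (K1, s1)" "\<forall>c\<in>set K1. rand_free c"
      using rand_free_step[of c K0 w y sA] Suc.prems(1) Cons by blast
    then have eq: "steps w y (Suc t) (K, sA) = steps w y t (K1, s1)"
      using Cons by (simp add: bind_return_pmf)
    obtain K2 s2 where K2: "(K2, s2) \<in> set_pmf (steps w y t (K1, s1))"
      using set_pmf_not_empty[of "steps w y t (K1, s1)"] by auto
    have "extent s1 \<le> Z"
      using bspec[OF Suc.prems(2)[unfolded eq] K2] steps_extent[OF K2] by simp
    then obtain t1 s' where t1: "t1 \<le> 7" "exec w x t1 (concat (map simulate (c # K0)) @ R, s) (concat (map simulate K1) @ R, s')"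
      "rep Z v (a(3 := mem s1)) (reg s1) s'"
      using exec_simulate_step[OF s1(1) _ _ Suc.prems(3) inp w, of x R] Suc.prems(1) Cons by auto
    obtain sA' t' s'' where "steps w y t (K1, s1) = return_pmf ([], sA')" "t' \<le> 7 * t"
      "exec w x t' (concat (map simulate K1) @ R, s') (R, s'')" "rep Z v (a(3 := mem sA')) (reg sA') s''"
      using Suc.IH[OF s1(2) Suc.prems(2)[unfolded eq] t1(3)] by blast
    moreover from this(3) t1(2) have "exec w x (t1 + t') (concat (map simulate (c # K0)) @ R, s) (R, s'')"
      by (rule exec_trans[rotated])
    moreover have "t1 + t' \<le> 7 * Suc t" using t1(1) calculation(2) by simp
    ultimately show ?thesis unfolding Cons eq[unfolded Cons] by blast
  qed
qed

section \<open>The kernel of a graph\<close>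

lemma concat_nth_sum:
  "u < length L \<Longrightarrow> i < length (L ! u) \<Longrightarrow> concat L ! ((\<Sum>j<u. length (L ! j)) + i) = L ! u ! i"
proof (induction L arbitrary: u)
  case (Cons xs L)
  then show ?case
  proof (cases u)
    case (Suc u')
    then have "(\<Sum>j<u. length ((xs # L) ! j)) = length xs + (\<Sum>j<u'. length (L ! j))"
      by (simp add: sum.lessThan_Suc_shift del: sum.lessThan_Suc)
    then show ?thesis using Cons Suc by (simp add: nth_append add.assoc)
  qed (simp add: nth_append)
qed simp

lemma length_concat_sum: "length (concat L) = (\<Sum>j<length L. length (L ! j))"
  by (induction L) (simp_all add: sum.lessThan_Suc_shift del: sum.lessThan_Suc)

lemma concat_index_cases:
  "p < (\<Sum>j<m. length (L ! j)) \<Longrightarrow> \<exists>u<m. \<exists>i<length (L ! u). p = (\<Sum>j<u. length (L ! j)) + i"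
proof (induction m)
  case (Suc m)
  show ?case
  proof (cases "p < (\<Sum>j<m. length (L ! j))")
    case True
    then show ?thesis using Suc.IH less_SucI by metis
  next
    case False
    then show ?thesis using Suc.prems
      by (intro exI[of _ m] conjI exI[of _ "p - (\<Sum>j<m. length (L ! j))"]) auto
  qed
qed simp

text \<open>The summand \<open>length L + 3\<close> accounts for the words in front of the lists:
  \<open>k\<close>, the number of vertices and \<open>length L + 1\<close> addresses.\<close>

definition offset :: "nat list list \<Rightarrow> nat \<Rightarrow> nat" where
  "offset L u = length L + 3 + (\<Sum>j<u. length (L ! j))"

lemma offset_Suc: "offset L (Suc u) = offset L u + length (L ! u)"
  by (simp add: offset_def)

lemma offset_mono: "u \<le> u' \<Longrightarrow> offset L u \<le> offset L u'"
  by (auto simp: offset_def intro!: sum_mono2)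

lemma length_encode: "length (encode L k) = offset L (length L)"
  by (simp add: encode_def offset_def length_concat_sum)

lemma encode_nth:
  "encode L k ! 0 = k" "encode L k ! Suc 0 = length L"
  "u \<le> length L \<Longrightarrow> encode L k ! (u + 2) = offset L u"
  "u < length L \<Longrightarrow> i < length (L ! u) \<Longrightarrow> encode L k ! (offset L u + i) = L ! u ! i"
proof -
  show "encode L k ! 0 = k" "encode L k ! Suc 0 = length L" by (simp_all add: encode_def)
  show "encode L k ! (u + 2) = offset L u" if "u \<le> length L"
    using that by (simp add: encode_def offset_def nth_append del: upt_Suc)
  assume u: "u < length L" "i < length (L ! u)"
  have "encode L k ! (offset L u + i) = concat L ! ((\<Sum>j<u. length (L ! j)) + i)"
    by (simp add: encode_def offset_def nth_append del: upt_Suc)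
  then show "encode L k ! (offset L u + i) = L ! u ! i" using concat_nth_sum[OF u] by simp
qed

text \<open>Splits the positions into header, address table and lists, for statements about all
  words of an encoded graph.\<close>

lemma encode_index_cases:
  assumes "p < length (encode L k)"
  obtains "p = 0" | "p = 1" | u where "u \<le> length L" "p = u + 2"
    | u i where "u < length L" "i < length (L ! u)" "p = offset L u + i"
proof (cases "p < length L + 3")
  case True
  then consider "p = 0" | "p = 1" | "p - 2 \<le> length L" "p = p - 2 + 2" by linarith
  then show ?thesis using that(1-3) by cases blast+
next
  case False
  then have "p - (length L + 3) < (\<Sum>j<length L. length (L ! j))"
    using assms by (simp add: length_encode offset_def)
  from concat_index_cases[OF this] obtain u i where ui: "u < length L" "i < length (L ! u)"
    "p - (length L + 3) = (\<Sum>j<u. length (L ! j)) + i" by blast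
  with False have "p = offset L u + i" by (simp add: offset_def)
  then show ?thesis using that(4) ui by blast
qed

section \<open>Greedy matchings, and matchings stored as flat arrays\<close>

lemma k_matching_of_card_ge:
  assumes "M \<subseteq> E" "finite M" "k \<le> card M" "\<forall>e\<in>M. \<forall>f\<in>M. e \<noteq> f \<longrightarrow> e \<inter> f = {}"
  shows "\<exists>M. k_matching E k M"
proof -
  obtain M' where "M' \<subseteq> M" "card M' = k" "finite M'"
    using obtain_subset_with_card_n[OF assms(3)] by blast
  then show ?thesis using assms unfolding k_matching_def by (intro exI[of _ M']) blast
qed

text \<open>Greedy choice: an edge meets at most \<open>2 * D\<close> edges, itself included. Once
  these are removed, enough edges remain for the other \<open>k - 1\<close> choices.\<close>

lemma k_matching_of_many_edges:
  assumes "finite F" "\<forall>e\<in>F. \<exists>u v. e = {u, v}" "\<forall>v. card {e \<in> F. v \<in> e} \<le> D" "0 < D"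
    "2 * D * k \<le> card F"
  shows "\<exists>M. k_matching F k M"
  using assms(1,2,3,5)
proof (induction k arbitrary: F)
  case 0
  then show ?case unfolding k_matching_def by (intro exI[of _ "{}"]) simp
next
  case (Suc k)
  then have "F \<noteq> {}" using assms(4) by auto
  then obtain u v where e: "{u, v} \<in> F" using Suc.prems(2) by (metis all_not_in_conv)
  define R where "R = {e \<in> F. u \<in> e} \<union> {e \<in> F. v \<in> e}"
  have R: "R \<subseteq> F" "{u, v} \<in> R" using e by (auto simp: R_def)
  have "card R \<le> card {e \<in> F. u \<in> e} + card {e \<in> F. v \<in> e}" unfolding R_def by (rule card_Un_le)
  also have "\<dots> \<le> 2 * D" using Suc.prems(3) by (metis add_mono mult_2)
  finally have "2 * D * k \<le> card (F - R)"
    using Suc.prems(1,4) R(1) by (simp add: card_Diff_subset finite_subset)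
  moreover have "card {e \<in> F - R. v \<in> e} \<le> D" for v
    using card_mono[of "{e \<in> F. v \<in> e}" "{e \<in> F - R. v \<in> e}"] Suc.prems(1,3) le_trans by fastforce
  ultimately obtain M where M: "k_matching (F - R) k M"
    using Suc.IH[of "F - R"] Suc.prems(1,2) by auto
  have new: "{u, v} \<inter> f = {}" if "f \<in> M" for f
    using that M unfolding k_matching_def R_def by auto
  then have "{u, v} \<notin> M" by blast
  then have "k_matching F (Suc k) (insert {u, v} M)"
    using M e new unfolding k_matching_def by auto
  then show ?case by blast
qed

text \<open>With its converse below this reduces the output format to pairwise different endpoints,
  so that loop invariants can speak of the injectivity of an array instead of disjoint
  edges.\<close>

lemma k_matching_flat:
  assumes "inj_on f {..<2 * c}" "\<And>i. i < c \<Longrightarrow> {f (2 * i), f (2 * i + 1)} \<in> E"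
  shows "k_matching E c {{f (2 * i), f (2 * i + 1)} | i. i < c}"
proof -
  let ?e = "\<lambda>i. {f (2 * i), f (2 * i + 1)}"
  have S: "{{f (2 * i), f (2 * i + 1)} | i. i < c} = ?e ` {..<c}" by auto
  have disj: "?e i \<inter> ?e j = {}" if "i < c" "j < c" "i \<noteq> j" for i j
  proof -
    have "f p \<noteq> f q" if "p \<in> {2 * i, 2 * i + 1}" "q \<in> {2 * j, 2 * j + 1}" for p q
    proof
      assume "f p = f q"
      moreover have "p < 2 * c" "q < 2 * c" "p \<noteq> q" using that \<open>i < c\<close> \<open>j < c\<close> \<open>i \<noteq> j\<close> by auto
      ultimately show False using assms(1) by (meson inj_on_contraD lessThan_iff)
    qed
    then show ?thesis by auto
  qed
  then have "inj_on ?e {..<c}" unfolding inj_on_def by (metis insert_not_empty inf.idem lessThan_iff)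
  then have "card (?e ` {..<c}) = c" by (simp add: card_image)
  moreover have "\<forall>e\<in>?e ` {..<c}. \<forall>g\<in>?e ` {..<c}. e \<noteq> g \<longrightarrow> e \<inter> g = {}"
    using disj by (metis (no_types, lifting) imageE lessThan_iff)
  ultimately show ?thesis unfolding k_matching_def S using assms(2) by auto
qed

text \<open>Since there are exactly \<open>k\<close> edges, the enumeration of the \<open>k\<close>
  pairs is injective, and so different pairs are disjoint. Within a pair the endpoints differ
  because there are no loops.\<close>

lemma inj_on_of_k_matching:
  assumes "ugraph n E" "k_matching E k {{f (2 * i), f (2 * i + 1)} | i. i < k}"
  shows "inj_on f {..<2 * k}" "\<And>i. i < k \<Longrightarrow> {f (2 * i), f (2 * i + 1)} \<in> E"
proof -
  let ?e = "\<lambda>i. {f (2 * i), f (2 * i + 1)}"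
  have S: "{{f (2 * i), f (2 * i + 1)} | i. i < k} = ?e ` {..<k}" by auto
  note km = assms(2)[unfolded k_matching_def S]
  show E: "?e i \<in> E" if "i < k" for i using km that by auto
  have "inj_on ?e {..<k}" using km by (intro eq_card_imp_inj_on) auto
  then have disj: "?e i \<inter> ?e j = {}" if "i < k" "j < k" "i \<noteq> j" for i j
    using km that by (metis (no_types, lifting) imageI inj_on_def lessThan_iff)
  have neq: "f (2 * i) \<noteq> f (2 * i + 1)" if "i < k" for i
    using E[OF that] assms(1) unfolding ugraph_def by (metis doubleton_eq_iff)
  show "inj_on f {..<2 * k}"
  proof (rule inj_onI)
    fix p q assume pq: "p \<in> {..<2 * k}" "q \<in> {..<2 * k}" "f p = f q"
    have d: "p div 2 < k" "q div 2 < k" using pq by auto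
    have fe: "f r \<in> ?e (r div 2)" for r
      by (cases "even r") (auto elim!: evenE oddE)
    have eq: "p div 2 = q div 2"
    proof (rule ccontr)
      assume "p div 2 \<noteq> q div 2"
      moreover have "f p \<in> ?e (p div 2) \<inter> ?e (q div 2)"
        using IntI[OF fe[of p] fe[of q, folded pq(3)]] .
      ultimately show False using disj[OF d] by (metis empty_iff)
    qed
    show "p = q"
    proof (rule ccontr)
      assume "p \<noteq> q"
      then have "{p, q} = {2 * (p div 2), 2 * (p div 2) + 1}" using eq by auto
      then show False using neq[OF d(1)] pq(3) by (auto simp: doubleton_eq_iff)
    qed
  qed
qed

section \<open>The cut, the kernel and its adjacency lists\<close>

locale graph_input =
  fixes n :: nat and E :: "nat set set" and L :: "nat list list" and k :: nat
  assumes ug: "ugraph n E" and adj: "adjacency_lists n E L"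
begin

lemma length_L: "length L = n" using adj by (simp add: adjacency_lists_def)

lemma set_L: "u < n \<Longrightarrow> v \<in> set (L ! u) \<longleftrightarrow> {u, v} \<in> E"
  using adj by (auto simp: adjacency_lists_def)

lemma distinct_L: "u < n \<Longrightarrow> distinct (L ! u)"
  using adj by (auto simp: adjacency_lists_def)

lemma edgeE:
  assumes "e \<in> E" obtains u v where "u < n" "v < n" "u \<noteq> v" "e = {u, v}"
  using assms ug unfolding ugraph_def by blast

lemma edgeD: "{u, v} \<in> E \<Longrightarrow> u < n \<and> v < n \<and> u \<noteq> v"
  by (erule edgeE) (auto simp: doubleton_eq_iff)

lemma finite_E: "finite E"
proof (rule finite_subset)
  show "E \<subseteq> Pow {..<n}" by (auto elim!: edgeE)
qed simp

lemma degree_eq: "u < n \<Longrightarrow> card {e \<in> E. u \<in> e} = length (L ! u)"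
proof -
  assume u: "u < n"
  have "{e \<in> E. u \<in> e} = (\<lambda>v. {u, v}) ` set (L ! u)"
  proof (intro equalityI subsetI)
    fix e assume "e \<in> {e \<in> E. u \<in> e}"
    then have eE: "e \<in> E" "u \<in> e" by auto
    from eE(1) obtain a b where ab: "e = {a, b}" by (rule edgeE)
    then have "e = {u, a} \<or> e = {u, b}" using eE(2) by auto
    then obtain v where "e = {u, v}" "e \<in> E" using eE(1) by blast
    then show "e \<in> (\<lambda>v. {u, v}) ` set (L ! u)" using set_L[OF u] by auto
  qed (use set_L[OF u] in auto)
  moreover have "inj_on (\<lambda>v. {u, v}) (set (L ! u))" by (auto simp: inj_on_def doubleton_eq_iff)
  ultimately show ?thesis using distinct_L[OF u] by (simp add: card_image distinct_card)
qed

lemma sum_degrees: "(\<Sum>u<n. length (L ! u)) \<le> 2 * card E"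
proof -
  have "(\<Sum>u<n. length (L ! u)) = (\<Sum>u<n. \<Sum>e\<in>E. if u \<in> e then 1 else 0)"
    using degree_eq finite_E by (intro sum.cong) (simp_all add: sum.If_cases Int_def)
  also have "\<dots> = (\<Sum>e\<in>E. \<Sum>u<n. if u \<in> e then 1 else 0)" by (rule sum.swap)
  also have "\<dots> \<le> (\<Sum>e\<in>E. 2)"
  proof (rule sum_mono)
    fix e assume "e \<in> E"
    then obtain u v where "u \<noteq> v" "e = {u, v}" by (rule edgeE)
    then have "card ({..<n} \<inter> e) \<le> 2" using card_mono[of e "{..<n} \<inter> e"] by simp
    then show "(\<Sum>u<n. if u \<in> e then 1 else 0) \<le> (2::nat)" by (simp add: sum.If_cases Int_def)
  qed
  finally show ?thesis by (simp add: mult.commute)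
qed

definition low :: "nat \<Rightarrow> bool" where "low u \<longleftrightarrow> length (L ! u) < 2 * k"

text \<open>\<open>T\<close> is the vertex at which the graph is cut off.\<close>

definition good :: "nat \<Rightarrow> nat \<Rightarrow> bool" where "good T v \<longleftrightarrow> v < T \<and> low v"

definition cut_edges :: "nat \<Rightarrow> nat set set" where "cut_edges T = {e \<in> E. \<forall>v\<in>e. good T v}"

definition good_nbrs :: "nat \<Rightarrow> nat \<Rightarrow> nat list" where "good_nbrs T u = filter (good T) (L ! u)"

text \<open>Vertices without good neighbours are left out because the given algorithm promises
  nothing for graphs with vertices of degree \<open>0\<close>.\<close>

definition kverts :: "nat \<Rightarrow> nat list" where
  "kverts T = filter (\<lambda>u. low u \<and> good_nbrs T u \<noteq> []) [0..<T]"

definition highs :: "nat list" where "highs = take k (filter (\<lambda>u. \<not> low u) [0..<n])"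

text \<open>The rank among the kernel vertices is the new name of a kernel vertex. It is also what a
  binary search in the sorted list returns.\<close>

definition idx :: "nat \<Rightarrow> nat \<Rightarrow> nat" where "idx T v = length (filter (\<lambda>u. u < v) (kverts T))"

text \<open>The gadgets come behind the renamed vertices, and positions \<open>2 * i\<close> and
  \<open>2 * i + 1\<close> there name each other. The lists keep the order of the input, so that
  they can be written while the input is read.\<close>

definition kL :: "nat \<Rightarrow> nat list list" where
  "kL T = map (\<lambda>u. map (idx T) (good_nbrs T u)) (kverts T) @
     map (\<lambda>j. [length (kverts T) + (if even j then j + 1 else j - 1)]) [0..<2 * length highs]"

definition kE :: "nat \<Rightarrow> nat set set" where
  "kE T = (\<lambda>e. idx T ` e) ` cut_edges T \<union>
     {{length (kverts T) + 2 * i, length (kverts T) + 2 * i + 1} | i. i < length highs}"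

abbreviation kn :: "nat \<Rightarrow> nat" where "kn T \<equiv> length (kverts T) + 2 * length highs"

lemma finite_cut_edges: "finite (cut_edges T)" using finite_E by (simp add: cut_edges_def)

lemma cut_edges_iff: "{u, v} \<in> cut_edges T \<longleftrightarrow> {u, v} \<in> E \<and> good T u \<and> good T v"
  by (auto simp: cut_edges_def)

lemma set_good_nbrs: "u < n \<Longrightarrow> good T u \<Longrightarrow> v \<in> set (good_nbrs T u) \<longleftrightarrow> {u, v} \<in> cut_edges T"
  by (auto simp: good_nbrs_def cut_edges_iff set_L)

lemma set_kverts: "T \<le> n \<Longrightarrow> u \<in> set (kverts T) \<longleftrightarrow> (\<exists>v. {u, v} \<in> cut_edges T)"
proof -
  assume T: "T \<le> n"
  have "u \<in> set (kverts T) \<longleftrightarrow> good T u \<and> (\<exists>v. v \<in> set (good_nbrs T u))"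
    unfolding kverts_def good_def by (cases "good_nbrs T u") auto
  also have "\<dots> \<longleftrightarrow> (\<exists>v. {u, v} \<in> cut_edges T)"
    using set_good_nbrs[of u T] T by (auto simp: cut_edges_iff good_def)
  finally show ?thesis .
qed

lemma sorted_kverts: "sorted_wrt (<) (kverts T)"
  unfolding kverts_def by (intro sorted_wrt_filter) simp

lemma distinct_kverts: "distinct (kverts T)" unfolding kverts_def by simp

text \<open>The hypotheses are the exit condition of binary search.\<close>

lemma idxI:
  assumes "p \<le> length (kverts T)" "\<And>i. i < p \<Longrightarrow> kverts T ! i < v" "\<And>i. p \<le> i \<Longrightarrow> i < length (kverts T) \<Longrightarrow> v \<le> kverts T ! i"
  shows "idx T v = p"
proof -
  have "{i. i < length (kverts T) \<and> kverts T ! i < v} = {..<p}"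
    using assms by (auto simp: not_le[symmetric])
  then show ?thesis by (simp add: idx_def length_filter_conv_card)
qed

lemma idx_nth: "i < length (kverts T) \<Longrightarrow> idx T (kverts T ! i) = i"
  using sorted_kverts[of T] by (intro idxI) (auto simp: sorted_wrt_iff_nth_less intro: less_imp_le dest: le_neq_implies_less)

lemma nth_idx: "v \<in> set (kverts T) \<Longrightarrow> idx T v < length (kverts T) \<and> kverts T ! idx T v = v"
  by (metis idx_nth in_set_conv_nth)

lemma inj_idx: "inj_on (idx T) (set (kverts T))"
  by (metis inj_onI nth_idx)

lemma cut_edges_subset_kverts: "T \<le> n \<Longrightarrow> e \<in> cut_edges T \<Longrightarrow> e \<subseteq> set (kverts T)"
proof -
  assume T: "T \<le> n" "e \<in> cut_edges T"
  then obtain u v where "e = {u, v}" unfolding cut_edges_def by (auto elim!: edgeE)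
  then show ?thesis using T set_kverts[OF T(1)] by (auto simp: insert_commute)
qed

lemma cut_edges_edgeE:
  assumes "e \<in> cut_edges T" obtains u v where "u \<noteq> v" "e = {u, v}" "{u, v} \<in> cut_edges T"
proof -
  have "e \<in> E" using assms by (simp add: cut_edges_def)
  then obtain u v where "u \<noteq> v" "e = {u, v}" by (rule edgeE)
  then show ?thesis using that assms by simp
qed

lemma ugraph_kE: assumes "T \<le> n" shows "ugraph (kn T) (kE T)"
  unfolding ugraph_def
proof
  fix e assume "e \<in> kE T"
  then consider f where "f \<in> cut_edges T" "e = idx T ` f"
    | i where "i < length highs" "e = {length (kverts T) + 2 * i, length (kverts T) + 2 * i + 1}"
    unfolding kE_def by auto
  then show "\<exists>u v. u < kn T \<and> v < kn T \<and> u \<noteq> v \<and> e = {u, v}"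
  proof cases
    case 1
    obtain u v where uv: "u \<noteq> v" "f = {u, v}" using cut_edges_edgeE[OF 1(1)] by metis
    have V: "u \<in> set (kverts T)" "v \<in> set (kverts T)" using cut_edges_subset_kverts[OF assms 1(1)] uv by auto
    have "idx T u \<noteq> idx T v" using inj_idx V uv(1) by (auto simp: inj_on_def)
    then show ?thesis using 1(2) uv(2) nth_idx[OF V(1)] nth_idx[OF V(2)]
      by (intro exI[of _ "idx T u"] exI[of _ "idx T v"]) auto
  next
    case 2
    then show ?thesis
      by (intro exI[of _ "length (kverts T) + 2 * i"] exI[of _ "length (kverts T) + 2 * i + 1"]) auto
  qed
qed

lemma length_kL: "length (kL T) = kn T" by (simp add: kL_def)

lemma kL_nth:
  "i < length (kverts T) \<Longrightarrow> kL T ! i = map (idx T) (good_nbrs T (kverts T ! i))"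
  "j < 2 * length highs \<Longrightarrow> kL T ! (length (kverts T) + j) = [length (kverts T) + (if even j then j + 1 else j - 1)]"
  by (simp_all add: kL_def nth_append)

text \<open>Renamed vertices and gadget vertices occupy disjoint ranges, separated by
  \<open>length (kverts T)\<close>, so each list has to be compared with only one of the two parts
  of \<open>kE T\<close>.\<close>

lemma adjacency_kL: assumes T: "T \<le> n" shows "adjacency_lists (kn T) (kE T) (kL T)"
  unfolding adjacency_lists_def
proof (intro conjI allI impI length_kL)
  fix u assume u: "u < kn T"
  let ?m = "length (kverts T)"
  show "distinct (kL T ! u)" and "set (kL T ! u) = {v. {u, v} \<in> kE T}"
  proof -
    consider "u < ?m" | j where "j < 2 * length highs" "u = ?m + j"
      using u by (metis add_diff_inverse_nat nat_add_left_cancel_less)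
    then have "distinct (kL T ! u) \<and> set (kL T ! u) = {v. {u, v} \<in> kE T}"
    proof cases
      case 1
      let ?p = "kverts T ! u"
      have p: "?p \<in> set (kverts T)" using 1 by simp
      then have gp: "good T ?p" "?p < n" using set_kverts[OF T] T by (auto simp: cut_edges_iff good_def)
      have sub: "set (good_nbrs T ?p) \<subseteq> set (kverts T)"
        using set_good_nbrs[OF gp(2,1)] cut_edges_subset_kverts[OF T] by blast
      have "distinct (good_nbrs T ?p)" using distinct_L[OF gp(2)] by (simp add: good_nbrs_def)
      then have "distinct (kL T ! u)" using inj_on_subset[OF inj_idx sub] kL_nth(1)[OF 1]
        by (simp add: distinct_map)
      moreover have "v \<in> idx T ` set (good_nbrs T ?p) \<longleftrightarrow> {u, v} \<in> kE T" for v
      proof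
        assume "v \<in> idx T ` set (good_nbrs T ?p)"
        then obtain q where q: "v = idx T q" "{?p, q} \<in> cut_edges T" using set_good_nbrs[OF gp(2,1)] by auto
        have "{u, v} = idx T ` {?p, q}" using q(1) idx_nth[OF 1] by simp
        then show "{u, v} \<in> kE T" using q(2) unfolding kE_def by blast
      next
        assume "{u, v} \<in> kE T"
        moreover have "{u, v} \<noteq> {?m + 2 * i, ?m + 2 * i + 1}" for i using 1 by (auto simp: doubleton_eq_iff)
        ultimately obtain f where f: "f \<in> cut_edges T" "{u, v} = idx T ` f" unfolding kE_def by auto
        then obtain a b where ab: "f = {a, b}" "a \<noteq> b" by (metis cut_edges_edgeE)
        then have abV: "a \<in> set (kverts T)" "b \<in> set (kverts T)" using cut_edges_subset_kverts[OF T f(1)] by auto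
        from f(2) ab(1) consider "u = idx T a" "v = idx T b" | "u = idx T b" "v = idx T a"
          by (auto simp: doubleton_eq_iff)
        then show "v \<in> idx T ` set (good_nbrs T ?p)"
        proof cases
          case 1
          then have "?p = a" using nth_idx[OF abV(1)] by simp
          then show ?thesis using 1 f(1) ab(1) set_good_nbrs[OF gp(2,1)] by blast
        next
          case 2
          then have "?p = b" using nth_idx[OF abV(2)] by simp
          then show ?thesis using 2 f(1) ab(1) set_good_nbrs[OF gp(2,1)] by (metis imageI insert_commute)
        qed
      qed
      ultimately show ?thesis using kL_nth(1)[OF 1] by auto
    next
      case 2
      let ?q = "?m + (if even j then j + 1 else j - 1)"
      have "{u, v} \<in> kE T \<longleftrightarrow> v = ?q" for v
      proof
        assume uv: "{u, v} \<in> kE T"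
        have "{u, v} \<noteq> idx T ` f" if "f \<in> cut_edges T" for f
        proof
          assume "{u, v} = idx T ` f"
          then obtain a where "a \<in> f" "u = idx T a" by auto
          then show False using 2 nth_idx[of a T] cut_edges_subset_kverts[OF T that] by auto
        qed
        then obtain i where "{u, v} = {?m + 2 * i, ?m + 2 * i + 1}" using uv unfolding kE_def by auto
        then show "v = ?q" using 2 by (auto simp: doubleton_eq_iff)
      next
        assume v: "v = ?q"
        have "{u, v} = {?m + 2 * (j div 2), ?m + 2 * (j div 2) + 1}"
          using 2 v by (cases "even j") (auto elim!: evenE oddE simp: doubleton_eq_iff)
        then show "{u, v} \<in> kE T" using 2 unfolding kE_def by auto
      qed
      then show ?thesis using 2 kL_nth(2)[OF 2(1)] by auto
    qed
    then show "distinct (kL T ! u)" "set (kL T ! u) = {v. {u, v} \<in> kE T}" by auto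
  qed
qed

lemma degree_kE: assumes T: "T \<le> n" and v: "v < kn T" shows "degree (kE T) v \<noteq> 0"
proof -
  \<comment> \<open>The kernel is itself a graph with adjacency lists, so its degrees are the
    lengths of its lists.\<close>
  interpret K: graph_input "kn T" "kE T" "kL T" k
    using ugraph_kE[OF T] adjacency_kL[OF T] by unfold_locales
  have "kL T ! v \<noteq> []"
  proof (cases "v < length (kverts T)")
    case True
    then have "good_nbrs T (kverts T ! v) \<noteq> []" using nth_mem[OF True] by (simp add: kverts_def)
    then show ?thesis using kL_nth(1)[OF True] by simp
  next
    case False
    then obtain j where "j < 2 * length highs" "v = length (kverts T) + j"
      using v by (metis add_diff_inverse_nat nat_add_left_cancel_less)
    then show ?thesis using kL_nth(2) by simp
  qed
  then show ?thesis using K.degree_eq[OF v] unfolding degree_def by simp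
qed

lemma card_kE: "card (kE T) \<le> card (cut_edges T) + length highs"
proof -
  have "{{length (kverts T) + 2 * i, length (kverts T) + 2 * i + 1} | i. i < length highs} =
      (\<lambda>i. {length (kverts T) + 2 * i, length (kverts T) + 2 * i + 1}) ` {..<length highs}" by auto
  then have "card {{length (kverts T) + 2 * i, length (kverts T) + 2 * i + 1} | i. i < length highs} \<le> length highs"
    using card_image_le[of "{..<length highs}"] by simp
  moreover have "card ((\<lambda>e. idx T ` e) ` cut_edges T) \<le> card (cut_edges T)"
    using card_image_le finite_cut_edges by blast
  ultimately show ?thesis unfolding kE_def using card_Un_le le_trans add_mono by meson
qed

section \<open>Size and completeness of the kernel\<close>

text \<open>Counting each edge between low vertices at its larger endpoint gives exactly the edges
  gained when the cut moves past \<open>u\<close>.\<close>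

definition back_degree :: "nat \<Rightarrow> nat" where
  "back_degree u = (if low u then length (filter (\<lambda>y. y < u \<and> low y) (L ! u)) else 0)"

lemma card_cut_edges_Suc: assumes T: "T < n" shows "card (cut_edges (Suc T)) = card (cut_edges T) + back_degree T"
proof (cases "low T")
  case True
  let ?S = "{y \<in> set (L ! T). y < T \<and> low y}"
  have "cut_edges (Suc T) = cut_edges T \<union> (\<lambda>y. {T, y}) ` ?S"
  proof (intro equalityI subsetI)
    fix e assume e: "e \<in> cut_edges (Suc T)"
    then obtain u v where uv: "u \<noteq> v" "e = {u, v}" "{u, v} \<in> cut_edges (Suc T)" by (rule cut_edges_edgeE)
    then have g: "{u, v} \<in> E" "u < Suc T" "v < Suc T" "low u" "low v" by (auto simp: cut_edges_iff good_def)
    show "e \<in> cut_edges T \<union> (\<lambda>y. {T, y}) ` ?S"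
    proof (cases "u = T \<or> v = T")
      case True
      then show ?thesis using g uv set_L[OF T] by (auto simp: insert_commute)
    next
      case False
      then show ?thesis using g uv by (auto simp: cut_edges_iff good_def)
    qed
  next
    fix e assume "e \<in> cut_edges T \<union> (\<lambda>y. {T, y}) ` ?S"
    then show "e \<in> cut_edges (Suc T)" using True set_L[OF T] by (auto simp: cut_edges_def good_def)
  qed
  moreover have "cut_edges T \<inter> (\<lambda>y. {T, y}) ` ?S = {}" by (auto simp: cut_edges_def good_def)
  moreover have "card ((\<lambda>y. {T, y}) ` ?S) = card ?S"
    by (intro card_image) (auto simp: inj_on_def doubleton_eq_iff)
  moreover have "card ?S = back_degree T"
    using True distinct_L[OF T] by (simp add: back_degree_def distinct_length_filter Int_def conj_commute)
  ultimately show ?thesis using finite_cut_edges by (simp add: card_Un_disjoint)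
next
  case False
  then have "cut_edges (Suc T) = cut_edges T" by (auto simp: cut_edges_def good_def less_Suc_eq)
  then show ?thesis using False by (simp add: back_degree_def)
qed

lemma cut_edges_0: "cut_edges 0 = {}"
  by (auto simp: cut_edges_def good_def elim!: edgeE)

lemma back_degree_le: "back_degree u \<le> 2 * k"
proof (cases "low u")
  case True
  then have "length (L ! u) < 2 * k" by (simp add: low_def)
  moreover have "back_degree u \<le> length (L ! u)" by (simp add: back_degree_def)
  ultimately show ?thesis by simp
qed (simp add: back_degree_def)

text \<open>The list entries inject into ordered pairs of adjacent vertices, and each cut edge has
  two orientations.\<close>

lemma sum_good_nbrs: assumes T: "T \<le> n" shows "(\<Sum>i<length (kverts T). length (good_nbrs T (kverts T ! i))) \<le> 2 * card (cut_edges T)"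
proof -
  let ?S = "SIGMA i:{..<length (kverts T)}. set (good_nbrs T (kverts T ! i))"
  have V: "kverts T ! i < n" "good T (kverts T ! i)" if "i < length (kverts T)" for i
    using nth_mem[OF that] T set_kverts[OF T] by (auto simp: cut_edges_iff good_def)
  have "(\<Sum>i<length (kverts T). length (good_nbrs T (kverts T ! i))) = card ?S"
  proof -
    have "length (good_nbrs T (kverts T ! i)) = card (set (good_nbrs T (kverts T ! i)))" if "i < length (kverts T)" for i
      using distinct_L[OF V(1)[OF that]] unfolding good_nbrs_def by (intro distinct_card[symmetric] distinct_filter)
    then show ?thesis by (subst card_SigmaI) auto
  qed
  also have "\<dots> = card ((\<lambda>(i, v). (kverts T ! i, v)) ` ?S)"
  proof (rule card_image[symmetric])
    show "inj_on (\<lambda>(i, v). (kverts T ! i, v)) ?S"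
      using distinct_kverts[of T] by (auto simp: inj_on_def nth_eq_iff_index_eq)
  qed
  also have "\<dots> \<le> card (\<Union>e\<in>cut_edges T. {(u, v). {u, v} = e})"
  proof (rule card_mono)
    have "finite {(u, v). {u, v} = e}" if "e \<in> cut_edges T" for e
    proof -
      have "finite (e \<times> e)" using cut_edges_edgeE[OF that] by (metis finite.emptyI finite_cartesian_product finite_insert)
      then show ?thesis by (rule finite_subset[rotated]) auto
    qed
    then show "finite (\<Union>e\<in>cut_edges T. {(u, v). {u, v} = e})" using finite_cut_edges by blast
    show "(\<lambda>(i, v). (kverts T ! i, v)) ` ?S \<subseteq> (\<Union>e\<in>cut_edges T. {(u, v). {u, v} = e})"
      using set_good_nbrs V by auto
  qed
  also have "\<dots> \<le> (\<Sum>e\<in>cut_edges T. card {(u, v). {u, v} = e})"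
    by (rule card_UN_le[OF finite_cut_edges])
  also have "\<dots> \<le> (\<Sum>e\<in>cut_edges T. 2)"
  proof (rule sum_mono)
    fix e assume "e \<in> cut_edges T"
    then obtain a b where "e = {a, b}" by (metis cut_edges_edgeE)
    then have "{(u, v). {u, v} = e} \<subseteq> {(a, b), (b, a)}" by (auto simp: doubleton_eq_iff)
    from card_mono[OF _ this] show "card {(u, v). {u, v} = e} \<le> 2"
      by (simp add: card_insert_if split: if_splits)
  qed
  finally show ?thesis by (simp add: mult.commute)
qed

lemma length_kverts_le: assumes T: "T \<le> n" shows "length (kverts T) \<le> 2 * card (cut_edges T)"
proof -
  have "1 \<le> length (good_nbrs T (kverts T ! i))" if "i < length (kverts T)" for i
    using nth_mem[OF that] by (auto simp: kverts_def Suc_le_eq)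
  then have "(\<Sum>i<length (kverts T). 1) \<le> (\<Sum>i<length (kverts T). length (good_nbrs T (kverts T ! i)))"
    by (intro sum_mono) auto
  then show ?thesis using sum_good_nbrs[OF T] by simp
qed

lemma length_highs: "length highs \<le> k" by (simp add: highs_def)

text \<open>If nothing was cut off and there are fewer than \<open>k\<close> high vertices, every
  edge of \<open>M\<close> missing from the kernel contains a high vertex. Disjointness makes the
  choice of such a vertex injective, so there are enough gadgets to replace the missing edges.
  Otherwise there are \<open>k\<close> gadgets, or the cut edges are numerous enough for a greedy
  matching.\<close>

theorem kernel_complete:
  assumes T: "T \<le> n" and full: "T = n \<or> 4 * k\<^sup>2 \<le> card (cut_edges T)" and M: "k_matching E k M"
  shows "\<exists>M. k_matching (kE T) k M"
proof -
  let ?m = "length (kverts T)"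
  let ?g = "\<lambda>i. {?m + 2 * i, ?m + 2 * i + 1}"
  let ?Gd = "?g ` {..<length highs}"
  have inj_g: "inj_on ?g {..<length highs}" by (auto simp: inj_on_def doubleton_eq_iff)
  \<comment> \<open>It suffices to find a matching among the cut edges that reaches size
    \<open>k\<close> when padded with all gadgets, since gadgets meet neither each other nor renamed
    edges.\<close>
  obtain N where N: "N \<subseteq> cut_edges T" "k \<le> card N + length highs" "\<forall>e\<in>N. \<forall>f\<in>N. e \<noteq> f \<longrightarrow> e \<inter> f = {}"
  proof (cases "T = n \<and> length highs < k")
    case True
    \<comment> \<open>\<open>highs\<close> is truncated at \<open>k\<close> entries; a length below
      \<open>k\<close> shows that nothing was dropped.\<close>
    then have Hall: "set highs = {u. u < n \<and> \<not> low u}" unfolding highs_def by auto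
    have dH: "card (set highs) = length highs" by (rule distinct_card) (simp add: highs_def)
    define B where "B = M - cut_edges T"
    have Bh: "\<exists>u\<in>e. u \<in> set highs" if "e \<in> B" for e
    proof -
      have "e \<in> E" "e \<notin> cut_edges T" using that M unfolding B_def k_matching_def by auto
      then show ?thesis unfolding Hall using True by (auto simp: cut_edges_def good_def elim!: edgeE)
    qed
    then obtain f where f: "\<And>e. e \<in> B \<Longrightarrow> f e \<in> e \<and> f e \<in> set highs" by metis
    have "inj_on f B"
    proof (rule inj_onI)
      fix e e' assume "e \<in> B" "e' \<in> B" "f e = f e'"
      moreover from this have "e \<inter> e' \<noteq> {}" using f by (metis disjoint_iff)
      ultimately show "e = e'" using M unfolding B_def k_matching_def by blast
    qed
    then have "card B \<le> length highs"
      using card_inj_on_le[of f B "set highs"] f dH by auto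
    moreover have "card M = card (M \<inter> cut_edges T) + card B"
      using M unfolding B_def k_matching_def by (metis card_Int_Diff)
    ultimately show ?thesis using that[of "M \<inter> cut_edges T"] M unfolding k_matching_def by auto
  next
    case False
    then consider "length highs = k" | "4 * k\<^sup>2 \<le> card (cut_edges T)" using full length_highs by linarith
    then show ?thesis
    proof cases
      case 1
      then show ?thesis using that[of "{}"] by simp
    next
      case 2
      have "\<exists>N. k_matching (cut_edges T) k N"
      proof (cases "k = 0")
        case True
        then show ?thesis unfolding k_matching_def by (intro exI[of _ "{}"]) simp
      next
        case False
        show ?thesis
        proof (rule k_matching_of_many_edges[OF finite_cut_edges, of T "2 * k"])
          show "\<forall>e\<in>cut_edges T. \<exists>u v. e = {u, v}" by (metis cut_edges_edgeE)
          show "\<forall>v. card {e \<in> cut_edges T. v \<in> e} \<le> 2 * k"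
          proof
            fix v
            show "card {e \<in> cut_edges T. v \<in> e} \<le> 2 * k"
            proof (cases "good T v")
              case True
              then have "v < n" "low v" using T by (auto simp: good_def)
              moreover have "card {e \<in> cut_edges T. v \<in> e} \<le> card {e \<in> E. v \<in> e}"
                using finite_E by (intro card_mono) (auto simp: cut_edges_def)
              ultimately show ?thesis using degree_eq[of v] by (simp add: low_def)
            next
              case False
              then have "{e \<in> cut_edges T. v \<in> e} = {}" by (auto simp: cut_edges_def)
              then show ?thesis by (simp only: card.empty le0)
            qed
          qed
          show "0 < 2 * k" using False by simp
          show "2 * (2 * k) * k \<le> card (cut_edges T)" using 2 by (simp add: power2_eq_square)
        qed
      qed
      then show ?thesis using that unfolding k_matching_def by (metis le_add1)
    qed
  qed
  have sub: "\<Union>N \<subseteq> set (kverts T)" using N(1) cut_edges_subset_kverts[OF T] by blast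
  have finN: "finite N" using N(1) finite_cut_edges finite_subset by blast
  let ?I = "(\<lambda>e. idx T ` e) ` N"
  have inj_im: "inj_on (\<lambda>e. idx T ` e) N"
  proof (rule inj_onI)
    fix e f assume "e \<in> N" "f \<in> N" "idx T ` e = idx T ` f"
    then show "e = f" using inj_on_image_eq_iff[OF inj_idx] sub by blast
  qed
  have dI: "e \<inter> f = {}" if "e \<in> ?I" "f \<in> ?I" "e \<noteq> f" for e f
  proof -
    obtain e0 f0 where ef: "e0 \<in> N" "f0 \<in> N" "e = idx T ` e0" "f = idx T ` f0" using \<open>e \<in> ?I\<close> \<open>f \<in> ?I\<close> by auto
    then have "e0 \<inter> f0 = {}" using N(3) that(3) by blast
    moreover have "idx T ` e0 \<inter> idx T ` f0 = idx T ` (e0 \<inter> f0)"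
      using inj_on_image_Int[OF inj_idx] ef sub by (metis Union_upper subset_trans)
    ultimately show ?thesis using ef by simp
  qed
  have lt: "u < ?m" if "e \<in> ?I" "u \<in> e" for e u
    using that nth_idx sub by auto
  have disjG: "e \<inter> f = {}" if "e \<in> ?I" "f \<in> ?Gd" for e f
    using lt[OF that(1)] that(2) by fastforce
  have neI: "e \<noteq> {}" if "e \<in> ?I" for e using that N(1) by (auto simp: cut_edges_def elim!: edgeE)
  have "e \<notin> ?Gd" if "e \<in> ?I" for e
  proof
    assume "e \<in> ?Gd"
    from disjG[OF that this] neI[OF that] show False by simp
  qed
  then have "?I \<inter> ?Gd = {}" by (intro disjoint_iff[THEN iffD2] allI impI)
  then have "card (?I \<union> ?Gd) = card ?I + card ?Gd"
    using finN by (intro card_Un_disjoint) simp_all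
  then have card: "k \<le> card (?I \<union> ?Gd)" using N(2) card_image[OF inj_im] card_image[OF inj_g] by simp
  show ?thesis
  proof (rule k_matching_of_card_ge[OF _ _ card])
    show "?I \<union> ?Gd \<subseteq> kE T" using N(1) unfolding kE_def by auto
    show "finite (?I \<union> ?Gd)" using finN by simp
    have dG: "e \<inter> f = {}" if "e \<in> ?Gd" "f \<in> ?Gd" "e \<noteq> f" for e f
      using that by auto presburger+
    show "\<forall>e\<in>?I \<union> ?Gd. \<forall>f\<in>?I \<union> ?Gd. e \<noteq> f \<longrightarrow> e \<inter> f = {}"
    proof (intro ballI impI)
      fix e f assume ef: "e \<in> ?I \<union> ?Gd" "f \<in> ?I \<union> ?Gd" "e \<noteq> f"
      from ef(1,2) consider "e \<in> ?I" "f \<in> ?I" | "e \<in> ?I" "f \<in> ?Gd" | "f \<in> ?I" "e \<in> ?Gd" | "e \<in> ?Gd" "f \<in> ?Gd"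
        by (elim UnE)
      then show "e \<inter> f = {}"
      proof cases
        case 1 then show ?thesis by (rule dI[OF _ _ ef(3)])
      next
        case 2 then show ?thesis by (rule disjG)
      next
        case 3 then show ?thesis by (subst Int_commute) (rule disjG)
      next
        case 4 then show ?thesis by (rule dG[OF _ _ ef(3)])
      qed
    qed
  qed
qed

end

section \<open>Binary search and insertion\<close>

abbreviation add_exp (infixl "\<oplus>" 65) where "e \<oplus> f \<equiv> Bin Add e f"
abbreviation mult_exp (infixl "\<otimes>" 70) where "e \<otimes> f \<equiv> Bin Mult e f"
abbreviation less_exp (infix "\<lhd>" 50) where "e \<lhd> f \<equiv> Bin Less e f"

definition agree_except :: "nat set \<Rightarrow> vars \<Rightarrow> vars \<Rightarrow> bool" where
  "agree_except S v v' \<longleftrightarrow> (\<forall>r. r \<notin> S \<longrightarrow> v r = v' r)"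

lemma agree_except_upd: "agree_except S v v' \<Longrightarrow> r \<in> S \<Longrightarrow> agree_except S (v(r := y)) v'"
  by (auto simp: agree_except_def)

definition sorted_arr :: "(nat \<Rightarrow> nat) \<Rightarrow> nat \<Rightarrow> bool" where
  "sorted_arr f m \<longleftrightarrow> (\<forall>i j. i \<le> j \<longrightarrow> j < m \<longrightarrow> f i \<le> f j)"

text \<open>Variables \<open>16\<close> and \<open>17\<close> delimit a half-open interval, and
  variable \<open>10\<close> holds the key. At exit \<open>16\<close> is the number of entries below
  the key, which is meaningful even if the key is absent.\<close>

definition bsearch :: "nat \<Rightarrow> nat \<Rightarrow> stm list" where
  "bsearch j s = [Asg 16 (Num 0), Asg 17 (Var s),
     Whl (Var 16 \<lhd> Var 17)
       [Asg 18 (Bin Div (Var 16 \<oplus> Var 17) (Num 2)),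
        Cnd (Arr j (Var 18) \<lhd> Var 10) [Asg 16 (Var 18 \<oplus> Num 1)] [Asg 17 (Var 18)]]]"

text \<open>One upward pass: the item carried in variable \<open>22\<close> is exchanged with every
  larger entry, so the largest one arrives at the new last place. Linear time is good enough, as
  there will be \<open>2 * k\<close> insertions into fewer than \<open>2 * k\<close>
  entries.\<close>

definition insort_prog :: "stm list" where
  "insort_prog = [Asg 19 (Num 0),
     For 19 (Var 21) [Cnd (Var 22 \<lhd> Arr 5 (Var 19))
       [Asg 23 (Arr 5 (Var 19)), Wr 5 (Var 19) (Var 22), Asg 22 (Var 23)] []],
     Wr 5 (Var 21) (Var 22), Asg 21 (Var 21 \<oplus> Num 1)]"

locale machine =
  fixes w Z :: nat and x :: "nat list"
  assumes W64: "64 < (2::nat) ^ w" and Z8: "8 * Z \<le> 2 ^ w"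
begin

lemma w_pos: "0 < w" using W64 by (cases w) auto

abbreviation "VC \<equiv> vc w Z x"

text \<open>The loop measure \<open>f\<close> also serves as a clock: the interval is shorter than
  \<open>2 ^ f\<close>, which leaves at most \<open>b\<close> rounds, each paid with
  \<open>25\<close> steps.\<close>

lemma vc_bsearch:
  assumes sorted: "sorted_arr (a j) S" and S: "v s = S" "S < 2 ^ b" "S \<le> Z" and j: "j < 8"
    and s: "s \<notin> {16, 17, 18}"
    and fin: "\<And>v' n' p. agree_except {16, 17, 18} v' v \<Longrightarrow> v' 16 = p \<Longrightarrow> p \<le> S \<Longrightarrow> (\<And>i. i < p \<Longrightarrow> a j i < v 10) \<Longrightarrow>
      (\<And>i. p \<le> i \<Longrightarrow> i < S \<Longrightarrow> v 10 \<le> a j i) \<Longrightarrow> n' \<le> n0 + 25 * b + 10 \<Longrightarrow> VC Ps Q v' a n'"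
  shows "VC (bsearch j s @ Ps) Q v a n0"
proof -
  let ?e = "Var 16 \<lhd> Var 17"
  let ?P = "[Asg 18 (Bin Div (Var 16 \<oplus> Var 17) (Num 2)),
        Cnd (Arr j (Var 18) \<lhd> Var 10) [Asg 16 (Var 18 \<oplus> Num 1)] [Asg 17 (Var 18)]]"
  define I where "I = (\<lambda>f v' a' n'. a' = a \<and> agree_except {16, 17, 18} v' v \<and> v' 16 \<le> v' 17 \<and> v' 17 \<le> S \<and>
    v' 17 - v' 16 < (2::nat) ^ f \<and> (\<forall>i<v' 16. a j i < v 10) \<and> (\<forall>i. v' 17 \<le> i \<longrightarrow> i < S \<longrightarrow> v 10 \<le> a j i) \<and>
    f \<le> b \<and> n' + 25 * f \<le> n0 + 25 * b + 4)"
  have step: "ok w Z x ?e v' a' \<and> (if val x ?e v' a' \<noteq> 0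
      then VC ?P (\<lambda>v a n. \<exists>f'<f. I f' v a n) v' a' (n' + (cost ?e + 1))
      else VC Ps Q v' a' (n' + (cost ?e + 1)))" if "I f v' a' n'" for f v' a' n'
  proof (cases "v' 16 < v' 17")
    case False
    have "VC Ps Q v' a' (n' + (cost ?e + 1))"
    proof -
      from that have "a' = a" by (simp add: I_def)
      moreover have "VC Ps Q v' a (n' + (cost ?e + 1))"
        by (rule fin[of v' "v' 16"]) (use that False in \<open>auto simp: I_def\<close>)
      ultimately show ?thesis by simp
    qed
    then show ?thesis using False by simp
  next
    case True
    from that have I: "a' = a" "agree_except {16, 17, 18} v' v" "v' 17 \<le> S"
      "v' 17 - v' 16 < 2 ^ f" "\<And>i. i < v' 16 \<Longrightarrow> a j i < v 10" "\<And>i. v' 17 \<le> i \<Longrightarrow> i < S \<Longrightarrow> v 10 \<le> a j i"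
      "f \<le> b" "n' + 25 * f \<le> n0 + 25 * b + 4"
      unfolding I_def by auto
    obtain f' where f: "f = Suc f'" using I(4) True by (cases f) auto
    let ?m = "(v' 16 + v' 17) div 2"
    have m: "v' 16 \<le> ?m" "?m < v' 17" "?m < S" "?m < Z" using True I(3) S(3) by auto
    have v10: "v' 10 = v 10" using I(2) by (simp add: agree_except_def)
    have half: "v' 17 - Suc ?m < 2 ^ f'" "?m - v' 16 < 2 ^ f'" using I(4) f True by auto
    have ov: "v' 16 + v' 17 < 2 ^ w" "Suc ?m < 2 ^ w" using True I(3) S(3) Z8 m by linarith+
    have "I f' (v'(18 := ?m, 16 := Suc ?m)) a (n' + 25)" if "a j ?m < v 10"
      unfolding I_def
    proof (intro conjI allI impI)
      show "agree_except {16, 17, 18} (v'(18 := ?m, 16 := Suc ?m)) v" using I(2) by (auto intro!: agree_except_upd)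
      fix i assume "i < (v'(18 := ?m, 16 := Suc ?m)) 16"
      then have "a j i \<le> a j ?m" using sorted m(3) unfolding sorted_arr_def by auto
      then show "a j i < v 10" using that by simp
    qed (use I half m f in auto)
    moreover have "I f' (v'(18 := ?m, 17 := ?m)) a (n' + 25)" if "\<not> a j ?m < v 10"
      unfolding I_def
    proof (intro conjI allI impI)
      show "agree_except {16, 17, 18} (v'(18 := ?m, 17 := ?m)) v" using I(2) by (auto intro!: agree_except_upd)
      fix i assume "(v'(18 := ?m, 17 := ?m)) 17 \<le> i" "i < S"
      then have "a j ?m \<le> a j i" using sorted unfolding sorted_arr_def by auto
      then show "v 10 \<le> a j i" using that by simp
    qed (use I half m f in auto)
    moreover have "I f'' v a n \<Longrightarrow> n \<ge> n2 \<Longrightarrow> I f'' v a n2" for f'' v a n n2 unfolding I_def by auto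
    ultimately have A: "a j ?m < v 10 \<Longrightarrow> n2 \<le> n' + 25 \<Longrightarrow> I f' (v'(18 := ?m, 16 := Suc ?m)) a n2"
      "\<not> a j ?m < v 10 \<Longrightarrow> n2 \<le> n' + 25 \<Longrightarrow> I f' (v'(18 := ?m, 17 := ?m)) a n2" for n2 by blast+
    have "VC ?P (\<lambda>v a n. \<exists>f'<f. I f' v a n) v' a (n' + (cost ?e + 1))"
      using W64 ov m j v10 f
      by (auto simp: vc_simps w_pos intro!: exI[of _ f'] A)
    then show ?thesis using True I(1) by simp
  qed
  have init: "I b (v(16 := 0, 17 := S)) a n1" if "n1 \<le> n0 + 4" for n1
    using S that unfolding I_def by (auto simp: agree_except_def)
  have "VC (Whl ?e ?P # Ps) Q (v(16 := 0, 17 := S)) a n1" if "n1 \<le> n0 + 4" for n1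
    by (rule vc_Whl[THEN iffD2], rule exI[of _ I]) (use init[OF that] step in \<open>blast\<close>)
  then show ?thesis using S(1) s w_pos by (simp add: bsearch_def vc_simps)
qed

text \<open>Only the set of entries is tracked, not their multiplicities, because the array serves
  membership tests alone.\<close>

lemma vc_insort_prog:
  assumes sorted: "sorted_arr (a 5) S" and S: "v 21 = S" "S < Z"
    and fin: "\<And>v' a' n'. agree_except {19, 21, 22, 23} v' v \<Longrightarrow> v' 21 = Suc S \<Longrightarrow> sorted_arr (a' 5) (Suc S) \<Longrightarrow>
      a' 5 ` {..<Suc S} = insert (v 22) (a 5 ` {..<S}) \<Longrightarrow> (\<And>j. j \<noteq> 5 \<Longrightarrow> a' j = a j) \<Longrightarrow>
      n' \<le> n0 + 40 * S + 20 \<Longrightarrow> VC Ps Q v' a' n'"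
  shows "VC (insort_prog @ Ps) Q v a n0"
proof -
  have SW: "S < 2 ^ w" "Suc S < 2 ^ w" using S(2) Z8 by linarith+
  \<comment> \<open>The carried value bounds the finished prefix from above, and together they hold
    the old prefix and the new item. The comparison with the old entries keeps the prefix below
    whatever old entry comes next.\<close>
  define I where "I = (\<lambda>i v' a' n'. agree_except {19, 22, 23} v' v \<and> (\<forall>j. j \<noteq> 5 \<longrightarrow> a' j = a j) \<and>
    (\<forall>l. i \<le> l \<longrightarrow> a' 5 l = a 5 l) \<and> (\<forall>l<i. a' 5 l \<le> a 5 l) \<and> sorted_arr (a' 5) i \<and> (\<forall>l<i. a' 5 l \<le> v' 22) \<and>
    insert (v' 22) (a' 5 ` {..<i}) = insert (v 22) (a 5 ` {..<i}) \<and> n' \<le> n0 + 2 + 40 * i)"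
  let ?P = "[Cnd (Var 22 \<lhd> Arr 5 (Var 19))
       [Asg 23 (Arr 5 (Var 19)), Wr 5 (Var 19) (Var 22), Asg 22 (Var 23)] []]"
  have "VC (For 19 (Var 21) ?P # Wr 5 (Var 21) (Var 22) # Asg 21 (Var 21 \<oplus> Num 1) # Ps) Q (v(19 := 0)) a (n0 + 2)"
  proof (rule vc_For[where I = I and lo = 0 and hi = S])
    show "I 0 (v(19 := 0)) a (n0 + 2)" by (auto simp: I_def agree_except_def sorted_arr_def)
    show "(v(19 := 0)) 19 = 0" "0 \<le> S" "S < 2 ^ w" "1 < (2::nat) ^ w" using SW W64 by auto
    show "ok w Z x (Var 21) v' a' \<and> val x (Var 21) v' a' = S" if "I i v' a' n'" for i v' a' n'
      using that S(1) by (simp add: I_def agree_except_def)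
  next
    fix i v' a' n' assume a: "I i v' a' n'" "v' 19 = i" "0 \<le> i" "i < S"
    then have I: "agree_except {19, 22, 23} v' v" "\<And>j. j \<noteq> 5 \<Longrightarrow> a' j = a j" "\<And>l. i \<le> l \<Longrightarrow> a' 5 l = a 5 l"
      "\<And>l. l < i \<Longrightarrow> a' 5 l \<le> a 5 l" "sorted_arr (a' 5) i" "\<And>l. l < i \<Longrightarrow> a' 5 l \<le> v' 22"
      "insert (v' 22) (a' 5 ` {..<i}) = insert (v 22) (a 5 ` {..<i})" "n' \<le> n0 + 2 + 40 * i"
      unfolding I_def by auto
    have le: "a' 5 l \<le> a 5 i" if "l < i" for l
      using I(4)[OF that] sorted that a(4) unfolding sorted_arr_def by (meson le_trans less_imp_le)
    have ai: "a' 5 i = a 5 i" using I(3) by simp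
    have set_Suc: "f ` {..<Suc i} = insert (f i) (f ` {..<i})" for f :: "nat \<Rightarrow> nat"
      by (simp add: lessThan_Suc)
    show "VC ?P (\<lambda>v a n. v 19 = i \<and> I (Suc i) (v(19 := Suc i)) a (n + 4)) v' a' (n' + (cost (Var 21) + 3))"
    proof (cases "v' 22 < a 5 i")
      case True
      let ?v = "v'(23 := a 5 i, 22 := a 5 i, 19 := Suc i)"
      let ?a = "upd a' 5 i (v' 22)"
      have im: "?a 5 ` {..<i} = a' 5 ` {..<i}" by (auto simp: upd_apply)
      have "I (Suc i) ?v ?a n2" if "n2 \<le> n' + 40" for n2
        unfolding I_def
      proof (intro conjI allI impI)
        show "agree_except {19, 22, 23} ?v v" using I(1) by (auto intro!: agree_except_upd)
        show "insert (?v 22) (?a 5 ` {..<Suc i}) = insert (v 22) (a 5 ` {..<Suc i})"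
          unfolding set_Suc im using I(7) by (auto simp: upd_apply)
        show "sorted_arr (?a 5) (Suc i)" using I(5,6) by (auto simp: sorted_arr_def upd_apply less_Suc_eq)
        show "n2 \<le> n0 + 2 + 40 * Suc i" using that I(8) by simp
      qed (use True I le in \<open>auto simp: upd_apply less_Suc_eq upd_def intro: less_imp_le\<close>)
      then show ?thesis using True a(2,4) S(2) W64 ai by (simp add: vc_simps fun_upd_twist)
    next
      case False
      have "I (Suc i) (v'(19 := Suc i)) a' n2" if "n2 \<le> n' + 40" for n2
        unfolding I_def
      proof (intro conjI allI impI)
        show "agree_except {19, 22, 23} (v'(19 := Suc i)) v" using I(1) by (auto intro!: agree_except_upd)
        show "insert ((v'(19 := Suc i)) 22) (a' 5 ` {..<Suc i}) = insert (v 22) (a 5 ` {..<Suc i})"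
          unfolding set_Suc ai using I(7) by (auto simp: insert_commute)
        show "sorted_arr (a' 5) (Suc i)" using I(5) le ai by (auto simp: sorted_arr_def less_Suc_eq le_less)
        show "n2 \<le> n0 + 2 + 40 * Suc i" using that I(8) by simp
      qed (use False I le ai in \<open>auto simp: less_Suc_eq\<close>)
      then show ?thesis using False a(2,4) S(2) W64 ai by (simp add: vc_simps)
    qed
  next
    fix v' a' n' assume a: "I S v' a' n'" "v' 19 = S"
    then have I: "agree_except {19, 22, 23} v' v" "\<And>j. j \<noteq> 5 \<Longrightarrow> a' j = a j"
      "sorted_arr (a' 5) S" "\<And>l. l < S \<Longrightarrow> a' 5 l \<le> v' 22"
      "insert (v' 22) (a' 5 ` {..<S}) = insert (v 22) (a 5 ` {..<S})" "n' \<le> n0 + 2 + 40 * S"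
      unfolding I_def by auto
    have v21: "v' 21 = S" using I(1) S(1) by (simp add: agree_except_def)
    let ?a = "upd a' 5 S (v' 22)"
    have "VC Ps Q (v'(21 := Suc S)) ?a n2" if "n2 \<le> n' + 18" for n2
    proof (rule fin)
      show "agree_except {19, 21, 22, 23} (v'(21 := Suc S)) v" using I(1) by (auto simp: agree_except_def)
      have "?a 5 ` {..<S} = a' 5 ` {..<S}" by (auto simp: upd_apply)
      then show "?a 5 ` {..<Suc S} = insert (v 22) (a 5 ` {..<S})"
        unfolding lessThan_Suc image_insert using I(5) by (simp add: upd_def)
      show "sorted_arr (?a 5) (Suc S)" using I(3,4) by (auto simp: sorted_arr_def upd_apply less_Suc_eq)
    qed (use I(2,6) that in \<open>auto simp: upd_def\<close>)
    then show "VC (Wr 5 (Var 21) (Var 22) # Asg 21 (Var 21 \<oplus> Num 1) # Ps) Q v' a' (n' + (cost (Var 21) + 3))"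
      using v21 S(2) SW W64 w_pos by (simp add: vc_simps)
  qed
  then show ?thesis by (simp add: insort_prog_def vc_simps w_pos)
qed

end

section \<open>Computing the kernel\<close>

text \<open>
  Variables: \<open>1, 2, 3\<close> hold \<open>k\<close>, \<open>n\<close> and \<open>2 * k\<close>; \<open>4\<close> is the current vertex, \<open>9\<close> a position in its adjacency
  list and \<open>10\<close> the neighbour found there; \<open>5\<close> counts the high vertices, \<open>6\<close> the edges and \<open>12\<close> the
  vertices of the kernel; \<open>7\<close> is the cut \<open>T\<close>; \<open>14\<close> is the writing position in the kernel input.
  Arrays: \<open>1\<close> the kernel vertices, \<open>2\<close> the kernel input, \<open>3\<close> the memory of the simulated program,
  \<open>4\<close> the high vertices, \<open>5\<close> the sorted used vertices, \<open>6\<close> the endpoints of the matching.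
\<close>

definition adj_start :: "nat \<Rightarrow> exp" where "adj_start r = Inp (Var r \<oplus> Num 2)"
definition adj_end :: "nat \<Rightarrow> exp" where "adj_end r = Inp (Var r \<oplus> Num 3)"
text \<open>The bound on the difference of two addresses is stated with a sum because
  \<open>ideal_ok\<close> admits no subtraction.\<close>

definition low_exp :: "nat \<Rightarrow> exp" where "low_exp r = (adj_end r \<lhd> adj_start r \<oplus> Var 3)"
text \<open>The product of two truth values is their conjunction.\<close>

definition good_exp :: "nat \<Rightarrow> exp" where "good_exp r = (Var r \<lhd> Var 7) \<otimes> low_exp r"

lemma cost_exps [simp]: "cost (adj_start r) = 4" "cost (adj_end r) = 4" "cost (low_exp r) = 11" "cost (good_exp r) = 15"
  by (simp_all add: adj_start_def adj_end_def low_exp_def good_exp_def)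

definition For_adj :: "nat \<Rightarrow> stm list \<Rightarrow> stm list" where
  "For_adj u P = [Asg 9 (adj_start u), For 9 (adj_end u) (Asg 10 (Inp (Var 9)) # P)]"

definition find_highs :: "stm list" where
  "find_highs = [Asg 4 (Num 0), Asg 5 (Num 0),
     For 4 (Var 2) [Cnd (low_exp 4) []
       [Cnd (Var 5 \<lhd> Var 1) [Wr 4 (Var 5) (Var 4), Asg 5 (Var 5 \<oplus> Num 1)] []]]]"

text \<open>Variable \<open>8\<close> is \<open>(2 * k)\<^sup>2\<close>, the number of edges that
  forces a matching. Once the count in \<open>6\<close> has reached it, the cut in \<open>7\<close>
  stays put and the loop runs idly to its end.\<close>

definition find_cut :: "stm list" where
  "find_cut = [Asg 4 (Num 0), Asg 6 (Num 0), Asg 7 (Num 0), Asg 8 (Var 3 \<otimes> Var 3),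
     For 4 (Var 2) [Cnd (Var 6 \<lhd> Var 8)
       [Cnd (low_exp 4) (For_adj 4 [Cnd (Var 10 \<lhd> Var 4) [Cnd (low_exp 10) [Asg 6 (Var 6 \<oplus> Num 1)] []] []]) [],
        Asg 7 (Var 4 \<oplus> Num 1)] []]]"

definition find_kverts :: "stm list" where
  "find_kverts = [Asg 4 (Num 0), Asg 12 (Num 0),
     For 4 (Var 7) [Cnd (low_exp 4)
       (Asg 11 (Num 0) # For_adj 4 [Cnd (good_exp 10) [Asg 11 (Num 1)] []] @
        [Cnd (Var 11) [Wr 1 (Var 12) (Var 4), Asg 12 (Var 12 \<oplus> Num 1)] []]) []]]"

text \<open>The bound on \<open>Z\<close> leaves room for the encoded kernel, the largest array
  besides the simulated memory. The bound on the word size covers all input addresses, even when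
  increased by \<open>2 * k\<close>.\<close>

locale ram = graph_input n E L k + machine w Z "encode L k"
  for n :: nat and E :: "nat set set" and L :: "nat list list" and k w Z :: nat +
  assumes Zk: "40 * (k\<^sup>2 + 1) \<le> Z" and Wn: "n + 2 * card E + 64 * (k\<^sup>2 + 1) < 2 ^ w"
begin

text \<open>A name for the square keeps it an atom in linear arithmetic.\<close>

definition K :: nat where "K = k\<^sup>2"

lemma k_le: "k \<le> K" by (simp add: K_def power2_eq_square)

lemma ZK: "40 * K + 40 \<le> Z" using Zk by (simp add: K_def)

lemma WK: "n + 2 * card E + 64 * K + 64 < 2 ^ w" using Wn by (simp add: K_def)

lemma sum_L: "u \<le> n \<Longrightarrow> (\<Sum>j<u. length (L ! j)) \<le> 2 * card E"
proof -
  assume "u \<le> n"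
  then have "(\<Sum>j<u. length (L ! j)) \<le> (\<Sum>j<n. length (L ! j))" by (intro sum_mono2) auto
  then show ?thesis using sum_degrees by simp
qed

lemma offset_le: "u \<le> n \<Longrightarrow> offset L u \<le> n + 3 + 2 * card E"
  using sum_L by (simp add: offset_def length_L)

lemma offset_lt: "u \<le> n \<Longrightarrow> offset L u < 2 ^ w"
  using offset_le[of u] WK by simp

lemma length_x: "length (encode L k) = offset L n" by (simp add: length_encode length_L)

lemma offset_ge: "n + 3 \<le> offset L u" by (simp add: offset_def length_L)

lemma n_lt: "n < 2 ^ w" using WK by linarith

lemma adj_start_ok [simp]: "v r < n \<Longrightarrow> ok w Z (encode L k) (adj_start r) v a"
  and adj_start_val [simp]: "v r < n \<Longrightarrow> val (encode L k) (adj_start r) v a = offset L (v r)"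
proof -
  assume r: "v r < n"
  show "val (encode L k) (adj_start r) v a = offset L (v r)"
    using r encode_nth(3)[of "v r" L k] by (simp add: adj_start_def length_L)
  then show "ok w Z (encode L k) (adj_start r) v a"
    using r offset_lt[of "v r"] W64 WK offset_ge[of n] length_x by (simp add: adj_start_def)
qed

lemma adj_end_ok [simp]: "v r < n \<Longrightarrow> ok w Z (encode L k) (adj_end r) v a"
  and adj_end_val [simp]: "v r < n \<Longrightarrow> val (encode L k) (adj_end r) v a = offset L (Suc (v r))"
proof -
  assume r: "v r < n"
  show val: "val (encode L k) (adj_end r) v a = offset L (Suc (v r))"
    using r encode_nth(3)[of "Suc (v r)" L k] by (simp add: adj_end_def length_L numeral_3_eq_3)
  then show "ok w Z (encode L k) (adj_end r) v a"
    using r offset_lt[of "Suc (v r)"] W64 WK offset_ge[of n] length_x by (simp add: adj_end_def)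
qed

lemma kk_lt: "offset L u + 2 * k < 2 ^ w" if "u \<le> n"
  using offset_le[OF that] WK k_le by simp

lemma low_exp_ok [simp]: "v r < n \<Longrightarrow> v 3 = 2 * k \<Longrightarrow> ok w Z (encode L k) (low_exp r) v a"
  using kk_lt[of "v r"] by (simp add: low_exp_def)

lemma low_exp_val [simp]: "v r < n \<Longrightarrow> v 3 = 2 * k \<Longrightarrow> val (encode L k) (low_exp r) v a = (if low (v r) then 1 else 0)"
  by (simp add: low_exp_def offset_Suc low_def)

lemma good_exp_ok [simp]: "v r < n \<Longrightarrow> v 3 = 2 * k \<Longrightarrow> ok w Z (encode L k) (good_exp r) v a"
  using W64 w_pos by (simp add: good_exp_def)

lemma good_exp_val [simp]: "v r < n \<Longrightarrow> v 3 = 2 * k \<Longrightarrow>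
    val (encode L k) (good_exp r) v a = (if good (v 7) (v r) then 1 else 0)"
  by (simp add: good_exp_def good_def)

lemma L_nth: "u < n \<Longrightarrow> i < length (L ! u) \<Longrightarrow> L ! u ! i < n"
  using set_L[of u "L ! u ! i"] edgeD by auto

text \<open>Invariants count positions in the list, whereas variable \<open>9\<close> holds
  addresses; the shift is done here once for all scans. The \<open>10\<close> steps are seven for
  the loop test and three for fetching the neighbour.\<close>

lemma vc_For_adj:
  assumes u: "v u = u0" "u0 < n" "u \<noteq> 9"
    and init: "\<And>n1. n1 \<le> n0 + 5 \<Longrightarrow> I 0 (v(9 := offset L u0)) a n1"
    and inv: "\<And>i v a m. I i v a m \<Longrightarrow> v u = u0"
    and body: "\<And>i v a m n1. i < length (L ! u0) \<Longrightarrow> I i v a m \<Longrightarrow> n1 \<le> m + 10 \<Longrightarrow> v 9 = offset L u0 + i \<Longrightarrow>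
      L ! u0 ! i < n \<Longrightarrow>
      VC P (\<lambda>v' a' n'. v' 9 = offset L u0 + i \<and> I (Suc i) (v'(9 := Suc (offset L u0 + i))) a' (n' + 4))
        (v(10 := L ! u0 ! i)) a n1"
    and fin: "\<And>v a m n1. I (length (L ! u0)) v a m \<Longrightarrow> n1 \<le> m + 7 \<Longrightarrow> VC Ps Q v a n1"
  shows "VC (For_adj u P @ Ps) Q v a n0"
proof -
  let ?o = "offset L u0"
  have "VC (For 9 (adj_end u) (Asg 10 (Inp (Var 9)) # P) # Ps) Q (v(9 := ?o)) a n1" if n1: "n1 \<le> n0 + 5" for n1
  proof (rule vc_For[where I = "\<lambda>p. I (p - ?o)" and lo = ?o and hi = "offset L (Suc u0)"])
    show "I (?o - ?o) (v(9 := ?o)) a n1" using init[OF n1] by simp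
    show "(v(9 := ?o)) 9 = ?o" by simp
    show "?o \<le> offset L (Suc u0)" by (simp add: offset_Suc)
    show "offset L (Suc u0) < 2 ^ w" using offset_lt[of "Suc u0"] u(2) by simp
    show "1 < (2::nat) ^ w" using W64 by linarith
    show "ok w Z (encode L k) (adj_end u) v' a' \<and> val (encode L k) (adj_end u) v' a' = offset L (Suc u0)"
      if "I (i - ?o) v' a' n'" for i v' a' n' using inv[OF that] u(2) by simp
    show "VC Ps Q v' a' (n' + (cost (adj_end u) + 3))" if "I (offset L (Suc u0) - ?o) v' a' n'" for v' a' n'
      using fin[of v' a' n'] that by (simp add: offset_Suc)
    show "VC (Asg 10 (Inp (Var 9)) # P)
        (\<lambda>v a n. v 9 = p \<and> I (Suc p - ?o) (v(9 := Suc p)) a (n + 4)) v' a' (n' + (cost (adj_end u) + 3))"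
      if a: "I (p - ?o) v' a' n'" "v' 9 = p" "?o \<le> p" "p < offset L (Suc u0)" for p v' a' n'
    proof -
      define i where "i = p - ?o"
      have i: "i < length (L ! u0)" "p = ?o + i" using a(3,4) by (auto simp: i_def offset_Suc)
      have "encode L k ! p = L ! u0 ! i"
        using encode_nth(4)[of u0 L i k] i u(2) by (simp add: length_L)
      moreover have "p < offset L n" using a(4) offset_mono[of "Suc u0" n L] u(2) by simp
      moreover note L_nth[OF u(2) i(1)] n_lt
      ultimately show ?thesis
        using body[OF i(1), of v' a' n' "10 + n'"] a i by (simp add: vc_simps length_x Suc_diff_le)
    qed
  qed
  then show ?thesis using u by (simp add: For_adj_def vc_simps)
qed

definition pre :: "vars \<Rightarrow> bool" where "pre v \<longleftrightarrow> v 1 = k \<and> v 2 = n \<and> v 3 = 2 * k"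

lemma preD: "pre v \<Longrightarrow> v 1 = k" "pre v \<Longrightarrow> v 2 = n" "pre v \<Longrightarrow> v 3 = 2 * k"
  by (simp_all add: pre_def)

section \<open>Scanning the input\<close>

lemma vc_find_highs:
  assumes v: "pre v"
    and fin: "\<And>v' a' n'. agree_except {4, 5} v' v \<Longrightarrow> v' 5 = length highs \<Longrightarrow> (\<And>i. i < length highs \<Longrightarrow> a' 4 i = highs ! i) \<Longrightarrow>
      (\<And>j. j \<noteq> 4 \<Longrightarrow> a' j = a j) \<Longrightarrow> n' \<le> n0 + 50 * n + 20 \<Longrightarrow> VC Ps Q v' a' n'"
  shows "VC (find_highs @ Ps) Q v a n0"
proof -
  define H where "H i = take k (filter (\<lambda>u. \<not> low u) [0..<i])" for i
  define I where "I = (\<lambda>i v' a' n'. agree_except {4, 5} v' v \<and> v' 5 = length (H i) \<and>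
    (\<forall>j<length (H i). a' 4 j = H i ! j) \<and> (\<forall>j. j \<noteq> 4 \<longrightarrow> a' j = a j) \<and> n' \<le> n0 + 4 + 50 * i)"
  note v' = preD[OF v]
  let ?P = "[Cnd (low_exp 4) []
       [Cnd (Var 5 \<lhd> Var 1) [Wr 4 (Var 5) (Var 4), Asg 5 (Var 5 \<oplus> Num 1)] []]]"
  have "VC (For 4 (Var 2) ?P # Ps) Q (v(4 := 0, 5 := 0)) a n1" if n1: "n1 \<le> n0 + 4" for n1
  proof (rule vc_For[where I = I and lo = 0 and hi = n])
    show "I 0 (v(4 := 0, 5 := 0)) a n1" using n1 by (auto simp: I_def H_def agree_except_def)
    show "ok w Z (encode L k) (Var 2) u b \<and> val (encode L k) (Var 2) u b = n" if "I i u b m" for i u b m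
      using that v' by (simp add: I_def agree_except_def)
    show "1 < (2::nat) ^ w" using W64 by linarith
    show "VC Ps Q u b (m + (cost (Var 2) + 3))" if "I n u b m" for u b m
      by (rule fin) (use that in \<open>auto simp: I_def H_def highs_def\<close>)
  next
    fix i u b m assume a: "I i u b m" "u 4 = i" "i < n"
    then have I: "agree_except {4, 5} u v" "u 5 = length (H i)" "\<And>j. j < length (H i) \<Longrightarrow> b 4 j = H i ! j"
      "\<And>j. j \<noteq> 4 \<Longrightarrow> b j = a j" "m \<le> n0 + 4 + 50 * i"
      by (auto simp: I_def)
    have u: "u 1 = k" "u 3 = 2 * k" using I(1) v' by (simp_all add: agree_except_def)
    have H: "H (Suc i) = (if low i \<or> length (H i) \<ge> k then H i else H i @ [i])"
      by (auto simp: H_def)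
    have lH: "length (H i) \<le> k" by (simp add: H_def)
    have "I (Suc i) (u(4 := Suc i)) b m2" if "low i \<or> length (H i) \<ge> k" "m2 \<le> m + 50" for m2
      using I that H by (auto simp: I_def agree_except_def)
    moreover have "I (Suc i) (u(5 := Suc (length (H i)), 4 := Suc i)) (upd b 4 (length (H i)) i) m2"
      if "\<not> low i" "length (H i) < k" "m2 \<le> m + 50" for m2
      using I that H by (auto simp: I_def agree_except_def upd_apply nth_append less_Suc_eq)
    moreover have "k < Z" "k < 2 ^ w" using ZK WK k_le by linarith+
    ultimately show "VC ?P (\<lambda>v a n. v 4 = i \<and> I (Suc i) (v(4 := Suc i)) a (n + 4)) u b (m + (cost (Var 2) + 3))"
      using a u I(2) lH W64 w_pos by (simp add: vc_simps fun_upd_twist)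
  qed (use n_lt in auto)
  then show ?thesis by (simp add: find_highs_def vc_simps w_pos)
qed

text \<open>A vertex is processed only while the count is below \<open>4 * K\<close>, and it
  contributes at most its back degree. This explains the overshoot of \<open>2 * k\<close>. Each
  list is read at most once, which makes the time linear in the input.\<close>

lemma vc_find_cut:
  assumes v: "pre v"
    and fin: "\<And>v' n'. agree_except {4, 6, 7, 8, 9, 10} v' v \<Longrightarrow> v' 7 \<le> n \<Longrightarrow> card (cut_edges (v' 7)) \<le> 4 * K + 2 * k \<Longrightarrow>
      (v' 7 = n \<or> 4 * K \<le> card (cut_edges (v' 7))) \<Longrightarrow>
      n' \<le> n0 + 100 * (n + 2 * card E) + 20 \<Longrightarrow> VC Ps Q v' a n'"
  shows "VC (find_cut @ Ps) Q v a n0"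
proof -
  define D where "D i = (\<Sum>j<i. length (L ! j))" for i
  define I where "I = (\<lambda>i v' a' n'. a' = a \<and> agree_except {4, 6, 7, 8, 9, 10} v' v \<and> v' 8 = 4 * K \<and> v' 7 \<le> i \<and>
    v' 6 = card (cut_edges (v' 7)) \<and> v' 6 \<le> 4 * K + 2 * k \<and> (v' 7 = i \<or> 4 * K \<le> v' 6) \<and>
    n' \<le> n0 + 10 + 100 * (i + D i))"
  note v' = preD[OF v]
  let ?B = "[Cnd (Var 10 \<lhd> Var 4) [Cnd (low_exp 10) [Asg 6 (Var 6 \<oplus> Num 1)] []] []]"
  let ?P = "[Cnd (Var 6 \<lhd> Var 8) [Cnd (low_exp 4) (For_adj 4 ?B) [], Asg 7 (Var 4 \<oplus> Num 1)] []]"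
  have "VC (For 4 (Var 2) ?P # Ps) Q (v(4 := 0, 6 := 0, 7 := 0, 8 := 4 * K)) a n1" if n1: "n1 \<le> n0 + 10" for n1
  proof (rule vc_For[where I = I and lo = 0 and hi = n])
    show "I 0 (v(4 := 0, 6 := 0, 7 := 0, 8 := 4 * K)) a n1" using n1 by (auto simp: I_def cut_edges_0 agree_except_def)
    show "ok w Z (encode L k) (Var 2) u b \<and> val (encode L k) (Var 2) u b = n" if "I i u b m" for i u b m
      using that v' by (simp add: I_def agree_except_def)
    show "1 < (2::nat) ^ w" using W64 by linarith
    show "VC Ps Q u b (m + (cost (Var 2) + 3))" if "I n u b m" for u b m
    proof -
      have "b = a" using that by (simp add: I_def)
      moreover have "VC Ps Q u a (m + (cost (Var 2) + 3))"
        by (rule fin) (use that sum_L[of n] in \<open>auto simp: I_def D_def\<close>)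
      ultimately show ?thesis by simp
    qed
  next
    fix i u b m assume a: "I i u b m" "u 4 = i" "i < n"
    then have I: "b = a" "agree_except {4, 6, 7, 8, 9, 10} u v" "u 8 = 4 * K" "u 7 \<le> i" "u 6 = card (cut_edges (u 7))"
      "u 6 \<le> 4 * K + 2 * k" "u 7 = i \<or> 4 * K \<le> u 6" "m \<le> n0 + 10 + 100 * (i + D i)"
      by (auto simp: I_def)
    have u: "u 3 = 2 * k" using I(2) v' by (simp add: agree_except_def)
    have ov: "Suc i < 2 ^ w" "4 * K + 2 * k + 1 < 2 ^ w" using a(3) WK k_le by linarith+
    let ?R = "\<lambda>v a n. v 4 = i \<and> I (Suc i) (v(4 := Suc i)) a (n + 4)"
    have DS: "D (Suc i) = D i + length (L ! i)" by (simp add: D_def)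
    show "VC ?P ?R u b (m + (cost (Var 2) + 3))"
    proof (cases "u 6 < u 8")
      case False
      then have "I (Suc i) (u(4 := Suc i)) a m2" if "m2 \<le> m + 20" for m2
        using I that DS by (auto simp: I_def agree_except_def)
      then show ?thesis using False a(2) I(1) by (simp add: vc_simps)
    next
      case True
      then have u7: "u 7 = i" using I(3,7) by simp
      have small: "card (cut_edges i) < 4 * K" using True I(3,5) u7 by simp
      have last0: "I (Suc i) (u'(7 := Suc i, 4 := Suc i)) a m'"
        if "agree_except {4, 6, 7, 8, 9, 10} u' v" "u' 8 = 4 * K" "u' 6 = card (cut_edges i) + back_degree i"
          "m' \<le> m + 60 + 60 * length (L ! i)" for u' m'
        using I(8) that small back_degree_le[of i] DS card_cut_edges_Suc[OF a(3)] by (auto simp: I_def agree_except_def)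
      have last: "VC [Asg 7 (Var 4 \<oplus> Num 1)] ?R u' a m'"
        if "agree_except {4, 6, 7, 8, 9, 10} u' v" "u' 4 = i" "u' 8 = 4 * K" "u' 6 = card (cut_edges i) + back_degree i"
          "m' \<le> m + 40 + 60 * length (L ! i)" for u' m'
        using last0[of u'] that ov w_pos by (simp add: vc_simps)
      show ?thesis
      proof (cases "low i")
        case False
        then have "back_degree i = 0" by (simp add: back_degree_def)
        then show ?thesis using True False a(2,3) u I u7 last0[of u] ov w_pos by (simp add: vc_simps)
      next
        case low: True
        define J where "J = (\<lambda>l v' a' n'. a' = a \<and> agree_except {6, 9, 10} v' u \<and>
          v' 6 = card (cut_edges i) + length (filter (\<lambda>y. y < i \<and> low y) (take l (L ! i))) \<and> n' \<le> m + 30 + 60 * l)"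
        have "VC (For_adj 4 ?B @ []) (VC [Asg 7 (Var 4 \<oplus> Num 1)] ?R) u a m1" if m1: "m1 \<le> m + 23" for m1
        proof (rule vc_For_adj[where I = J and ?u0.0 = i])
          show "u 4 = i" "i < n" "4 \<noteq> (9::nat)" using a by auto
          show "J 0 (u(9 := offset L i)) a n1" if "n1 \<le> m1 + 5" for n1
            using that m1 I(5) u7 by (auto simp: J_def agree_except_def)
          show "v' 4 = i" if "J l v' a' n'" for l v' a' n' using that a(2) by (simp add: J_def agree_except_def)
          show "VC [] (VC [Asg 7 (Var 4 \<oplus> Num 1)] ?R) v' a' n1"
            if "J (length (L ! i)) v' a' n'" "n1 \<le> n' + 7" for v' a' n' n1
          proof -
            from that have J: "a' = a" "agree_except {6, 9, 10} v' u" "v' 6 = card (cut_edges i) + back_degree i" "n' \<le> m + 30 + 60 * length (L ! i)"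
              using low by (auto simp: J_def back_degree_def)
            have "VC [Asg 7 (Var 4 \<oplus> Num 1)] ?R v' a n1"
              by (rule last) (use J I that(2) a(2) in \<open>auto simp: agree_except_def\<close>)
            then show ?thesis unfolding vc_simps(1) J(1) .
          qed
        next
          fix l v' a' n' n1 assume b: "l < length (L ! i)" "J l v' a' n'" "n1 \<le> n' + 10" "v' 9 = offset L i + l" "L ! i ! l < n"
          let ?y = "L ! i ! l"
          from b have J: "a' = a" "agree_except {6, 9, 10} v' u"
            "v' 6 = card (cut_edges i) + length (filter (\<lambda>y. y < i \<and> low y) (take l (L ! i)))" "n' \<le> m + 30 + 60 * l"
            by (auto simp: J_def)
          have tk: "take (Suc l) (L ! i) = take l (L ! i) @ [?y]" using b(1) by (simp add: take_Suc_conv_app_nth)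
          have vu: "v' 4 = i" "v' 3 = 2 * k" using J(2) a(2) u by (simp_all add: agree_except_def)
          \<comment> \<open>Needed to exclude overflow: a low vertex raises the count by less than
            \<open>2 * k\<close> before this increment.\<close>
          have "length (filter (\<lambda>y. y < i \<and> low y) (take l (L ! i))) \<le> l"
            using length_filter_le[of _ "take l (L ! i)"] b(1) by (metis length_take min.absorb2 less_imp_le)
          then have "Suc (v' 6) < 2 ^ w" using J(3) b(1) low small ov unfolding low_def by linarith
          moreover have "J (Suc l) (v'(10 := ?y, 6 := Suc (v' 6), 9 := Suc (offset L i + l))) a n2"
            if "?y < i" "low ?y" "n2 \<le> n' + 60" for n2
            using that J by (auto simp: J_def tk agree_except_def)
          moreover have "J (Suc l) (v'(10 := ?y, 9 := Suc (offset L i + l))) a n2"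
            if "\<not> (?y < i \<and> low ?y)" "n2 \<le> n' + 60" for n2
            using that J by (auto simp: J_def tk agree_except_def)
          ultimately show "VC ?B (\<lambda>v' a' n'. v' 9 = offset L i + l \<and> J (Suc l) (v'(9 := Suc (offset L i + l))) a' (n' + 4))
              (v'(10 := ?y)) a' n1"
            using b vu J(1) W64 w_pos by (simp add: vc_simps fun_upd_twist)
        qed
        then show ?thesis using True low a(2,3) u I(1) by (simp add: vc_simps)
      qed
    qed
  qed (use n_lt in auto)
  moreover have "4 * K < 2 ^ w" using WK by linarith
  ultimately show ?thesis using v' by (simp add: find_cut_def vc_simps w_pos K_def power2_eq_square)
qed

lemma kverts_bound: assumes T: "T \<le> n" "card (cut_edges T) \<le> 4 * K + 2 * k" shows "length (kverts T) \<le> 12 * K"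
  using length_kverts_le[OF T(1)] T(2) k_le by linarith

lemma vc_find_kverts:
  assumes v: "pre v" and T: "v 7 = T" "T \<le> n" "card (cut_edges T) \<le> 4 * K + 2 * k"
    and fin: "\<And>v' a' n'. agree_except {4, 9, 10, 11, 12} v' v \<Longrightarrow> v' 12 = length (kverts T) \<Longrightarrow>
      (\<And>i. i < length (kverts T) \<Longrightarrow> a' 1 i = kverts T ! i) \<Longrightarrow> (\<And>j. j \<noteq> 1 \<Longrightarrow> a' j = a j) \<Longrightarrow>
      n' \<le> n0 + 100 * (n + 2 * card E) + 20 \<Longrightarrow> VC Ps Q v' a' n'"
  shows "VC (find_kverts @ Ps) Q v a n0"
proof -
  define D where "D i = (\<Sum>j<i. length (L ! j))" for i
  define V where "V i = filter (\<lambda>u. low u \<and> good_nbrs T u \<noteq> []) [0..<i]" for i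
  define I where "I = (\<lambda>i v' a' n'. agree_except {4, 9, 10, 11, 12} v' v \<and> v' 12 = length (V i) \<and>
    (\<forall>j<length (V i). a' 1 j = V i ! j) \<and> (\<forall>j. j \<noteq> 1 \<longrightarrow> a' j = a j) \<and> n' \<le> n0 + 4 + 100 * (i + D i))"
  note v' = preD[OF v]
  let ?B = "[Cnd (good_exp 10) [Asg 11 (Num 1)] []]"
  let ?C = "[Cnd (Var 11) [Wr 1 (Var 12) (Var 4), Asg 12 (Var 12 \<oplus> Num 1)] []]"
  let ?P = "[Cnd (low_exp 4) (Asg 11 (Num 0) # For_adj 4 ?B @ ?C) []]"
  have "VC (For 4 (Var 7) ?P # Ps) Q (v(4 := 0, 12 := 0)) a n1" if n1: "n1 \<le> n0 + 4" for n1
  proof (rule vc_For[where I = I and lo = 0 and hi = T])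
    show "I 0 (v(4 := 0, 12 := 0)) a n1" using n1 by (auto simp: I_def V_def agree_except_def)
    show "ok w Z (encode L k) (Var 7) u b \<and> val (encode L k) (Var 7) u b = T" if "I i u b m" for i u b m
      using that T(1) by (simp add: I_def agree_except_def)
    show "1 < (2::nat) ^ w" using W64 by linarith
    show "VC Ps Q u b (m + (cost (Var 7) + 3))" if "I T u b m" for u b m
      by (rule fin) (use that sum_L[OF T(2)] T(2) in \<open>auto simp: I_def V_def kverts_def D_def\<close>)
  next
    fix i u b m assume a: "I i u b m" "u 4 = i" "i < T"
    then have I: "agree_except {4, 9, 10, 11, 12} u v" "u 12 = length (V i)" "\<And>j. j < length (V i) \<Longrightarrow> b 1 j = V i ! j"
      "\<And>j. j \<noteq> 1 \<Longrightarrow> b j = a j" "m \<le> n0 + 4 + 100 * (i + D i)"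
      by (auto simp: I_def)
    have u: "u 3 = 2 * k" "u 7 = T" using I(1) v' T(1) by (simp_all add: agree_except_def)
    have iN: "i < n" using a(3) T(2) by simp
    have DS: "D (Suc i) = D i + length (L ! i)" by (simp add: D_def)
    have VS: "V (Suc i) = (if low i \<and> good_nbrs T i \<noteq> [] then V i @ [i] else V i)" by (simp add: V_def)
    \<comment> \<open>\<open>V i\<close> is an initial segment of \<open>kverts T\<close>, so the
      bound on the full list keeps every write inside the array.\<close>
    have "[0..<T] = [0..<i] @ [i..<T]" using a(3) by (metis le_add_diff_inverse less_imp_le upt_add_eq_append zero_le)
    then have "kverts T = V i @ filter (\<lambda>u. low u \<and> good_nbrs T u \<noteq> []) [i..<T]" by (simp add: kverts_def V_def)
    then have "length (V i) \<le> length (kverts T)" by simp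
    then have lV: "length (V i) \<le> 12 * K" using kverts_bound[OF T(2,3)] by simp
    have lV': "length (V i) < Z" "Suc (length (V i)) < 2 ^ w" using lV ZK WK by linarith+
    let ?R = "\<lambda>v a n. v 4 = i \<and> I (Suc i) (v(4 := Suc i)) a (n + 4)"
    show "VC ?P ?R u b (m + (cost (Var 7) + 3))"
    proof (cases "low i")
      case False
      then have "I (Suc i) (u(4 := Suc i)) b m2" if "m2 \<le> m + 50" for m2
        using I that DS VS by (auto simp: I_def agree_except_def)
      then show ?thesis using False a(2) iN u by (simp add: vc_simps)
    next
      case low: True
      define J where "J = (\<lambda>l v' a' n'. a' = b \<and> agree_except {9, 10, 11} v' u \<and>
          v' 11 = (if filter (good T) (take l (L ! i)) = [] then 0 else 1) \<and> n' \<le> m + 40 + 60 * l)"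
      have "VC (For_adj 4 ?B @ ?C) ?R (u(11 := 0)) b m1" if m1: "m1 \<le> m + 30" for m1
      proof (rule vc_For_adj[where I = J and ?u0.0 = i])
        show "(u(11 := 0)) 4 = i" "i < n" "4 \<noteq> (9::nat)" using a iN by auto
        show "J 0 (u(11 := 0, 9 := offset L i)) b n1" if "n1 \<le> m1 + 5" for n1
          using that m1 by (auto simp: J_def agree_except_def)
        show "v' 4 = i" if "J l v' a' n'" for l v' a' n' using that a(2) by (simp add: J_def agree_except_def)
        show "VC ?C ?R v' a' n1"
          if "J (length (L ! i)) v' a' n'" "n1 \<le> n' + 7" for v' a' n' n1
        proof -
          from that have J: "a' = b" "agree_except {9, 10, 11} v' u" "v' 11 = (if good_nbrs T i = [] then 0 else 1)" "n' \<le> m + 40 + 60 * length (L ! i)"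
            by (auto simp: J_def good_nbrs_def)
          have v4: "v' 4 = i" "v' 12 = length (V i)" using J(2) a(2) I(2) by (simp_all add: agree_except_def)
          have "I (Suc i) (v'(4 := Suc i)) b m2" if "good_nbrs T i = []" "m2 \<le> n1 + 20" for m2
            using I J that \<open>n1 \<le> n' + 7\<close> DS VS by (auto simp: I_def agree_except_def)
          moreover have "I (Suc i) (v'(12 := Suc (length (V i)), 4 := Suc i)) (upd b 1 (length (V i)) i) m2"
            if "good_nbrs T i \<noteq> []" "m2 \<le> n1 + 20" for m2
            using I J that \<open>n1 \<le> n' + 7\<close> DS VS low
            by (auto simp: I_def agree_except_def upd_apply nth_append less_Suc_eq)
          ultimately show ?thesis
            using J(1,3) v4 lV' W64 w_pos by (simp add: vc_simps fun_upd_twist)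
        qed
      next
        fix l v' a' n' n1 assume c: "l < length (L ! i)" "J l v' a' n'" "n1 \<le> n' + 10" "v' 9 = offset L i + l" "L ! i ! l < n"
        let ?y = "L ! i ! l"
        from c have J: "a' = b" "agree_except {9, 10, 11} v' u"
          "v' 11 = (if filter (good T) (take l (L ! i)) = [] then 0 else 1)" "n' \<le> m + 40 + 60 * l"
          by (auto simp: J_def)
        have tk: "take (Suc l) (L ! i) = take l (L ! i) @ [?y]" using c(1) by (simp add: take_Suc_conv_app_nth)
        have vu: "v' 7 = T" "v' 3 = 2 * k" using J(2) u by (simp_all add: agree_except_def)
        have "J (Suc l) (v'(10 := ?y, 11 := Suc 0, 9 := Suc (offset L i + l))) b n2"
          if "good T ?y" "n2 \<le> n' + 60" for n2
          using that J by (auto simp: J_def tk agree_except_def)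
        moreover have "J (Suc l) (v'(10 := ?y, 9 := Suc (offset L i + l))) b n2"
          if "\<not> good T ?y" "n2 \<le> n' + 60" for n2
          using that J by (auto simp: J_def tk agree_except_def)
        ultimately show "VC ?B (\<lambda>v' a' n'. v' 9 = offset L i + l \<and> J (Suc l) (v'(9 := Suc (offset L i + l))) a' (n' + 4))
            (v'(10 := ?y)) a' n1"
          using c vu J(1) W64 w_pos by (simp add: vc_simps fun_upd_twist)
      qed
      then show ?thesis using low a(2) iN u W64 w_pos by (simp add: vc_simps)
    qed
  qed (use n_lt T in auto)
  then show ?thesis by (simp add: find_kverts_def vc_simps w_pos)
qed

end

text \<open>Address table and lists are written in one sweep: when a vertex is started, the next
  free position in variable \<open>14\<close> is exactly its table entry. Nothing needs to be
  counted beforehand except the number of vertices.\<close>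

definition write_kernel :: "stm list" where
  "write_kernel = [Asg 13 (Var 12 \<oplus> Var 5 \<oplus> Var 5), Asg 14 (Var 13 \<oplus> Num 3),
     Wr 2 (Num 0) (Var 1), Wr 2 (Num 1) (Var 13), Asg 15 (Num 0),
     For 15 (Var 12) ([Wr 2 (Var 15 \<oplus> Num 2) (Var 14), Asg 4 (Arr 1 (Var 15))] @
       For_adj 4 [Cnd (good_exp 10) (bsearch 1 12 @ [Wr 2 (Var 14) (Var 16), Asg 14 (Var 14 \<oplus> Num 1)]) []]),
     Asg 19 (Num 0),
     For 19 (Var 5) [Wr 2 (Var 15 \<oplus> Num 2) (Var 14), Wr 2 (Var 14) (Var 15 \<oplus> Num 1),
       Wr 2 (Var 15 \<oplus> Num 3) (Var 14 \<oplus> Num 1), Wr 2 (Var 14 \<oplus> Num 1) (Var 15),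
       Asg 14 (Var 14 \<oplus> Num 2), Asg 15 (Var 15 \<oplus> Num 2)],
     Wr 2 (Var 13 \<oplus> Num 2) (Var 14)]"

text \<open>There are at most \<open>6 * k\<^sup>2\<close> cut edges, hence at most
  \<open>12 * k\<^sup>2\<close> kernel vertices, and \<open>b\<close> rounds of binary search
  suffice.\<close>

locale kernel_ram = ram n E L k w Z for n E L k w Z +
  fixes T b :: nat
  assumes T: "T \<le> n" "card (cut_edges T) \<le> 4 * k\<^sup>2 + 2 * k" and b: "12 * k\<^sup>2 < 2 ^ b"
begin

lemma bK: "12 * K < 2 ^ b" using b by (simp add: K_def)

lemma TK: "card (cut_edges T) \<le> 4 * K + 2 * k" using T(2) by (simp add: K_def)

section \<open>Layout of the encoded kernel\<close>

abbreviation "m \<equiv> length (kverts T)"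
abbreviation "h \<equiv> length highs"
abbreviation "off \<equiv> offset (kL T)"

lemma m_le: "m \<le> 12 * K" using kverts_bound[OF T(1) TK] .

lemma h_le: "h \<le> k" by (rule length_highs)

lemma off_0: "off 0 = kn T + 3" by (simp add: offset_def length_kL)

lemma off_m: "i \<le> m \<Longrightarrow> off i = kn T + 3 + (\<Sum>i'<i. length (good_nbrs T (kverts T ! i')))"
  by (simp add: offset_def length_kL kL_nth(1))

lemma off_gadget: "j \<le> 2 * h \<Longrightarrow> off (m + j) = off m + j"
  by (induction j) (simp_all add: offset_Suc kL_nth(2))

lemma off_m_le: "off m \<le> kn T + 3 + 12 * K"
  using sum_good_nbrs[OF T(1)] TK k_le off_m[of m] by linarith

text \<open>The \<open>28 * K\<close> words are \<open>14 * K\<close> for the addresses,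
  \<open>12 * K\<close> for the lists of renamed vertices and \<open>2 * K\<close> for those of the
  gadgets.\<close>

lemma off_kn: "off (kn T) \<le> 28 * K + 3"
  using off_gadget[of "2 * h"] off_m_le m_le h_le k_le by simp

lemma off_le: "i \<le> kn T \<Longrightarrow> off i \<le> 28 * K + 3"
  using off_kn offset_mono[of i "kn T" "kL T"] by simp

lemma off_ge: "kn T + 3 \<le> off i" by (simp add: offset_def length_kL)

definition filled :: "nat \<Rightarrow> arrs \<Rightarrow> bool" where
  "filled i a \<longleftrightarrow> a 2 0 = k \<and> a 2 (Suc 0) = kn T \<and> (\<forall>u<i. a 2 (Suc (Suc u)) = off u \<and>
     (\<forall>l<length (kL T ! u). a 2 (off u + l) = kL T ! u ! l))"

text \<open>While the kernel is being written there is a gap between the finished part of the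
  address table and the lists. Writes into this gap or beyond \<open>off i\<close> do no
  harm.\<close>

lemma filled_frame:
  assumes "filled i a" "i \<le> kn T"
    and eq: "\<And>p. p < off i \<Longrightarrow> p < i + 2 \<or> kn T + 3 \<le> p \<Longrightarrow> a' 2 p = a 2 p"
  shows "filled i a'"
  unfolding filled_def
proof (intro conjI allI impI)
  show "a' 2 0 = k" "a' 2 (Suc 0) = kn T" using assms off_ge[of i] by (auto simp: filled_def)
  fix u assume u: "u < i"
  show "a' 2 (Suc (Suc u)) = off u" using assms(1) eq[of "Suc (Suc u)"] u off_ge[of i] assms(2)
    by (auto simp: filled_def)
  fix l assume l: "l < length (kL T ! u)"
  then have "off u + l < off i" using offset_mono[of "Suc u" i "kL T"] u by (simp add: offset_Suc)
  then show "a' 2 (off u + l) = kL T ! u ! l"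
    using assms(1) u l eq[of "off u + l"] off_ge[of u] by (auto simp: filled_def)
qed

lemma filled_Suc:
  "filled i a \<Longrightarrow> a 2 (Suc (Suc i)) = off i \<Longrightarrow> (\<And>l. l < length (kL T ! i) \<Longrightarrow> a 2 (off i + l) = kL T ! i ! l) \<Longrightarrow>
    filled (Suc i) a"
  by (auto simp: filled_def less_Suc_eq)

text \<open>The table has one more address than there are vertices. This closing entry lies outside
  \<open>filled\<close> and is supplied by the last write.\<close>

lemma filled_encode:
  assumes "filled (kn T) a" "a 2 (kn T + 2) = off (kn T)" "p < length (encode (kL T) k)"
  shows "a 2 p = encode (kL T) k ! p"
  using assms(3)
proof (cases rule: encode_index_cases)
  case (3 u)
  then show ?thesis using assms(1,2) encode_nth(3)[of u "kL T" k]
    by (cases "u = kn T") (auto simp: filled_def length_kL)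
qed (use assms(1) encode_nth(1,2,4) in \<open>auto simp: filled_def length_kL\<close>)

text \<open>An \<open>Input\<close> command truncates to words, so the simulation is faithful only
  if every word of the encoded kernel fits.\<close>

lemma encode_lt:
  assumes "p < length (encode (kL T) k)"
  shows "encode (kL T) k ! p < 2 ^ w"
proof -
  interpret G: graph_input "kn T" "kE T" "kL T" k
    using ugraph_kE[OF T(1)] adjacency_kL[OF T(1)] by unfold_locales
  have kn: "kn T < 2 ^ w" "28 * K + 3 < 2 ^ w" "k < 2 ^ w" using m_le h_le k_le WK by linarith+
  show ?thesis
    using assms
  proof (cases rule: encode_index_cases)
    case (3 u)
    then show ?thesis using encode_nth(3)[of u "kL T" k] off_le[of u] kn by (simp add: length_kL)
  next
    case (4 u i)
    then have "kL T ! u ! i < kn T" using G.set_L[of u "kL T ! u ! i"] G.edgeD by (auto simp: length_kL)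
    then show ?thesis using encode_nth(4)[of u "kL T" i k] 4 kn by simp
  qed (use kn encode_nth(1,2)[of "kL T" k] in \<open>auto simp: length_kL\<close>)
qed

lemma length_y: "length (encode (kL T) k) = off (kn T)"
  by (simp add: length_encode length_kL)

lemma sum_kverts: "(\<Sum>i<m. length (L ! (kverts T ! i))) \<le> 2 * card E"
proof -
  have "(\<Sum>i<m. length (L ! (kverts T ! i))) = sum_list (map (\<lambda>u. length (L ! u)) (kverts T))"
    by (simp add: sum_list_sum_nth atLeast0LessThan)
  also have "\<dots> = (\<Sum>u\<in>set (kverts T). length (L ! u))"
    using distinct_kverts by (simp add: sum_list_distinct_conv_sum_set)
  also have "\<dots> \<le> (\<Sum>u<n. length (L ! u))"
    using T(1) by (intro sum_mono2) (auto simp: kverts_def)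
  finally show ?thesis using sum_degrees by simp
qed

lemma m_le_n: "m \<le> n"
  using length_filter_le[of "\<lambda>u. low u \<and> good_nbrs T u \<noteq> []" "[0..<T]"] T(1) by (simp add: kverts_def del: length_filter_le)

lemma sorted_arr_kverts: "(\<And>i. i < m \<Longrightarrow> a 1 i = kverts T ! i) \<Longrightarrow> sorted_arr (a 1) m"
  using sorted_kverts[of T] unfolding sorted_arr_def sorted_wrt_iff_nth_less
  by (metis le_less_trans le_neq_implies_less less_imp_le order_refl)

text \<open>Reading costs a constant per input entry, while each binary search is charged to the
  kernel word that it produces, whence the term \<open>off i - off 0\<close> in the invariant. This
  keeps the logarithm away from the size of the input.\<close>

lemma vc_write_kernel:
  assumes v: "pre v" "v 7 = T" "v 12 = m" "v 5 = h" and a: "\<And>i. i < m \<Longrightarrow> a 1 i = kverts T ! i"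
    and fin: "\<And>v' a' n'. agree_except {4, 9, 10, 13, 14, 15, 16, 17, 18, 19} v' v \<Longrightarrow> v' 14 = length (encode (kL T) k) \<Longrightarrow>
      (\<And>p. p < length (encode (kL T) k) \<Longrightarrow> a' 2 p = encode (kL T) k ! p) \<Longrightarrow> (\<And>j. j \<noteq> 2 \<Longrightarrow> a' j = a j) \<Longrightarrow>
      n' \<le> n0 + 100 * (n + 2 * card E) + (25 * b + 60) * (12 * K) + 100 * k + 100 \<Longrightarrow> VC Ps Q v' a' n'"
  shows "VC (write_kernel @ Ps) Q v a n0"
proof -
  note v' = preD[OF v(1)]
  define D where "D i = (\<Sum>j<i. length (L ! (kverts T ! j)))" for i
  define S :: "nat set" where "S = {4, 9, 10, 13, 14, 15, 16, 17, 18, 19}"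
  let ?c = "25 * b + 60"
  define B where "B = n0 + 100 * (n + 2 * card E) + ?c * (12 * K) + 60"
  define I where "I = (\<lambda>i v' a' n'. agree_except S v' v \<and> v' 13 = kn T \<and> v' 14 = off i \<and> filled i a' \<and>
    (\<forall>j. j \<noteq> 2 \<longrightarrow> a' j = a j) \<and> n' \<le> n0 + 40 + 100 * (i + D i) + ?c * (off i - off 0))"
  define I2 where "I2 = (\<lambda>g v' a' n'. agree_except S v' v \<and> v' 13 = kn T \<and> v' 14 = off (m + 2 * g) \<and> v' 15 = m + 2 * g \<and>
    filled (m + 2 * g) a' \<and> (\<forall>j. j \<noteq> 2 \<longrightarrow> a' j = a j) \<and> n' \<le> B + 80 * g)"
  let ?B = "[Cnd (good_exp 10) (bsearch 1 12 @ [Wr 2 (Var 14) (Var 16), Asg 14 (Var 14 \<oplus> Num 1)]) []]"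
  let ?P = "[Wr 2 (Var 15 \<oplus> Num 2) (Var 14), Asg 4 (Arr 1 (Var 15))] @ For_adj 4 ?B"
  let ?P2 = "[Wr 2 (Var 15 \<oplus> Num 2) (Var 14), Wr 2 (Var 14) (Var 15 \<oplus> Num 1),
       Wr 2 (Var 15 \<oplus> Num 3) (Var 14 \<oplus> Num 1), Wr 2 (Var 14 \<oplus> Num 1) (Var 15),
       Asg 14 (Var 14 \<oplus> Num 2), Asg 15 (Var 15 \<oplus> Num 2)]"
  let ?last = "Wr 2 (Var 13 \<oplus> Num 2) (Var 14)"
  have kn: "kn T \<le> 14 * K" using m_le h_le k_le by linarith
  have bnd: "14 * K + 5 < 2 ^ w" "28 * K + 10 < 2 ^ w" "28 * K + 10 < Z" using WK ZK by linarith+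
  have final: "VC Ps Q u (upd a2 2 (kn T + 2) (off (kn T))) n2"
    if u: "I2 h u a2 n1" "n2 \<le> n1 + 20" for u a2 n1 n2
  proof (rule fin)
    from u have I: "agree_except S u v" "u 14 = off (kn T)" "filled (kn T) a2" "\<And>j. j \<noteq> 2 \<Longrightarrow> a2 j = a j" "n1 \<le> B + 80 * h"
      by (auto simp: I2_def)
    show "agree_except {4, 9, 10, 13, 14, 15, 16, 17, 18, 19} u v" using I(1) by (simp add: S_def)
    show "u 14 = length (encode (kL T) k)" using I(2) by (simp add: length_y)
    show "upd a2 2 (kn T + 2) (off (kn T)) j = a j" if "j \<noteq> 2" for j using I(4)[OF that] that by (simp add: upd_def)
    show "n2 \<le> n0 + 100 * (n + 2 * card E) + ?c * (12 * K) + 100 * k + 100"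
      using u(2) I(5) h_le unfolding B_def by linarith
    fix p assume p: "p < length (encode (kL T) k)"
    show "upd a2 2 (kn T + 2) (off (kn T)) 2 p = encode (kL T) k ! p"
    proof (rule filled_encode[where a = "upd a2 2 (kn T + 2) (off (kn T))", OF _ _ p])
      show "filled (kn T) (upd a2 2 (kn T + 2) (off (kn T)))"
        by (rule filled_frame[OF I(3)]) (auto simp: upd_apply)
    qed (simp add: upd_apply)
  qed
  have loop2: "VC (For 19 (Var 5) ?P2 # ?last # Ps) Q (u(19 := 0)) a2 n1"
    if u: "I m u a2 n2" "u 15 = m" "n1 \<le> n2 + 10" for u a2 n1 n2
  proof (rule vc_For[where I = I2 and lo = 0 and hi = h])
    have "off m - off 0 \<le> 12 * K" using off_m_le off_0 by simp
    then have 1: "?c * (off m - off 0) \<le> ?c * (12 * K)" by (rule mult_le_mono2)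
    have 2: "100 * (m + D m) \<le> 100 * (n + 2 * card E)"
      using sum_kverts m_le_n by (simp add: D_def)
    have 3: "n2 \<le> n0 + 40 + 100 * (m + D m) + ?c * (off m - off 0)" using u(1) unfolding I_def by blast
    have "n1 \<le> n0 + A' + P' + 60" if "n2 \<le> n0 + 40 + A + P" "A \<le> A'" "P \<le> P'" for A A' P P'
      using that u(3) by linarith
    from this[OF 3 2 1] have "n1 \<le> B" unfolding B_def .
    then show "I2 0 (u(19 := 0)) a2 n1" using u by (auto simp: I_def I2_def agree_except_def S_def)
    show "ok w Z (encode L k) (Var 5) u' b' \<and> val (encode L k) (Var 5) u' b' = h" if "I2 i u' b' m'" for i u' b' m'
      using that v(4) by (simp add: I2_def agree_except_def S_def)
    show "h < 2 ^ w" "1 < (2::nat) ^ w" using h_le k_le WK W64 by linarith+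
    show "VC (?last # Ps) Q u' b' (m' + (cost (Var 5) + 3))" if "I2 h u' b' m'" for u' b' m'
      using final[OF that] that off_kn bnd kn w_pos W64 by (simp add: vc_simps I2_def add.commute)
  next
    fix g u' b' m' assume g: "I2 g u' b' m'" "u' 19 = g" "g < h"
    let ?i = "m + 2 * g"
    from g have I: "agree_except S u' v" "u' 13 = kn T" "u' 14 = off ?i" "u' 15 = ?i" "filled ?i b'"
      "\<And>j. j \<noteq> 2 \<Longrightarrow> b' j = a j" "m' \<le> B + 80 * g"
      by (auto simp: I2_def)
    have i: "?i + 2 \<le> kn T" using g(3) by simp
    let ?o = "off ?i"
    have o: "off (Suc ?i) = Suc ?o" "off (Suc (Suc ?i)) = Suc (Suc ?o)"
      using off_gadget[of "2 * g"] off_gadget[of "2 * g + 1"] off_gadget[of "2 * g + 2"] g(3) by simp_all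
    have lists: "kL T ! ?i = [Suc ?i]" "kL T ! Suc ?i = [?i]"
      using kL_nth(2)[of "2 * g" T] kL_nth(2)[of "2 * g + 1" T] g(3) by simp_all
    let ?b = "upd (upd (upd (upd b' 2 (Suc (Suc ?i)) ?o) 2 ?o (Suc ?i)) 2 (Suc (Suc (Suc ?i))) (Suc ?o)) 2 (Suc ?o) ?i"
    have og: "kn T + 3 \<le> ?o" by (rule off_ge)
    have f0: "filled ?i ?b"
      by (rule filled_frame[OF I(5)]) (use i og in \<open>auto simp: upd_apply\<close>)
    have f1: "filled (Suc ?i) ?b"
      by (rule filled_Suc[OF f0]) (use i og lists in \<open>auto simp: upd_apply\<close>)
    have f2: "filled (Suc (Suc ?i)) ?b"
      by (rule filled_Suc[OF f1]) (use i og lists o in \<open>auto simp: upd_apply\<close>)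
    have "I2 (Suc g) (u'(14 := Suc (Suc ?o), 15 := Suc (Suc ?i), 19 := Suc g)) ?b m2" if "m2 \<le> m' + 80" for m2
      using f2 o I that by (auto simp: I2_def agree_except_def S_def upd_def)
    moreover have "?o \<le> 28 * K + 3" using off_le[of ?i] i by simp
    ultimately show "VC ?P2 (\<lambda>v a n. v 19 = g \<and> I2 (Suc g) (v(19 := Suc g)) a (n + 4)) u' b' (m' + (cost (Var 5) + 3))"
      using I g(2) i kn bnd W64 w_pos by (simp add: vc_simps numeral_3_eq_3)
  qed simp_all
  have loop1: "VC (For 15 (Var 12) ?P # Asg 19 (Num 0) # For 19 (Var 5) ?P2 # ?last # Ps) Q u a2 n1"
    if u: "agree_except S u v" "u 13 = kn T" "u 14 = off 0" "u 15 = 0" "filled 0 a2" "\<And>j. j \<noteq> 2 \<Longrightarrow> a2 j = a j" "n1 \<le> n0 + 40"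
    for u a2 n1
  proof (rule vc_For[where I = I and lo = 0 and hi = m])
    show "I 0 u a2 n1" using u by (auto simp: I_def)
    show "u 15 = 0" by fact
    show "ok w Z (encode L k) (Var 12) u' b' \<and> val (encode L k) (Var 12) u' b' = m" if "I i u' b' m'" for i u' b' m'
      using that v(3) by (simp add: I_def agree_except_def S_def)
    show "m < 2 ^ w" "1 < (2::nat) ^ w" using m_le WK W64 by linarith+
    show "VC (Asg 19 (Num 0) # For 19 (Var 5) ?P2 # ?last # Ps) Q u' b' (m' + (cost (Var 12) + 3))"
      if "I m u' b' m'" "u' 15 = m" for u' b' m'
      using loop2[OF that] w_pos by (simp add: vc_simps add.commute)
  next
    fix i u' b' m' assume i: "I i u' b' m'" "u' 15 = i" "i < m"
    from i have I: "agree_except S u' v" "u' 13 = kn T" "u' 14 = off i" "filled i b'"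
      "\<And>j. j \<noteq> 2 \<Longrightarrow> b' j = a j" "m' \<le> n0 + 40 + 100 * (i + D i) + ?c * (off i - off 0)"
      by (auto simp: I_def)
    let ?R = "\<lambda>v a n. v 15 = i \<and> I (Suc i) (v(15 := Suc i)) a (n + 4)"
    define y where "y = kverts T ! i"
    have yV: "y \<in> set (kverts T)" using i(3) by (simp add: y_def)
    then have yn: "y < n" using T(1) by (auto simp: kverts_def)
    have b1: "b' 1 = a 1" using I(5) by simp
    have u3: "u' 3 = 2 * k" "u' 7 = T" "u' 12 = m" using I(1) v v' by (simp_all add: agree_except_def S_def)
    let ?b = "upd b' 2 (Suc (Suc i)) (off i)"
    let ?u = "u'(4 := y)"
    have fb: "filled i ?b" by (rule filled_frame[OF I(4)]) (use i(3) in \<open>auto simp: upd_apply\<close>)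
    have kLi: "kL T ! i = map (idx T) (good_nbrs T y)" using kL_nth(1)[OF i(3)] by (simp add: y_def)
    define F where "F l = filter (good T) (take l (L ! y))" for l
    define J where "J = (\<lambda>l v' a' n'. agree_except {9, 10, 14, 16, 17, 18} v' ?u \<and> (\<forall>j. j \<noteq> 2 \<longrightarrow> a' j = a j) \<and>
      (\<forall>p<off i. a' 2 p = ?b 2 p) \<and> v' 14 = off i + length (F l) \<and>
      (\<forall>l'<length (F l). a' 2 (off i + l') = idx T (F l ! l')) \<and> n' \<le> m' + 60 + 80 * l + ?c * length (F l))"
    have "VC (For_adj 4 ?B @ []) ?R ?u ?b m1" if m1: "m1 \<le> m' + 30" for m1
    proof (rule vc_For_adj[where I = J and ?u0.0 = y])
      show "?u 4 = y" "y < n" "4 \<noteq> (9::nat)" using yn by auto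
      show "J 0 (?u(9 := offset L y)) ?b n1" if "n1 \<le> m1 + 5" for n1
        using that m1 I(3,5) by (auto simp: J_def F_def agree_except_def upd_def)
      show "v' 4 = y" if "J l v' a' n'" for l v' a' n' using that by (simp add: J_def agree_except_def)
      show "VC [] ?R v' a' n1" if J: "J (length (L ! y)) v' a' n'" "n1 \<le> n' + 7" for v' a' n' n1
      proof -
        have F: "F (length (L ! y)) = good_nbrs T y" by (simp add: F_def good_nbrs_def)
        have J': "agree_except {9, 10, 14, 16, 17, 18} v' ?u" "\<And>j. j \<noteq> 2 \<Longrightarrow> a' j = a j" "\<And>p. p < off i \<Longrightarrow> a' 2 p = ?b 2 p"
          "v' 14 = off i + length (good_nbrs T y)" "\<And>l'. l' < length (good_nbrs T y) \<Longrightarrow> a' 2 (off i + l') = idx T (good_nbrs T y ! l')"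
          "n' \<le> m' + 60 + 80 * length (L ! y) + ?c * length (good_nbrs T y)"
          using J(1) F by (auto simp: J_def)
        have oS: "off (Suc i) = off i + length (good_nbrs T y)" by (simp add: offset_Suc kLi)
        have "Suc (Suc i) < off i" using off_ge[of i] i(3) by simp
        then have "a' 2 (Suc (Suc i)) = off i" using J'(3) by (simp add: upd_apply)
        then have "filled (Suc i) a'"
          using filled_Suc[OF filled_frame[OF fb]] J'(3,5) i(3) by (simp add: kLi)
        moreover have "?c * (off (Suc i) - off 0) = ?c * (off i - off 0) + ?c * length (good_nbrs T y)"
        proof -
          have "off (Suc i) - off 0 = (off i - off 0) + length (good_nbrs T y)"
            using oS off_ge[of i] off_0 by simp
          then show ?thesis by (simp only: add_mult_distrib2)
        qed
        moreover have "D (Suc i) = D i + length (L ! y)" by (simp add: D_def y_def)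
        moreover have "agree_except S (v'(15 := Suc i)) v" using J'(1) I(1) by (auto simp: agree_except_def S_def)
        moreover have "v' 15 = i" "v' 13 = kn T" using J'(1) i(2) I(2) by (simp_all add: agree_except_def)
        ultimately show ?thesis using J' J(2) I(6) oS by (simp add: vc_simps I_def)
      qed
    next
      fix l v' a' n' n1
      assume c: "l < length (L ! y)" "J l v' a' n'" "n1 \<le> n' + 10" "v' 9 = offset L y + l" "L ! y ! l < n"
      let ?z = "L ! y ! l"
      have J: "agree_except {9, 10, 14, 16, 17, 18} v' ?u" "\<And>j. j \<noteq> 2 \<Longrightarrow> a' j = a j" "\<And>p. p < off i \<Longrightarrow> a' 2 p = ?b 2 p"
          "v' 14 = off i + length (F l)" "\<And>l'. l' < length (F l) \<Longrightarrow> a' 2 (off i + l') = idx T (F l ! l')"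
          "n' \<le> m' + 60 + 80 * l + ?c * length (F l)"
        using c(2) by (auto simp: J_def)
      have FS: "F (Suc l) = (if good T ?z then F l @ [?z] else F l)"
        using c(1) by (simp add: F_def take_Suc_conv_app_nth)
      have vu: "v' 3 = 2 * k" "v' 7 = T" "v' 12 = m" using J(1) u3 by (simp_all add: agree_except_def)
      let ?Q = "\<lambda>v' a' n'. v' 9 = offset L y + l \<and> J (Suc l) (v'(9 := Suc (offset L y + l))) a' (n' + 4)"
      show "VC ?B ?Q (v'(10 := ?z)) a' n1"
      proof (cases "good T ?z")
        case False
        then have "J (Suc l) (v'(10 := ?z, 9 := Suc (offset L y + l))) a' n2" if "n2 \<le> n' + 40" for n2
          using J that FS by (auto simp: J_def agree_except_def)
        then show ?thesis using False c vu by (simp add: vc_simps)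
      next
        case True
        have "F (length (L ! y)) = F l @ filter (good T) (drop l (L ! y))"
          unfolding F_def by (metis append_take_drop_id filter_append order_refl take_all)
        then have "length (F l) \<le> length (good_nbrs T y)" by (simp add: F_def good_nbrs_def)
        then have "off i + length (F l) \<le> off (Suc i)" by (simp add: offset_Suc kLi)
        then have pos: "off i + length (F l) \<le> 28 * K + 3" using off_le[of "Suc i"] i(3) by simp
        have "VC (bsearch 1 12 @ [Wr 2 (Var 14) (Var 16), Asg 14 (Var 14 \<oplus> Num 1)]) ?Q (v'(10 := ?z)) a' n2"
          if n2: "n2 \<le> n1 + 20" for n2
        proof (rule vc_bsearch[where S = m and b = b])
          have a1: "a' 1 = a 1" using J(2) by simp
          show "sorted_arr (a' 1) m" using sorted_arr_kverts[of a'] a a1 by simp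
          show "(v'(10 := ?z)) 12 = m" "m < 2 ^ b" "m \<le> Z" "1 < (8::nat)" "12 \<notin> {16, 17, 18::nat}"
            using vu m_le bK ZK by auto
          fix v2 n3 p assume p: "agree_except {16, 17, 18} v2 (v'(10 := ?z))" "v2 16 = p" "p \<le> m"
            "\<And>i. i < p \<Longrightarrow> a' 1 i < (v'(10 := ?z)) 10" "\<And>i. p \<le> i \<Longrightarrow> i < m \<Longrightarrow> (v'(10 := ?z)) 10 \<le> a' 1 i"
            "n3 \<le> n2 + 25 * b + 10"
          have idx: "idx T ?z = p"
            by (rule idxI) (use p a a1 in auto)
          have v2: "v2 14 = off i + length (F l)" "v2 9 = offset L y + l" using p(1) J(4) c(4) by (simp_all add: agree_except_def)
          have "J (Suc l) (v2(14 := Suc (off i + length (F l)), 9 := Suc (offset L y + l)))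
              (upd a' 2 (off i + length (F l)) p) n4" if "n4 \<le> n3 + 15" for n4
            unfolding J_def
          proof (intro conjI allI impI)
            let ?v = "v2(14 := Suc (off i + length (F l)), 9 := Suc (offset L y + l))"
            show "agree_except {9, 10, 14, 16, 17, 18} ?v ?u" using p(1) J(1) by (auto simp: agree_except_def)
            show "?v 14 = off i + length (F (Suc l))" using FS True by simp
            show "n4 \<le> m' + 60 + 80 * Suc l + ?c * length (F (Suc l))"
              using that n2 p(6) J(6) c(3) FS True by simp
          qed (use J FS True idx in \<open>auto simp: upd_apply nth_append less_Suc_eq\<close>)
          then show "VC [Wr 2 (Var 14) (Var 16), Asg 14 (Var 14 \<oplus> Num 1)] ?Q v2 a' n3"
            using v2 p(2) pos bnd w_pos by (simp add: vc_simps)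
        qed
        then show ?thesis using True c vu by (simp add: vc_simps)
      qed
    qed
    moreover have "i < Z" "Suc (Suc i) < Z" "Suc (Suc i) < 2 ^ w" using i(3) m_le ZK WK by linarith+
    ultimately show "VC ?P ?R u' b' (m' + (cost (Var 12) + 3))"
      using I(3) i(2,3) b1 a W64 w_pos by (simp add: vc_simps y_def upd_apply)
  qed simp_all
  have start: "VC (For 15 (Var 12) ?P # Asg 19 (Num 0) # For 19 (Var 5) ?P2 # ?last # Ps) Q
      (v(13 := q, 14 := r, 15 := 0)) (upd (upd a 2 0 k) 2 (Suc 0) q) n1"
    if "n1 \<le> n0 + 40" "q = kn T" "r = kn T + 3" for n1 q r
    by (rule loop1) (use that off_0 in \<open>auto simp: agree_except_def S_def filled_def upd_apply upd_def\<close>)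
  show ?thesis using v v' kn bnd w_pos W64
    by (simp add: write_kernel_def vc_simps) (rule start[simplified]; simp)
qed

end

section \<open>Extending the answer to the input graph\<close>

text \<open>An edge of the kernel lies entirely among the renamed vertices or is a gadget, so
  testing one endpoint is enough. Gadget edges are merely counted, in variable
  \<open>11\<close>.\<close>

definition translate_back :: "stm list" where
  "translate_back = [Asg 20 (Num 0), Asg 21 (Num 0), Asg 11 (Num 0), Asg 15 (Num 0),
     For 15 (Var 1) [Asg 10 (Arr 3 (Var 15 \<oplus> Var 15)), Asg 24 (Arr 3 (Var 15 \<oplus> Var 15 \<oplus> Num 1)),
       Cnd (Var 10 \<lhd> Var 12)
         ([Asg 10 (Arr 1 (Var 10)), Asg 24 (Arr 1 (Var 24)), Wr 6 (Var 20) (Var 10),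
           Wr 6 (Var 20 \<oplus> Num 1) (Var 24), Asg 20 (Var 20 \<oplus> Num 2), Asg 22 (Var 10)] @ insort_prog @
          Asg 22 (Var 24) # insort_prog)
         [Asg 11 (Var 11 \<oplus> Num 1)]]]"

text \<open>The high vertices still to be matched are marked as used in advance, so that none of
  them becomes the partner of another.\<close>

definition reserve_highs :: "stm list" where
  "reserve_highs = [Asg 15 (Num 0), For 15 (Var 11) (Asg 22 (Arr 4 (Var 15)) # insort_prog)]"

text \<open>Inspecting \<open>2 * k\<close> neighbours is enough and makes the time independent of
  the degree. The inner loop does not stop at a free neighbour; the last one found stays in variable
  \<open>24\<close>.\<close>

definition match_highs :: "stm list" where
  "match_highs = [Asg 15 (Num 0), For 15 (Var 11)
     ([Asg 4 (Arr 4 (Var 15)), Asg 9 (adj_start 4), Asg 25 (Var 9 \<oplus> Var 3),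
       For 9 (Var 25) (Asg 10 (Inp (Var 9)) # bsearch 5 21 @
         [Cnd ((Var 16 \<lhd> Var 21) \<otimes> Bin Eq (Arr 5 (Var 16)) (Var 10)) [] [Asg 24 (Var 10)]]),
       Wr 6 (Var 20) (Var 4), Wr 6 (Var 20 \<oplus> Num 1) (Var 24), Asg 20 (Var 20 \<oplus> Num 2), Asg 22 (Var 24)] @ insort_prog)]"

text \<open>Cell \<open>i\<close> of array \<open>6\<close> has an address above \<open>i\<close>, so copying upwards overwrites only cells
  that have already been read.\<close>

definition copy_out :: "stm list" where
  "copy_out = [Asg 15 (Num 0), For 15 (Var 3) [Out (Var 15) (Arr 6 (Var 15))]]"

context kernel_ram
begin

section \<open>Translating the kernel matching back\<close>

definition pairs :: "nat \<Rightarrow> arrs \<Rightarrow> bool" where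
  "pairs d a \<longleftrightarrow> inj_on (a 6) {..<2 * d} \<and> (\<forall>j<d. {a 6 (2 * j), a 6 (2 * j + 1)} \<in> E)"

lemma pairs_Suc:
  assumes "pairs d a" "{y, z} \<in> E" "y \<notin> a 6 ` {..<2 * d}" "z \<notin> a 6 ` {..<2 * d}"
    and eq: "\<And>p. p < 2 * d \<Longrightarrow> a' 6 p = a 6 p" "a' 6 (2 * d) = y" "a' 6 (Suc (2 * d)) = z"
  shows "pairs (Suc d) a'" "a' 6 ` {..<2 * Suc d} = insert y (insert z (a 6 ` {..<2 * d}))"
proof -
  have S: "{..<2 * Suc d} = insert (2 * d) (insert (Suc (2 * d)) {..<2 * d})" by auto
  have im: "a' 6 ` {..<2 * d} = a 6 ` {..<2 * d}" using eq(1) by auto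
  show "a' 6 ` {..<2 * Suc d} = insert y (insert z (a 6 ` {..<2 * d}))"
    unfolding S image_insert im eq(2,3) ..
  have "y \<noteq> z" using edgeD[OF assms(2)] by simp
  moreover have "inj_on (a' 6) {..<2 * d}" using assms(1) eq(1) by (auto simp: pairs_def inj_on_def)
  ultimately have "inj_on (a' 6) {..<2 * Suc d}"
    unfolding S using assms(3,4) im eq(2,3) by (auto simp: inj_on_insert)
  moreover have "{a' 6 (2 * j), a' 6 (2 * j + 1)} \<in> E" if "j < Suc d" for j
  proof (cases "j = d")
    case True
    then show ?thesis using eq(2,3) assms(2) by simp
  next
    case False
    then have "j < d" "2 * j < 2 * d" "2 * j + 1 < 2 * d" using that by auto
    then show ?thesis using assms(1) eq(1) by (simp add: pairs_def)
  qed
  ultimately show "pairs (Suc d) a'" by (simp add: pairs_def)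
qed

lemma kE_low:
  assumes "{p, q} \<in> kE T" "p < m"
  shows "q < m" "{kverts T ! p, kverts T ! q} \<in> cut_edges T"
proof -
  have "{p, q} \<noteq> {m + 2 * i, m + 2 * i + 1}" for i using assms(2) by (auto simp: doubleton_eq_iff)
  then obtain f where f: "f \<in> cut_edges T" "{p, q} = idx T ` f" using assms(1) unfolding kE_def by auto
  then obtain c d where cd: "f = {c, d}" by (metis cut_edges_edgeE)
  then have V: "c \<in> set (kverts T)" "d \<in> set (kverts T)" using cut_edges_subset_kverts[OF T(1) f(1)] by auto
  from f(2) cd consider "p = idx T c" "q = idx T d" | "p = idx T d" "q = idx T c"
    by (auto simp: doubleton_eq_iff)
  then have "q < m \<and> {kverts T ! p, kverts T ! q} \<in> cut_edges T"
  proof cases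
    case 1
    then show ?thesis using nth_idx[OF V(1)] nth_idx[OF V(2)] f(1) cd by simp
  next
    case 2
    then show ?thesis using nth_idx[OF V(1)] nth_idx[OF V(2)] f(1) cd by (simp add: insert_commute)
  qed
  then show "q < m" "{kverts T ! p, kverts T ! q} \<in> cut_edges T" by blast+
qed

lemma kE_high:
  assumes "{p, q} \<in> kE T" "\<not> p < m"
  shows "\<exists>g<h. {p, q} = {m + 2 * g, m + 2 * g + 1}"
proof -
  have "{p, q} \<noteq> idx T ` f" if "f \<in> cut_edges T" for f
  proof
    assume "{p, q} = idx T ` f"
    then obtain c where "c \<in> f" "p = idx T c" by auto
    then show False using assms(2) nth_idx[of c T] cut_edges_subset_kverts[OF T(1) that] by auto
  qed
  then show ?thesis using assms(1) unfolding kE_def by auto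
qed

text \<open>Different matching edges on the gadget side are different gadgets, so there are enough
  high vertices to take their places.\<close>

lemma count_high:
  assumes inj: "inj_on f {..<2 * k}" and E: "\<And>i. i < k \<Longrightarrow> {f (2 * i), f (2 * i + 1)} \<in> kE T"
  shows "card {i. i < k \<and> \<not> f (2 * i) < m} \<le> h"
proof -
  let ?S = "{i. i < k \<and> \<not> f (2 * i) < m}"
  have "\<forall>i\<in>?S. \<exists>g. g < h \<and> {f (2 * i), f (2 * i + 1)} = {m + 2 * g, m + 2 * g + 1}"
  proof
    fix i assume "i \<in> ?S"
    then show "\<exists>g. g < h \<and> {f (2 * i), f (2 * i + 1)} = {m + 2 * g, m + 2 * g + 1}"
      using kE_high[OF E[of i]] by blast
  qed
  from bchoice[OF this] obtain g
    where g0: "\<forall>i\<in>?S. g i < h \<and> {f (2 * i), f (2 * i + 1)} = {m + 2 * g i, m + 2 * g i + 1}" by (rule exE)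
  note g = g0[THEN bspec, THEN conjunct1] g0[THEN bspec, THEN conjunct2]
  have "inj_on g ?S"
  proof (rule inj_onI)
    fix i j assume ij: "i \<in> ?S" "j \<in> ?S" "g i = g j"
    then have "{f (2 * i), f (2 * i + 1)} = {f (2 * j), f (2 * j + 1)}" using g(2) by simp
    then have "f (2 * i) = f (2 * j) \<or> f (2 * i) = f (2 * j + 1)" by (auto simp: doubleton_eq_iff)
    moreover have "2 * i < 2 * k" "2 * j < 2 * k" "2 * j + 1 < 2 * k" using ij by auto
    ultimately have "2 * i = 2 * j \<or> 2 * i = 2 * j + 1"
      using inj_onD[OF inj, of "2 * i" "2 * j"] inj_onD[OF inj, of "2 * i" "2 * j + 1"] by auto
    then show "i = j" by presburger
  qed
  then have "card ?S \<le> card {..<h}" using g(1) by (intro card_inj_on_le) auto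
  then show ?thesis by simp
qed

lemma low_kverts: "u \<in> set (kverts T) \<Longrightarrow> low u" by (simp add: kverts_def)

lemma highs_nth: "i < h \<Longrightarrow> \<not> low (highs ! i) \<and> highs ! i < n"
proof -
  assume "i < h"
  then have "highs ! i \<in> set (filter (\<lambda>u. \<not> low u) [0..<n])"
    unfolding highs_def using in_set_takeD nth_mem by metis
  then show ?thesis by simp
qed

lemma distinct_highs: "distinct highs" by (simp add: highs_def)

lemma vc_translate_back:
  assumes v: "pre v" "v 12 = m" and a: "\<And>i. i < m \<Longrightarrow> a 1 i = kverts T ! i"
    and f: "inj_on (a 3) {..<2 * k}" "\<And>i. i < k \<Longrightarrow> {a 3 (2 * i), a 3 (2 * i + 1)} \<in> kE T"
    and fin: "\<And>v' a' n' d. agree_except {10, 11, 15, 19, 20, 21, 22, 23, 24} v' v \<Longrightarrow> v' 11 \<le> h \<Longrightarrow> d + v' 11 = k \<Longrightarrow>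
      v' 20 = 2 * d \<Longrightarrow> v' 21 = 2 * d \<Longrightarrow> pairs d a' \<Longrightarrow> a' 6 ` {..<2 * d} \<subseteq> set (kverts T) \<Longrightarrow>
      sorted_arr (a' 5) (2 * d) \<Longrightarrow> a' 5 ` {..<2 * d} = a' 6 ` {..<2 * d} \<Longrightarrow>
      (\<And>j. j \<noteq> 5 \<Longrightarrow> j \<noteq> 6 \<Longrightarrow> a' j = a j) \<Longrightarrow>
      n' \<le> n0 + k * (160 * k + 200) + 20 \<Longrightarrow> VC Ps Q v' a' n'"
  shows "VC (translate_back @ Ps) Q v a n0"
proof -
  note v' = preD[OF v(1)]
  define f where "f = a 3"
  \<comment> \<open>Two insertions into fewer than \<open>2 * k\<close> entries at \<open>40\<close>
    steps per entry, plus constant overhead.\<close>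
  define c where "c = 160 * k + 200"
  define S :: "nat set" where "S = {10, 11, 15, 19, 20, 21, 22, 23, 24}"
  define I where "I = (\<lambda>i v' a' n'. agree_except S v' v \<and> (\<exists>d. d + v' 11 = i \<and> v' 20 = 2 * d \<and> v' 21 = 2 * d \<and>
    pairs d a' \<and> sorted_arr (a' 5) (2 * d) \<and> a' 5 ` {..<2 * d} = a' 6 ` {..<2 * d} \<and>
    a' 6 ` {..<2 * d} \<subseteq> (\<lambda>r. kverts T ! f r) ` {r. r < 2 * i \<and> f r < m}) \<and>
    v' 11 = card {j. j < i \<and> \<not> f (2 * j) < m} \<and>
    (\<forall>j. j \<noteq> 5 \<longrightarrow> j \<noteq> 6 \<longrightarrow> a' j = a j) \<and> n' \<le> n0 + 10 + i * c)"
  let ?B1 = "[Asg 10 (Arr 1 (Var 10)), Asg 24 (Arr 1 (Var 24)), Wr 6 (Var 20) (Var 10),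
           Wr 6 (Var 20 \<oplus> Num 1) (Var 24), Asg 20 (Var 20 \<oplus> Num 2), Asg 22 (Var 10)]"
  let ?B = "?B1 @ insort_prog @ Asg 22 (Var 24) # insort_prog"
  let ?P = "[Asg 10 (Arr 3 (Var 15 \<oplus> Var 15)), Asg 24 (Arr 3 (Var 15 \<oplus> Var 15 \<oplus> Num 1)),
       Cnd (Var 10 \<lhd> Var 12) ?B [Asg 11 (Var 11 \<oplus> Num 1)]]"
  have kZ: "2 * k + 2 < Z" "2 * k + 2 < 2 ^ w" using k_le ZK WK by linarith+
  have "VC (For 15 (Var 1) ?P # Ps) Q (v(20 := 0, 21 := 0, 11 := 0, 15 := 0)) a n1" if n1: "n1 \<le> n0 + 10" for n1
  proof (rule vc_For[where I = I and lo = 0 and hi = k])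
    show "I 0 (v(20 := 0, 21 := 0, 11 := 0, 15 := 0)) a n1"
      using n1 by (auto simp: I_def agree_except_def S_def pairs_def sorted_arr_def)
    show "ok w Z (encode L k) (Var 1) u b' \<and> val (encode L k) (Var 1) u b' = k" if "I i u b' m'" for i u b' m'
      using that v' by (simp add: I_def agree_except_def S_def)
    show "k < 2 ^ w" "1 < (2::nat) ^ w" using kZ by linarith+
    show "VC Ps Q u b' (m' + (cost (Var 1) + 3))" if J: "I k u b' m'" for u b' m'
    proof -
      from J obtain d where d: "d + u 11 = k" "u 20 = 2 * d" "u 21 = 2 * d"
        "pairs d b'" "sorted_arr (b' 5) (2 * d)" "b' 5 ` {..<2 * d} = b' 6 ` {..<2 * d}"
        "b' 6 ` {..<2 * d} \<subseteq> (\<lambda>r. kverts T ! f r) ` {r. r < 2 * k \<and> f r < m}"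
        unfolding I_def by blast
      from J have e: "agree_except S u v" "u 11 = card {j. j < k \<and> \<not> f (2 * j) < m}" "m' \<le> n0 + 10 + k * c"
        "\<And>j. j \<noteq> 5 \<Longrightarrow> j \<noteq> 6 \<Longrightarrow> b' j = a j"
        unfolding I_def by blast+
      show ?thesis
      proof (rule fin[where d = d])
        show "agree_except {10, 11, 15, 19, 20, 21, 22, 23, 24} u v" using e(1) by (simp add: S_def)
        show "u 11 \<le> h" using e(2) count_high[OF assms(4,5)] by (simp add: f_def)
        show "b' 6 ` {..<2 * d} \<subseteq> set (kverts T)" using d(7) by auto
        show "m' + (cost (Var 1) + 3) \<le> n0 + k * (160 * k + 200) + 20" using e(3) unfolding c_def by simp
      qed (use d e in auto)
    qed
  next
    fix i u b' m' assume i: "I i u b' m'" "u 15 = i" "i < k"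
    from i(1) obtain d where d: "d + u 11 = i" "u 20 = 2 * d" "u 21 = 2 * d"
      "pairs d b'" "sorted_arr (b' 5) (2 * d)" "b' 5 ` {..<2 * d} = b' 6 ` {..<2 * d}"
      "b' 6 ` {..<2 * d} \<subseteq> (\<lambda>r. kverts T ! f r) ` {r. r < 2 * i \<and> f r < m}"
      unfolding I_def by blast
    from i(1) have e: "agree_except S u v" "u 11 = card {j. j < i \<and> \<not> f (2 * j) < m}" "m' \<le> n0 + 10 + i * c"
      "\<And>j. j \<noteq> 5 \<Longrightarrow> j \<noteq> 6 \<Longrightarrow> b' j = a j"
      unfolding I_def by blast+
    have b: "b' 1 = a 1" "b' 3 = f" using e(4) by (simp_all add: f_def)
    have u: "u 12 = m" using e(1) v(2) by (simp add: agree_except_def S_def)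
    have ii: "i + i = 2 * i" by simp
    have dk: "d < k" using d(1) i(3) by simp
    let ?R = "\<lambda>v a n. v 15 = i \<and> I (Suc i) (v(15 := Suc i)) a (n + 4)"
    have cnt: "{j. j < Suc i \<and> \<not> f (2 * j) < m} = (if f (2 * i) < m then {j. j < i \<and> \<not> f (2 * j) < m}
        else insert i {j. j < i \<and> \<not> f (2 * j) < m})"
      by (auto simp: less_Suc_eq)
    show "VC ?P ?R u b' (m' + (cost (Var 1) + 3))"
    proof (cases "f (2 * i) < m")
      case False
      have "I (Suc i) (u(10 := f (2 * i), 24 := f (Suc (2 * i)), 11 := Suc (u 11), 15 := Suc i)) b' m2"
        if "m2 \<le> m' + 100" for m2
        unfolding I_def
      proof (intro conjI exI[of _ d])
        show "b' 6 ` {..<2 * d} \<subseteq> (\<lambda>r. kverts T ! f r) ` {r. r < 2 * Suc i \<and> f r < m}" using d(7) by fastforce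
        show "m2 \<le> n0 + 10 + Suc i * c" using that e(3) by (simp add: c_def)
        show "\<forall>j. j \<noteq> 5 \<longrightarrow> j \<noteq> 6 \<longrightarrow> b' j = a j" using e(4) by blast
      qed (use d e(1,2) False cnt in \<open>auto simp: agree_except_def S_def\<close>)
      then show ?thesis using False i(2,3) b u kZ d(1) w_pos W64 by (simp add: vc_simps ii)
    next
      case True
      define y where "y = kverts T ! f (2 * i)"
      define z where "z = kverts T ! f (Suc (2 * i))"
      have ed: "{f (2 * i), f (Suc (2 * i))} \<in> kE T" using assms(5)[OF i(3)] by (simp add: f_def)
      have fm: "f (Suc (2 * i)) < m" "{y, z} \<in> cut_edges T" using kE_low[OF ed True] by (simp_all add: y_def z_def)
      have yzE: "{y, z} \<in> E" using fm(2) by (simp add: cut_edges_def)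
      \<comment> \<open>Vertices used so far stem from earlier endpoints of the kernel matching. Its
        endpoints are distinct and so are the entries of \<open>kverts T\<close>, hence the vertex
        is new.\<close>
      have new: "kverts T ! f r \<notin> b' 6 ` {..<2 * d}" if "r < 2 * k" "2 * i \<le> r" "f r < m" for r
      proof
        assume "kverts T ! f r \<in> b' 6 ` {..<2 * d}"
        then obtain r' where r': "r' < 2 * i" "f r' < m" "kverts T ! f r = kverts T ! f r'" using d(7) by auto
        then have "f r = f r'" using that(3) distinct_kverts[of T] by (simp add: nth_eq_iff_index_eq)
        then show False using inj_onD[OF assms(4), of r r'] that r'(1) i(3) by (simp add: f_def)
      qed
      have yz: "y \<notin> b' 6 ` {..<2 * d}" "z \<notin> b' 6 ` {..<2 * d}"
        using new[of "2 * i"] new[of "Suc (2 * i)"] i(3) True fm(1) by (auto simp: y_def z_def)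
      let ?b = "upd (upd b' 6 (2 * d) y) 6 (Suc (2 * d)) z"
      let ?u = "u(10 := y, 24 := z, 20 := Suc (Suc (2 * d)), 22 := y)"
      note pS = pairs_Suc[OF d(4) yzE yz, where a' = ?b]
      have pS': "pairs (Suc d) ?b" "?b 6 ` {..<2 * Suc d} = insert y (insert z (b' 6 ` {..<2 * d}))"
        by (rule pS; simp add: upd_apply)+
      have b5: "?b 5 = b' 5" by (simp add: upd_def)
      have "VC (insort_prog @ Asg 22 (Var 24) # insort_prog) ?R ?u ?b n2" if n2: "n2 \<le> m' + 100" for n2
      proof (rule vc_insort_prog[where S = "2 * d"])
        show "sorted_arr (?b 5) (2 * d)" unfolding b5 by (rule d(5))
        show "?u 21 = 2 * d" "2 * d < Z" using d(3) dk kZ by auto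
        fix v2 a2 n3 assume s: "agree_except {19, 21, 22, 23} v2 ?u" "v2 21 = Suc (2 * d)" "sorted_arr (a2 5) (Suc (2 * d))"
          "a2 5 ` {..<Suc (2 * d)} = insert (?u 22) (?b 5 ` {..<2 * d})" "\<And>j. j \<noteq> 5 \<Longrightarrow> a2 j = ?b j"
          "n3 \<le> n2 + 40 * (2 * d) + 20"
        have "VC (insort_prog @ []) ?R (v2(22 := z)) a2 n4" if n4: "n4 \<le> n3 + 10" for n4
        proof (rule vc_insort_prog[where S = "Suc (2 * d)"])
          show "sorted_arr (a2 5) (Suc (2 * d))" by fact
          show "(v2(22 := z)) 21 = Suc (2 * d)" "Suc (2 * d) < Z" using s(2) dk kZ by auto
          fix v3 a3 n5 assume t: "agree_except {19, 21, 22, 23} v3 (v2(22 := z))" "v3 21 = Suc (Suc (2 * d))"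
            "sorted_arr (a3 5) (Suc (Suc (2 * d)))"
            "a3 5 ` {..<Suc (Suc (2 * d))} = insert ((v2(22 := z)) 22) (a2 5 ` {..<Suc (2 * d)})" "\<And>j. j \<noteq> 5 \<Longrightarrow> a3 j = a2 j"
            "n5 \<le> n4 + 40 * Suc (2 * d) + 20"
          have a36: "a3 6 = ?b 6" using t(5)[of 6] s(5)[of 6] by simp
          have v3: "v3 15 = i" "v3 11 = u 11" "v3 20 = 2 * Suc d" using t(1) s(1) i(2) by (simp_all add: agree_except_def)
          have "I (Suc i) (v3(15 := Suc i)) a3 (n5 + 4)"
            unfolding I_def
          proof (intro conjI exI[of _ "Suc d"] allI impI)
            show "agree_except S (v3(15 := Suc i)) v" using t(1) s(1) e(1) by (auto simp: agree_except_def S_def)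
            show "pairs (Suc d) a3" using pS'(1) unfolding pairs_def a36 .
            show "a3 5 ` {..<2 * Suc d} = a3 6 ` {..<2 * Suc d}"
              unfolding a36 pS'(2) using t(4) s(4) d(6) b5 by auto
            show "sorted_arr (a3 5) (2 * Suc d)" using t(3) by simp
            have "y \<in> (\<lambda>r. kverts T ! f r) ` {r. r < 2 * Suc i \<and> f r < m}"
              using True by (auto simp: y_def)
            moreover have "z \<in> (\<lambda>r. kverts T ! f r) ` {r. r < 2 * Suc i \<and> f r < m}"
              using fm(1) by (auto simp: z_def)
            ultimately show "a3 6 ` {..<2 * Suc d} \<subseteq> (\<lambda>r. kverts T ! f r) ` {r. r < 2 * Suc i \<and> f r < m}"
              unfolding a36 pS'(2) using d(7) by fastforce
            show "(v3(15 := Suc i)) 11 = card {j. j < Suc i \<and> \<not> f (2 * j) < m}" using v3(2) e(2) cnt True by simp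
            show "a3 j = a j" if "j \<noteq> 5" "j \<noteq> 6" for j using that t(5) s(5) e(4) by (simp add: upd_def)
            show "n5 + 4 \<le> n0 + 10 + Suc i * c" using t(6) n4 s(6) n2 e(3) dk by (simp add: c_def)
          qed (use v3 d(1) t(2) in auto)
          then show "VC [] ?R v3 a3 n5" using v3(1) by (simp add: vc_simps)
        qed
        then have "VC insort_prog ?R (v2(22 := z)) a2 n4" if "n4 \<le> n3 + 10" for n4 using that by simp
        moreover have "v2 24 = z" using s(1) by (simp add: agree_except_def)
        ultimately show "VC (Asg 22 (Var 24) # insort_prog) ?R v2 a2 n3" by (simp add: vc_simps)
      qed
      moreover have "m \<le> Z" using m_le ZK by linarith
      ultimately show ?thesis using True fm(1) i(2,3) b u d(1,2) kZ a dk w_pos W64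
        by (simp add: vc_simps ii y_def z_def)
    qed
  qed simp_all
  then show ?thesis by (simp add: translate_back_def vc_simps w_pos)
qed

lemma vc_reserve_highs:
  assumes v: "v 11 = r" "r \<le> h" "d + r = k" "v 21 = 2 * d" and a: "\<And>i. i < h \<Longrightarrow> a 4 i = highs ! i"
    and U: "sorted_arr (a 5) (2 * d)" "a 5 ` {..<2 * d} = a 6 ` {..<2 * d}"
    and fin: "\<And>v' a' n'. agree_except {15, 19, 21, 22, 23} v' v \<Longrightarrow> v' 21 = 2 * d + r \<Longrightarrow>
      sorted_arr (a' 5) (2 * d + r) \<Longrightarrow> a' 5 ` {..<2 * d + r} = a 6 ` {..<2 * d} \<union> (!) highs ` {..<r} \<Longrightarrow>
      (\<And>j. j \<noteq> 5 \<Longrightarrow> a' j = a j) \<Longrightarrow> n' \<le> n0 + k * (80 * k + 100) + 20 \<Longrightarrow> VC Ps Q v' a' n'"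
  shows "VC (reserve_highs @ Ps) Q v a n0"
proof -
  define c where "c = 80 * k + 100"
  define I where "I = (\<lambda>i v' a' n'. agree_except {15, 19, 21, 22, 23} v' v \<and> v' 21 = 2 * d + i \<and>
    sorted_arr (a' 5) (2 * d + i) \<and> a' 5 ` {..<2 * d + i} = a 6 ` {..<2 * d} \<union> (!) highs ` {..<i} \<and>
    (\<forall>j. j \<noteq> 5 \<longrightarrow> a' j = a j) \<and> n' \<le> n0 + 10 + i * c)"
  have kZ: "2 * k + 2 < Z" "2 * k + 2 < 2 ^ w" using k_le ZK WK by linarith+
  have rk: "r \<le> k" using v(3) by simp
  let ?P = "Asg 22 (Arr 4 (Var 15)) # insort_prog"
  have "VC (For 15 (Var 11) ?P # Ps) Q (v(15 := 0)) a n1" if n1: "n1 \<le> n0 + 10" for n1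
  proof (rule vc_For[where I = I and lo = 0 and hi = r])
    show "I 0 (v(15 := 0)) a n1" using n1 v U by (auto simp: I_def agree_except_def)
    show "ok w Z (encode L k) (Var 11) u b' \<and> val (encode L k) (Var 11) u b' = r" if "I i u b' m'" for i u b' m'
      using that v(1) by (simp add: I_def agree_except_def)
    show "r < 2 ^ w" "1 < (2::nat) ^ w" using kZ rk by linarith+
    show "VC Ps Q u b' (m' + (cost (Var 11) + 3))" if "I r u b' m'" for u b' m'
    proof (rule fin)
      have "r * c \<le> k * c" using rk by (rule mult_le_mono1)
      moreover have "m' \<le> n0 + 10 + r * c" using that unfolding I_def by blast
      ultimately have "m' + (cost (Var 11) + 3) \<le> n0 + k * c + 20" unfolding cost.simps by linarith
      then show "m' + (cost (Var 11) + 3) \<le> n0 + k * (80 * k + 100) + 20" unfolding c_def .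
    qed (use that in \<open>auto simp: I_def\<close>)
  next
    fix i u b' m' assume i: "I i u b' m'" "u 15 = i" "i < r"
    from i(1) have e: "agree_except {15, 19, 21, 22, 23} u v" "u 21 = 2 * d + i" "sorted_arr (b' 5) (2 * d + i)"
      "b' 5 ` {..<2 * d + i} = a 6 ` {..<2 * d} \<union> (!) highs ` {..<i}" "\<And>j. j \<noteq> 5 \<Longrightarrow> b' j = a j" "m' \<le> n0 + 10 + i * c"
      by (auto simp: I_def)
    have b4: "b' 4 i = highs ! i" using e(5) a i(3) v(2) by simp
    let ?R = "\<lambda>v a n. v 15 = i \<and> I (Suc i) (v(15 := Suc i)) a (n + 4)"
    have "VC (insort_prog @ []) ?R (u(22 := highs ! i)) b' n2" if n2: "n2 \<le> m' + 20" for n2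
    proof (rule vc_insort_prog[where S = "2 * d + i"])
      show "sorted_arr (b' 5) (2 * d + i)" by fact
      show "(u(22 := highs ! i)) 21 = 2 * d + i" "2 * d + i < Z" using e(2) i(3) v(3) kZ by auto
      fix v2 a2 n3 assume s: "agree_except {19, 21, 22, 23} v2 (u(22 := highs ! i))" "v2 21 = Suc (2 * d + i)"
        "sorted_arr (a2 5) (Suc (2 * d + i))"
        "a2 5 ` {..<Suc (2 * d + i)} = insert ((u(22 := highs ! i)) 22) (b' 5 ` {..<2 * d + i})"
        "\<And>j. j \<noteq> 5 \<Longrightarrow> a2 j = b' j" "n3 \<le> n2 + 40 * (2 * d + i) + 20"
      have "a2 5 ` {..<2 * d + Suc i} = a 6 ` {..<2 * d} \<union> (!) highs ` {..<Suc i}"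
        using s(4) e(4) by (auto simp: lessThan_Suc)
      moreover have "n3 + 4 \<le> n0 + 10 + Suc i * c" using s(6) n2 e(6) i(3) v(3) by (simp add: c_def)
      moreover have "agree_except {15, 19, 21, 22, 23} (v2(15 := Suc i)) v" using s(1) e(1) by (auto simp: agree_except_def)
      moreover have "v2 15 = i" using s(1) i(2) by (simp add: agree_except_def)
      ultimately show "VC [] ?R v2 a2 n3" using s(2,3,5) e(5) by (simp add: vc_simps I_def)
    qed
    then have "VC insort_prog ?R (u(22 := highs ! i)) b' n2" if "n2 \<le> m' + 20" for n2 using that by simp
    then show "VC ?P ?R u b' (m' + (cost (Var 11) + 3))"
      using i b4 rk kZ by (simp add: vc_simps)
  qed simp_all
  then show ?thesis by (simp add: reserve_highs_def vc_simps w_pos)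
qed

lemma vc_copy_out:
  assumes v: "v 3 = 2 * k"
    and fin: "\<And>v' a' n'. agree_except {15} v' v \<Longrightarrow> (\<And>i. i < 2 * k \<Longrightarrow> a' (i mod 8) (i div 8) = a 6 i) \<Longrightarrow>
      n' \<le> n0 + 40 * k + 20 \<Longrightarrow> VC Ps Q v' a' n'"
  shows "VC (copy_out @ Ps) Q v a n0"
proof -
  define I where "I = (\<lambda>i v' a' n'. agree_except {15} v' v \<and> (\<forall>j<i. a' (j mod 8) (j div 8) = a 6 j) \<and>
    (\<forall>j. i \<le> j \<longrightarrow> j < 2 * k \<longrightarrow> a' 6 j = a 6 j) \<and> n' \<le> n0 + 10 + 20 * i)"
  have kZ: "2 * k + 2 < Z" "2 * k + 2 < 2 ^ w" using k_le ZK WK by linarith+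
  let ?P = "[Out (Var 15) (Arr 6 (Var 15))]"
  have "VC (For 15 (Var 3) ?P # Ps) Q (v(15 := 0)) a n1" if n1: "n1 \<le> n0 + 10" for n1
  proof (rule vc_For[where I = I and lo = 0 and hi = "2 * k"])
    show "I 0 (v(15 := 0)) a n1" using n1 by (auto simp: I_def agree_except_def)
    show "ok w Z (encode L k) (Var 3) u b' \<and> val (encode L k) (Var 3) u b' = 2 * k" if "I i u b' m'" for i u b' m'
      using that v by (simp add: I_def agree_except_def)
    show "2 * k < 2 ^ w" "1 < (2::nat) ^ w" using kZ by linarith+
    show "VC Ps Q u b' (m' + (cost (Var 3) + 3))" if "I (2 * k) u b' m'" for u b' m'
      by (rule fin) (use that in \<open>auto simp: I_def\<close>)
  next
    fix i u b' m' assume i: "I i u b' m'" "u 15 = i" "i < 2 * k"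
    let ?b = "upd b' (i mod 8) (i div 8) (a 6 i)"
    have "b' 6 i = a 6 i" using i by (simp add: I_def)
    moreover have "I (Suc i) (u(15 := Suc i)) ?b m2" if "m2 \<le> m' + 20" for m2
      unfolding I_def
    proof (intro conjI allI impI)
      show "agree_except {15} (u(15 := Suc i)) v" using i(1) by (auto simp: I_def agree_except_def)
      show "m2 \<le> n0 + 10 + 20 * Suc i" using i(1) that by (simp add: I_def)
      show "?b (j mod 8) (j div 8) = a 6 j" if "j < Suc i" for j
      proof (cases "j = i")
        case False
        then have "\<not> (j mod 8 = i mod 8 \<and> j div 8 = i div 8)" by (metis div_mult_mod_eq)
        then show ?thesis using i(1) that False by (auto simp: I_def upd_apply)
      qed (simp add: upd_apply)
      show "?b 6 j = a 6 j" if j: "Suc i \<le> j" "j < 2 * k" for j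
      proof -
        have "i div 8 \<le> i" by simp
        then have "j \<noteq> i div 8" using j(1) by linarith
        then show ?thesis using i(1) j by (simp add: I_def upd_apply)
      qed
    qed
    ultimately show "VC ?P (\<lambda>v a n. v 15 = i \<and> I (Suc i) (v(15 := Suc i)) a (n + 4)) u b' (m' + (cost (Var 3) + 3))"
      using i(2,3) kZ by (simp add: vc_simps)
  qed simp_all
  then show ?thesis by (simp add: copy_out_def vc_simps w_pos)
qed

end

section \<open>The assembled program and the matching of high vertices\<close>

definition output_prog :: "stm list" where
  "output_prog = [Cnd (Var 0) (translate_back @ reserve_highs @ match_highs @ copy_out) []]"

definition kernel_stms :: "stm list" where
  "kernel_stms = [Asg 1 (Inp (Num 0)), Asg 2 (Inp (Num 1)), Asg 3 (Var 1 \<oplus> Var 1)] @ find_highs @ find_cut @ find_kverts @ write_kernel"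

text \<open>Register \<open>2\<close> is the simulated register \<open>0\<close>, that is, the flag
  of the simulated answer. Its copy in register \<open>0\<close> is variable \<open>0\<close> and at
  the same time the flag of the final answer.\<close>

definition kernel_prog :: "prog \<Rightarrow> prog" where
  "kernel_prog A = compile kernel_stms @ concat (map simulate A) @ Op And 0 2 2 # compile output_prog"

context kernel_ram
begin

text \<open>After \<open>i\<close> rounds the blocked vertices are \<open>2 * d\<close> translated
  endpoints, \<open>r\<close> reserved vertices and \<open>i\<close> partners. As
  \<open>i < r\<close> and \<open>d + r = k\<close>, they number fewer than \<open>2 * k\<close>,
  the minimum degree of a high vertex.\<close>

lemma vc_match_highs:
  assumes v: "pre v" "v 11 = r" "r \<le> h" "d + r = k" "v 20 = 2 * d" "v 21 = 2 * d + r"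
    and a: "\<And>i. i < h \<Longrightarrow> a 4 i = highs ! i"
    and O: "pairs d a" "a 6 ` {..<2 * d} \<subseteq> set (kverts T)"
    and U: "sorted_arr (a 5) (2 * d + r)" "a 5 ` {..<2 * d + r} = a 6 ` {..<2 * d} \<union> (!) highs ` {..<r}"
    and fin: "\<And>v' a' n'. agree_except {4, 9, 10, 15, 16, 17, 18, 19, 20, 21, 22, 23, 24, 25} v' v \<Longrightarrow> pairs k a' \<Longrightarrow>
      n' \<le> n0 + k * (2 * k * (25 * b + 70) + 80 * k + 300) + 20 \<Longrightarrow> VC Ps Q v' a' n'"
  shows "VC (match_highs @ Ps) Q v a n0"
proof -
  note v' = preD[OF v(1)]
  define c1 where "c1 = 25 * b + 70"
  define c where "c = 2 * k * c1 + 80 * k + 300"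
  define S :: "nat set" where "S = {4, 9, 10, 15, 16, 17, 18, 19, 20, 21, 22, 23, 24, 25}"
  define I where "I = (\<lambda>i v' a' n'. agree_except S v' v \<and> v' 20 = 2 * (d + i) \<and> pairs (d + i) a' \<and> v' 21 = 2 * d + r + i \<and>
    sorted_arr (a' 5) (2 * d + r + i) \<and> a' 5 ` {..<2 * d + r + i} = a' 6 ` {..<2 * (d + i)} \<union> (!) highs ` {..<r} \<and>
    (\<forall>i'. i \<le> i' \<longrightarrow> i' < r \<longrightarrow> highs ! i' \<notin> a' 6 ` {..<2 * (d + i)}) \<and> a' 4 = a 4 \<and> n' \<le> n0 + 10 + i * c)"
  have kZ: "2 * k + 2 < Z" "2 * k + 2 < 2 ^ w" using k_le ZK WK by linarith+
  have rk: "r \<le> k" using v(4) by simp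
  let ?N = "Asg 10 (Inp (Var 9)) # bsearch 5 21 @
         [Cnd ((Var 16 \<lhd> Var 21) \<otimes> Bin Eq (Arr 5 (Var 16)) (Var 10)) [] [Asg 24 (Var 10)]]"
  let ?W = "[Wr 6 (Var 20) (Var 4), Wr 6 (Var 20 \<oplus> Num 1) (Var 24), Asg 20 (Var 20 \<oplus> Num 2), Asg 22 (Var 24)] @ insort_prog"
  let ?P = "[Asg 4 (Arr 4 (Var 15)), Asg 9 (adj_start 4), Asg 25 (Var 9 \<oplus> Var 3), For 9 (Var 25) ?N,
      Wr 6 (Var 20) (Var 4), Wr 6 (Var 20 \<oplus> Num 1) (Var 24), Asg 20 (Var 20 \<oplus> Num 2), Asg 22 (Var 24)] @ insort_prog"
  have "VC (For 15 (Var 11) ?P # Ps) Q (v(15 := 0)) a n1" if n1: "n1 \<le> n0 + 10" for n1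
  proof (rule vc_For[where I = I and lo = 0 and hi = r])
    have "highs ! i' \<notin> a 6 ` {..<2 * d}" if "i' < r" for i'
      using highs_nth[of i'] low_kverts O(2) that v(3) by auto
    then show "I 0 (v(15 := 0)) a n1" using n1 v O U by (auto simp: I_def agree_except_def S_def)
    show "ok w Z (encode L k) (Var 11) u b' \<and> val (encode L k) (Var 11) u b' = r" if "I i u b' m'" for i u b' m'
      using that v(2) by (simp add: I_def agree_except_def S_def)
    show "r < 2 ^ w" "1 < (2::nat) ^ w" using kZ rk by linarith+
    show "VC Ps Q u b' (m' + (cost (Var 11) + 3))" if J: "I r u b' m'" for u b' m'
    proof (rule fin)
      show "agree_except {4, 9, 10, 15, 16, 17, 18, 19, 20, 21, 22, 23, 24, 25} u v" using J by (simp add: I_def S_def)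
      show "pairs k b'" using J v(4) by (simp add: I_def)
      have "r * c \<le> k * c" using rk by (rule mult_le_mono1)
      moreover have "m' \<le> n0 + 10 + r * c" using J unfolding I_def by blast
      ultimately have "m' + (cost (Var 11) + 3) \<le> n0 + k * c + 20" unfolding cost.simps by linarith
      then show "m' + (cost (Var 11) + 3) \<le> n0 + k * (2 * k * (25 * b + 70) + 80 * k + 300) + 20"
        unfolding c_def c1_def .
    qed
  next
    fix i u b' m' assume i: "I i u b' m'" "u 15 = i" "i < r"
    from i(1) have e: "agree_except S u v" "u 20 = 2 * (d + i)" "pairs (d + i) b'" "u 21 = 2 * d + r + i"
      "sorted_arr (b' 5) (2 * d + r + i)" "b' 5 ` {..<2 * d + r + i} = b' 6 ` {..<2 * (d + i)} \<union> (!) highs ` {..<r}"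
      "\<And>i'. i \<le> i' \<Longrightarrow> i' < r \<Longrightarrow> highs ! i' \<notin> b' 6 ` {..<2 * (d + i)}" "b' 4 = a 4" "m' \<le> n0 + 10 + i * c"
      unfolding I_def by blast+
    define y where "y = highs ! i"
    have b4: "b' 4 i = y" using e(8) a i(3) v(3) by (simp add: y_def)
    have y: "y < n" "2 * k \<le> length (L ! y)" using highs_nth[of i] i(3) v(3) by (auto simp: y_def low_def)
    define U where "U = b' 5 ` {..<2 * d + r + i}"
    define s where "s = 2 * d + r + i"
    have s: "s < 2 * k" using i(3) v(4) by (simp add: s_def)
    have u3: "u 3 = 2 * k" using e(1) v' by (simp add: agree_except_def S_def)
    let ?R = "\<lambda>v a n. v 15 = i \<and> I (Suc i) (v(15 := Suc i)) a (n + 4)"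
    let ?o = "offset L y"
    let ?u = "u(4 := y, 9 := ?o, 25 := ?o + 2 * k)"
    \<comment> \<open>The loop is not left early, so the invariant only says that variable
      \<open>24\<close> holds a free neighbour as soon as one has been passed.\<close>
    define J where "J = (\<lambda>p v' a' n'. a' = b' \<and> agree_except {9, 10, 16, 17, 18, 24} v' ?u \<and>
      ((\<exists>l. ?o + l < p \<and> L ! y ! l \<notin> U) \<longrightarrow> v' 24 \<in> set (L ! y) \<and> v' 24 \<notin> U) \<and> n' \<le> m' + 40 + (p - ?o) * c1)"
    have store: "VC ?W ?R v1 b' m1"
      if v1: "agree_except {9, 10, 16, 17, 18, 24} v1 ?u" "v1 24 \<in> set (L ! y)" "v1 24 \<notin> U" "m1 \<le> m' + 50 + 2 * k * c1" for v1 m1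
    proof -
      define z where "z = v1 24"
      have yz: "{y, z} \<in> E" using v1(2) set_L[OF y(1)] by (simp add: z_def)
      have yO: "y \<notin> b' 6 ` {..<2 * (d + i)}" using e(7)[of i] i(3) by (simp add: y_def)
      have zO: "z \<notin> b' 6 ` {..<2 * (d + i)}" using v1(3) e(6) by (simp add: z_def U_def)
      let ?b = "upd (upd b' 6 (2 * (d + i)) y) 6 (Suc (2 * (d + i))) z"
      let ?v = "v1(20 := Suc (Suc (2 * (d + i))), 22 := z)"
      note pS = pairs_Suc[OF e(3) yz yO zO, where a' = ?b]
      have pS': "pairs (Suc (d + i)) ?b" "?b 6 ` {..<2 * Suc (d + i)} = insert y (insert z (b' 6 ` {..<2 * (d + i)}))"
        by (rule pS; simp add: upd_apply)+
      have b5: "?b 5 = b' 5" by (simp add: upd_def)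
      have v1': "v1 4 = y" "v1 15 = i" "v1 20 = 2 * (d + i)" "v1 21 = s" using v1(1) i(2) e(2,4) by (simp_all add: agree_except_def s_def)
      have yH: "y \<in> (!) highs ` {..<r}" using i(3) by (auto simp: y_def)
      have "VC (insort_prog @ []) ?R ?v ?b n2" if n2: "n2 \<le> m1 + 60" for n2
      proof (rule vc_insort_prog[where S = s])
        show "sorted_arr (?b 5) s" unfolding b5 s_def by (rule e(5))
        show "?v 21 = s" "s < Z" using v1'(4) s kZ by auto
        fix v2 a2 n3 assume t: "agree_except {19, 21, 22, 23} v2 ?v" "v2 21 = Suc s" "sorted_arr (a2 5) (Suc s)"
          "a2 5 ` {..<Suc s} = insert (?v 22) (?b 5 ` {..<s})" "\<And>j. j \<noteq> 5 \<Longrightarrow> a2 j = ?b j" "n3 \<le> n2 + 40 * s + 20"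
        have a26: "a2 6 = ?b 6" using t(5)[of 6] by simp
        have "I (Suc i) (v2(15 := Suc i)) a2 (n3 + 4)"
          unfolding I_def
        proof (intro conjI allI impI)
          show "agree_except S (v2(15 := Suc i)) v" using t(1) v1(1) e(1) by (auto simp: agree_except_def S_def)
          show "(v2(15 := Suc i)) 20 = 2 * (d + Suc i)" using t(1) by (simp add: agree_except_def)
          show "pairs (d + Suc i) a2" using pS'(1) unfolding pairs_def a26 by simp
          show "(v2(15 := Suc i)) 21 = 2 * d + r + Suc i" using t(2) by (simp add: s_def)
          show "sorted_arr (a2 5) (2 * d + r + Suc i)" using t(3) by (simp add: s_def)
          have 6: "a2 6 ` {..<2 * (d + Suc i)} = insert y (insert z (b' 6 ` {..<2 * (d + i)}))"
            using pS'(2) unfolding a26 by simp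
          have 5: "a2 5 ` {..<2 * d + r + Suc i} = insert z U" using t(4) b5 by (simp add: s_def U_def)
          show "a2 5 ` {..<2 * d + r + Suc i} = a2 6 ` {..<2 * (d + Suc i)} \<union> (!) highs ` {..<r}"
            unfolding 5 6 U_def e(6) using yH by blast
          show "highs ! i' \<notin> a2 6 ` {..<2 * (d + Suc i)}" if i': "Suc i \<le> i'" "i' < r" for i'
          proof -
            have "highs ! i' \<noteq> y" using i' v(3) distinct_highs by (simp add: y_def nth_eq_iff_index_eq)
            \<comment> \<open>Reserved vertices are blocked, so the chosen partner is none of those
              still waiting.\<close>
            moreover have "highs ! i' \<in> U" unfolding U_def e(6) using i'(2) by blast
            then have "highs ! i' \<noteq> z" using v1(3) by (auto simp: z_def)
            ultimately show ?thesis unfolding 6 using e(7)[of i'] i' by simp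
          qed
          show "a2 4 = a 4" using t(5)[of 4] e(8) by (simp add: upd_def)
          show "n3 + 4 \<le> n0 + 10 + Suc i * c" using t(6) n2 v1(4) e(9) s by (simp add: c_def)
        qed
        then show "VC [] ?R v2 a2 n3" using t(1) v1'(2) by (simp add: vc_simps agree_except_def)
      qed
      then have "VC insort_prog ?R ?v ?b n2" if "n2 \<le> m1 + 60" for n2 using that by simp
      moreover have "Suc (2 * (d + i)) < Z" "Suc (Suc (2 * (d + i))) < 2 ^ w" using i(3) v(4) kZ by auto
      ultimately show ?thesis using v1' w_pos W64 by (simp add: vc_simps z_def)
    qed
    have "VC (For 9 (Var 25) ?N # ?W) ?R ?u b' m1" if m1: "m1 \<le> m' + 40" for m1
    proof (rule vc_For[where I = J and lo = ?o and hi = "?o + 2 * k"])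
      show "J ?o ?u b' m1" using m1 by (auto simp: J_def agree_except_def)
      show "?u 9 = ?o" "?o \<le> ?o + 2 * k" by auto
      show "ok w Z (encode L k) (Var 25) v1 a1 \<and> val (encode L k) (Var 25) v1 a1 = ?o + 2 * k" if "J p v1 a1 m2" for p v1 a1 m2
        using that by (simp add: J_def agree_except_def)
      show "?o + 2 * k < 2 ^ w" using kk_lt[of y] y(1) by simp
      show "1 < (2::nat) ^ w" using W64 by linarith
      show "VC ?W ?R v1 a1 (m2 + (cost (Var 25) + 3))" if J: "J (?o + 2 * k) v1 a1 m2" for v1 a1 m2
      proof -
        \<comment> \<open>Pigeonhole: \<open>2 * k\<close> distinct neighbours do not fit into fewer
          than \<open>2 * k\<close> blocked vertices.\<close>
        have "\<exists>l<2 * k. L ! y ! l \<notin> U"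
        proof (rule ccontr)
          assume "\<not> (\<exists>l<2 * k. L ! y ! l \<notin> U)"
          then have "(!) (L ! y) ` {..<2 * k} \<subseteq> U" by auto
          moreover have "finite U" by (simp add: U_def)
          ultimately have "card ((!) (L ! y) ` {..<2 * k}) \<le> card U" by (rule card_mono[rotated])
          moreover have "card ((!) (L ! y) ` {..<2 * k}) = 2 * k"
            using distinct_L[OF y(1)] y(2) by (subst card_image) (auto simp: inj_on_def nth_eq_iff_index_eq)
          moreover have "card U \<le> s" unfolding U_def s_def using card_image_le[of "{..<2 * d + r + i}" "b' 5"] by simp
          ultimately show False using s by simp
        qed
        then have "v1 24 \<in> set (L ! y)" "v1 24 \<notin> U" using J by (auto simp: J_def)
        moreover have "a1 = b'" "agree_except {9, 10, 16, 17, 18, 24} v1 ?u" "m2 \<le> m' + 40 + 2 * k * c1"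
          using J by (auto simp: J_def)
        ultimately show ?thesis using store[of v1 "m2 + (cost (Var 25) + 3)"] by simp
      qed
    next
      fix p v1 a1 m2 assume p: "J p v1 a1 m2" "v1 9 = p" "?o \<le> p" "p < ?o + 2 * k"
      define l where "l = p - ?o"
      have l: "l < 2 * k" "p = ?o + l" "l < length (L ! y)" using p(3,4) y(2) by (auto simp: l_def)
      let ?z = "L ! y ! l"
      from p(1) have J: "a1 = b'" "agree_except {9, 10, 16, 17, 18, 24} v1 ?u"
        "\<And>l. ?o + l < p \<Longrightarrow> L ! y ! l \<notin> U \<Longrightarrow> v1 24 \<in> set (L ! y) \<and> v1 24 \<notin> U" "m2 \<le> m' + 40 + l * c1"
        by (auto simp: J_def l_def)
      have x: "encode L k ! p = ?z" using encode_nth(4)[of y L l k] y(1) l by (simp add: length_L)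
      have xl: "p < offset L n" using l(3) y(1) offset_mono[of "Suc y" n L] unfolding l(2) by (simp add: offset_Suc)
      have zn: "?z < 2 ^ w" using L_nth[OF y(1) l(3)] n_lt by simp
      have v21: "v1 21 = s" using J(2) e(4) by (simp add: agree_except_def s_def)
      let ?Q = "\<lambda>v a n. v 9 = p \<and> J (Suc p) (v(9 := Suc p)) a (n + 4)"
      have "VC (bsearch 5 21 @ [Cnd ((Var 16 \<lhd> Var 21) \<otimes> Bin Eq (Arr 5 (Var 16)) (Var 10)) [] [Asg 24 (Var 10)]]) ?Q
          (v1(10 := ?z)) b' m3" if m3: "m3 \<le> m2 + 10" for m3
      proof (rule vc_bsearch[where S = s and b = b])
        show "sorted_arr (b' 5) s" unfolding s_def by (rule e(5))
        show "(v1(10 := ?z)) 21 = s" "s < 2 ^ b" "s \<le> Z" "5 < (8::nat)" "21 \<notin> {16, 17, 18::nat}"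
          using v21 s kZ bK k_le by auto
        fix v2 n3 q assume q: "agree_except {16, 17, 18} v2 (v1(10 := ?z))" "v2 16 = q" "q \<le> s"
          "\<And>i. i < q \<Longrightarrow> b' 5 i < (v1(10 := ?z)) 10" "\<And>i. q \<le> i \<Longrightarrow> i < s \<Longrightarrow> (v1(10 := ?z)) 10 \<le> b' 5 i"
          "n3 \<le> m3 + 25 * b + 10"
        have found: "q < s \<and> b' 5 q = ?z \<longleftrightarrow> ?z \<in> U"
        proof
          assume "q < s \<and> b' 5 q = ?z"
          then show "?z \<in> U" by (force simp: U_def s_def)
        next
          assume "?z \<in> U"
          then obtain t where t: "t < s" "b' 5 t = ?z" by (auto simp: U_def s_def)
          then have "q \<le> t" using q(4)[of t] by (simp add: not_less[symmetric]) (metis less_irrefl)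
          then have "b' 5 q \<le> b' 5 t" using e(5) t(1) unfolding sorted_arr_def s_def by blast
          then show "q < s \<and> b' 5 q = ?z" using t q(5)[of q] \<open>q \<le> t\<close> by simp
        qed
        have v2: "v2 21 = s" "v2 9 = p" "v2 10 = ?z" using q(1) v21 p(2) by (simp_all add: agree_except_def)
        have tm: "n4 \<le> m' + 40 + (Suc p - ?o) * c1" if "n4 \<le> n3 + 30" for n4
        proof -
          have "Suc p - ?o = Suc l" using l(2) by simp
          then show ?thesis using that q(6) m3 J(4) by (simp add: c1_def)
        qed
        have "J (Suc p) (v2(9 := Suc p)) b' n4" if "?z \<in> U" "n4 \<le> n3 + 30" for n4
          unfolding J_def
        proof (intro conjI impI)
          assume "\<exists>l. ?o + l < Suc p \<and> L ! y ! l \<notin> U"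
          then obtain l' where l': "?o + l' < Suc p" "L ! y ! l' \<notin> U" by blast
          then have "l' \<noteq> l" using that(1) by auto
          then have "?o + l' < p" using l'(1) l(2) by simp
          from J(3)[OF this l'(2)] show "(v2(9 := Suc p)) 24 \<in> set (L ! y)" "(v2(9 := Suc p)) 24 \<notin> U"
            using q(1) by (simp_all add: agree_except_def)
        qed (use tm[OF that(2)] q(1) J(2) in \<open>auto simp: agree_except_def\<close>)
        moreover have "J (Suc p) (v2(24 := ?z, 9 := Suc p)) b' n4" if "?z \<notin> U" "n4 \<le> n3 + 30" for n4
          unfolding J_def using tm[OF that(2)] that(1) q(1) J(2) l(3) by (auto simp: agree_except_def)
        \<comment> \<open>Both factors of the test are evaluated, so the cell must be in range even
          when the search has run past the last entry.\<close>
        moreover have "q < Z" using q(3) s kZ by linarith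
        ultimately show "VC [Cnd ((Var 16 \<lhd> Var 21) \<otimes> Bin Eq (Arr 5 (Var 16)) (Var 10)) [] [Asg 24 (Var 10)]] ?Q v2 b' n3"
          using v2 q(2) found W64 by (cases "?z \<in> U") (auto simp: vc_simps fun_upd_twist)
      qed
      then show "VC ?N ?Q v1 a1 (m2 + (cost (Var 25) + 3))"
        using J(1) p(2) x xl zn by (simp add: vc_simps length_x)
    qed
    moreover have "?o + 2 * k < 2 ^ w" using kk_lt[of y] y(1) by simp
    moreover have "i < Z" using i(3) rk kZ by linarith
    ultimately show "VC ?P ?R u b' (m' + (cost (Var 11) + 3))"
      using i(2) b4 y(1) u3 w_pos W64 by (simp add: vc_simps)
  qed simp_all
  then show ?thesis by (simp add: match_highs_def vc_simps w_pos)
qed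

lemma vc_output_prog:
  assumes v: "pre v" "v 12 = m" "v 0 \<noteq> 0" and a: "\<And>i. i < m \<Longrightarrow> a 1 i = kverts T ! i" "\<And>i. i < h \<Longrightarrow> a 4 i = highs ! i"
    and f: "inj_on (a 3) {..<2 * k}" "\<And>i. i < k \<Longrightarrow> {a 3 (2 * i), a 3 (2 * i + 1)} \<in> kE T"
  shows "VC output_prog (\<lambda>v' a' n'. v' 0 = v 0 \<and> n' \<le> n0 + (50 * b + 1100) * K + 100 \<and>
    k_matching E k {{a' ((2 * i) mod 8) ((2 * i) div 8), a' ((2 * i + 1) mod 8) ((2 * i + 1) div 8)} | i. i < k}) v a n0"
    (is "VC output_prog ?Q v a n0")
proof -
  have "VC (translate_back @ (reserve_highs @ (match_highs @ (copy_out @ [])))) ?Q v a n1" if n1: "n1 \<le> n0 + 2" for n1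
  proof (rule vc_translate_back[OF v(1,2) a(1) f])
    fix v1 a1 n2 d
    assume 1: "agree_except {10, 11, 15, 19, 20, 21, 22, 23, 24} v1 v" "v1 11 \<le> h" "d + v1 11 = k"
      "v1 20 = 2 * d" "v1 21 = 2 * d" "pairs d a1" "a1 6 ` {..<2 * d} \<subseteq> set (kverts T)"
      "sorted_arr (a1 5) (2 * d)" "a1 5 ` {..<2 * d} = a1 6 ` {..<2 * d}"
      "\<And>j. j \<noteq> 5 \<Longrightarrow> j \<noteq> 6 \<Longrightarrow> a1 j = a j" "n2 \<le> n1 + k * (160 * k + 200) + 20"
    show "VC (reserve_highs @ (match_highs @ (copy_out @ []))) ?Q v1 a1 n2"
    proof (rule vc_reserve_highs[where r = "v1 11" and d = d])
      show "a1 4 i = highs ! i" if "i < h" for i using a(2)[OF that] 1(10)[of 4] by simp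
      fix v2 a2 n3
      assume 2: "agree_except {15, 19, 21, 22, 23} v2 v1" "v2 21 = 2 * d + v1 11" "sorted_arr (a2 5) (2 * d + v1 11)"
        "a2 5 ` {..<2 * d + v1 11} = a1 6 ` {..<2 * d} \<union> (!) highs ` {..<v1 11}"
        "\<And>j. j \<noteq> 5 \<Longrightarrow> a2 j = a1 j" "n3 \<le> n2 + k * (80 * k + 100) + 20"
      have a26: "a2 6 = a1 6" using 2(5)[of 6] by simp
      show "VC (match_highs @ (copy_out @ [])) ?Q v2 a2 n3"
      proof (rule vc_match_highs[where r = "v1 11" and d = d])
        show "pre v2" using v(1) 1(1) 2(1) by (simp add: pre_def agree_except_def)
        show "v2 11 = v1 11" "v2 20 = 2 * d" using 2(1) 1(4) by (simp_all add: agree_except_def)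
        show "a2 4 i = highs ! i" if "i < h" for i using a(2)[OF that] 1(10)[of 4] 2(5)[of 4] by simp
        show "pairs d a2" using 1(6) unfolding pairs_def a26 .
        show "a2 6 ` {..<2 * d} \<subseteq> set (kverts T)" unfolding a26 by (rule 1(7))
        show "a2 5 ` {..<2 * d + v1 11} = a2 6 ` {..<2 * d} \<union> (!) highs ` {..<v1 11}" unfolding a26 by (rule 2(4))
        fix v3 a3 n4
        assume 3: "agree_except {4, 9, 10, 15, 16, 17, 18, 19, 20, 21, 22, 23, 24, 25} v3 v2" "pairs k a3"
          "n4 \<le> n3 + k * (2 * k * (25 * b + 70) + 80 * k + 300) + 20"
        show "VC (copy_out @ []) ?Q v3 a3 n4"
        proof (rule vc_copy_out)
          show "v3 3 = 2 * k" using v(1) 1(1) 2(1) 3(1) by (simp add: pre_def agree_except_def)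
          fix v4 a4 n5
          assume 4: "agree_except {15} v4 v3" "\<And>i. i < 2 * k \<Longrightarrow> a4 (i mod 8) (i div 8) = a3 6 i" "n5 \<le> n4 + 40 * k + 20"
          have "v4 0 = v 0" using 1(1) 2(1) 3(1) 4(1) by (simp add: agree_except_def)
          moreover have "n5 \<le> n0 + (50 * b + 1100) * K + 100"
          proof -
            have "n5 \<le> n0 + 2 + (k * (160 * k + 200) + 20) + (k * (80 * k + 100) + 20) +
                (k * (2 * k * (25 * b + 70) + 80 * k + 300) + 20) + 40 * k + 20"
              using 1(11) 2(6) 3(3) 4(3) n1 by linarith
            also have "\<dots> = n0 + (50 * b + 460) * (k * k) + 640 * k + 82" by (simp add: algebra_simps)
            also have "\<dots> \<le> n0 + (50 * b + 1100) * (k * k) + 100" using mult_le_mono1[of 1 k k]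
              by (cases k) (simp_all add: algebra_simps)
            finally show ?thesis by (simp add: K_def power2_eq_square)
          qed
          moreover have "k_matching E k {{a4 ((2 * i) mod 8) ((2 * i) div 8), a4 ((2 * i + 1) mod 8) ((2 * i + 1) div 8)} | i. i < k}"
          proof (rule k_matching_flat[where f = "\<lambda>p. a4 (p mod 8) (p div 8)"])
            show "inj_on (\<lambda>p. a4 (p mod 8) (p div 8)) {..<2 * k}"
              using 3(2) 4(2) unfolding pairs_def inj_on_def by simp
            show "{a4 ((2 * i) mod 8) ((2 * i) div 8), a4 ((2 * i + 1) mod 8) ((2 * i + 1) div 8)} \<in> E" if "i < k" for i
              using 3(2) 4(2)[of "2 * i"] 4(2)[of "2 * i + 1"] that unfolding pairs_def by simp
          qed
          ultimately show "VC [] ?Q v4 a4 n5" by (simp only: vc_simps simp_thms)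
        qed
      qed (use 1 2 in auto)
    qed (use 1 in auto)
  qed
  then show ?thesis using v(3) by (simp add: output_prog_def vc_simps)
qed

end

section \<open>The complete algorithm\<close>

context ram
begin

definition kernel_ready :: "nat \<Rightarrow> vars \<Rightarrow> arrs \<Rightarrow> bool" where
  "kernel_ready T v a \<longleftrightarrow> T \<le> n \<and> card (cut_edges T) \<le> 4 * k\<^sup>2 + 2 * k \<and> (T = n \<or> 4 * k\<^sup>2 \<le> card (cut_edges T)) \<and>
     pre v \<and> v 12 = length (kverts T) \<and> v 14 = length (encode (kL T) k) \<and>
     (\<forall>i<length (kverts T). a 1 i = kverts T ! i) \<and> (\<forall>i<length highs. a 4 i = highs ! i) \<and>
     (\<forall>p<length (encode (kL T) k). a 2 p = encode (kL T) k ! p) \<and> a 3 = (\<lambda>_. 0)"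

lemma vc_kernel_stms:
  assumes b: "12 * k\<^sup>2 < 2 ^ b"
  shows "VC kernel_stms (\<lambda>v a t. (\<exists>T. kernel_ready T v a) \<and>
    t \<le> 350 * (n + 2 * card E) + (25 * b + 60) * (12 * K) + 100 * k + 300) (\<lambda>_. 0) (\<lambda>_ _. 0) 0"
    (is "VC kernel_stms ?Q _ ?a 0")
proof -
  have "VC (find_highs @ (find_cut @ (find_kverts @ (write_kernel @ [])))) ?Q ((\<lambda>_. 0)(1 := k, 2 := n, 3 := k + k)) ?a n0"
    if n0: "n0 \<le> 20" for n0
  proof (rule vc_find_highs)
    let ?v = "(\<lambda>_. 0)(1 := k, 2 := n, 3 := k + k)"
    show "pre ?v" by (simp add: pre_def)
    fix v1 a1 n1
    assume 1: "agree_except {4, 5} v1 ?v" "v1 5 = length highs" "\<And>i. i < length highs \<Longrightarrow> a1 4 i = highs ! i"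
      "\<And>j. j \<noteq> 4 \<Longrightarrow> a1 j = ?a j" "n1 \<le> n0 + 50 * n + 20"
    have p1: "pre v1" using 1(1) by (simp add: pre_def agree_except_def)
    show "VC (find_cut @ (find_kverts @ (write_kernel @ []))) ?Q v1 a1 n1"
    proof (rule vc_find_cut[OF p1])
      fix v2 n2
      assume 2: "agree_except {4, 6, 7, 8, 9, 10} v2 v1" "v2 7 \<le> n" "card (cut_edges (v2 7)) \<le> 4 * K + 2 * k"
        "v2 7 = n \<or> 4 * K \<le> card (cut_edges (v2 7))" "n2 \<le> n1 + 100 * (n + 2 * card E) + 20"
      have p2: "pre v2" using p1 2(1) by (simp add: pre_def agree_except_def)
      define T where "T = v2 7"
      \<comment> \<open>The cut is known only after the scan, hence the interpretation in the middle
        of the program.\<close>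
      interpret kr: kernel_ram n E L k w Z T b
        using 2(2,3) b by unfold_locales (simp_all add: K_def T_def)
      show "VC (find_kverts @ (write_kernel @ [])) ?Q v2 a1 n2"
      proof (rule vc_find_kverts[OF p2 T_def[symmetric] kr.T(1) kr.TK])
        fix v3 a3 n3
        assume 3: "agree_except {4, 9, 10, 11, 12} v3 v2" "v3 12 = length (kverts T)" "\<And>i. i < length (kverts T) \<Longrightarrow> a3 1 i = kverts T ! i"
          "\<And>j. j \<noteq> 1 \<Longrightarrow> a3 j = a1 j" "n3 \<le> n2 + 100 * (n + 2 * card E) + 20"
        have p3: "pre v3" using p2 3(1) by (simp add: pre_def agree_except_def)
        show "VC (write_kernel @ []) ?Q v3 a3 n3"
        proof (rule kr.vc_write_kernel[where v = v3 and a = a3])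
          show "pre v3" "v3 12 = length (kverts T)" by fact+
          show "a3 1 i = kverts T ! i" if "i < length (kverts T)" for i using 3(3)[OF that] .
          show "v3 7 = T" using 3(1) by (simp add: agree_except_def T_def)
          show "v3 5 = length highs" using 3(1) 2(1) 1(2) by (simp add: agree_except_def)
          fix v4 a4 n4
          assume 4: "agree_except {4, 9, 10, 13, 14, 15, 16, 17, 18, 19} v4 v3" "v4 14 = length (encode (kL T) k)"
            "\<And>p. p < length (encode (kL T) k) \<Longrightarrow> a4 2 p = encode (kL T) k ! p" "\<And>j. j \<noteq> 2 \<Longrightarrow> a4 j = a3 j"
            "n4 \<le> n3 + 100 * (n + 2 * card E) + (25 * b + 60) * (12 * K) + 100 * k + 100"
          have "kernel_ready T v4 a4"
            unfolding kernel_ready_def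
          proof (intro conjI allI impI)
            show "T = n \<or> 4 * k\<^sup>2 \<le> card (cut_edges T)" using 2(4) by (simp add: K_def T_def)
            show "pre v4" using p3 4(1) by (simp add: pre_def agree_except_def)
            show "v4 12 = length (kverts T)" using 4(1) 3(2) by (simp add: agree_except_def)
            show "a4 1 i = kverts T ! i" if "i < length (kverts T)" for i using 4(4)[of 1] 3(3)[OF that] by simp
            show "a4 4 i = highs ! i" if "i < length highs" for i using 4(4)[of 4] 3(4)[of 4] 1(3)[OF that] by simp
            show "a4 3 = (\<lambda>_. 0)" using 4(4)[of 3] 3(4)[of 3] 1(4)[of 3] by simp
          qed (use kr.T 4(2,3) in auto)
          \<comment> \<open>The factor \<open>350\<close> adds up \<open>50\<close> for finding the
            high vertices and \<open>100\<close> for each of the three other phases.\<close>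
          moreover have "n4 \<le> 350 * (n + 2 * card E) + (25 * b + 60) * (12 * K) + 100 * k + 300"
          proof -
            have "n4 \<le> 350 * Y + X + 100 * k + 300"
              if "n4 \<le> n3 + 100 * Y + X + 100 * k + 100" "n3 \<le> n2 + 100 * Y + 20" "n2 \<le> n1 + 100 * Y + 20" "n \<le> Y" for X Y
              using that 1(5) n0 by linarith
            from this[OF 4(5) 3(5) 2(5)] show ?thesis by simp
          qed
          ultimately show "VC [] ?Q v4 a4 n4" by (auto simp: vc_simps)
        qed
      qed
    qed
  qed
  moreover have "0 < offset L n" "Suc 0 < offset L n" "k < 2 ^ w" "2 * k < 2 ^ w"
    using offset_ge[of n] k_le WK by linarith+
  ultimately show ?thesis
    using n_lt W64 w_pos
    by (simp add: kernel_stms_def vc_simps encode_nth length_x length_L)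
qed

text \<open>No invariants are available for an arbitrary given program, so its run is glued in at
  the level of \<open>exec\<close> between two compiled pieces; the common relation
  \<open>rep\<close> makes the ends meet.\<close>

lemma kernel_prog_exec:
  assumes b: "12 * k\<^sup>2 < 2 ^ b" and A: "\<forall>c\<in>set A. rand_free c"
    and sim: "\<And>T. T \<le> n \<Longrightarrow> card (cut_edges T) \<le> 4 * k\<^sup>2 + 2 * k \<Longrightarrow>
      \<exists>t\<le>tA. \<forall>(K', s') \<in> set_pmf (run w A (encode (kL T) k) t). K' = [] \<and> extent s' \<le> Z \<and> correct_answer (kE T) k s'"
  shows "\<exists>t s. exec w (encode L k) t (kernel_prog A, init_state) ([], s) \<and> extent s \<le> 8 * Z \<and> correct_answer E k s \<and>
    t \<le> 350 * (n + 2 * card E) + (25 * b + 60) * (12 * K) + 100 * k + 300 + 7 * tA + 1 + ((50 * b + 1100) * K + 100)"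
proof -
  have W8: "8 < (2::nat) ^ w" using W64 by linarith
  let ?x = "encode L k"
  from vc_sound[OF Z8 W8 vc_kernel_stms[OF b]] obtain t1 v a T where
    1: "kernel_ready T v a" "t1 \<le> 350 * (n + 2 * card E) + (25 * b + 60) * (12 * K) + 100 * k + 300"
    and e1: "\<And>s K g. rep Z (\<lambda>_. 0) (\<lambda>_ _. 0) g s \<Longrightarrow> \<exists>s'. rep Z v a g s' \<and> exec w ?x t1 (compile kernel_stms @ K, s) (K, s')"
    unfolding wp_def by auto
  from 1(1) have T: "T \<le> n" "card (cut_edges T) \<le> 4 * k\<^sup>2 + 2 * k" "T = n \<or> 4 * k\<^sup>2 \<le> card (cut_edges T)"
    and v: "pre v" "v 12 = length (kverts T)" "v 14 = length (encode (kL T) k)"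
    and a: "\<And>i. i < length (kverts T) \<Longrightarrow> a 1 i = kverts T ! i" "\<And>i. i < length highs \<Longrightarrow> a 4 i = highs ! i"
      "\<And>p. p < length (encode (kL T) k) \<Longrightarrow> a 2 p = encode (kL T) k ! p" "a 3 = (\<lambda>_. 0)"
    unfolding kernel_ready_def by blast+
  interpret kr: kernel_ram n E L k w Z T b using T b by unfold_locales
  let ?y = "encode (kL T) k"
  let ?K2 = "Op And 0 2 2 # compile output_prog"
  let ?K1 = "concat (map simulate A) @ ?K2"
  have rep0: "rep Z (\<lambda>_. 0) (\<lambda>_ _. 0) (\<lambda>_. 0) init_state" by (simp add: rep_def init_state_def)
  obtain s1 where s1: "rep Z v a (\<lambda>_. 0) s1" "exec w ?x t1 (compile kernel_stms @ ?K1, init_state) (?K1, s1)"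
    using e1[OF rep0, of ?K1] by blast
  obtain t where t: "t \<le> tA"
    "\<forall>(K', s') \<in> set_pmf (run w A ?y t). K' = [] \<and> extent s' \<le> Z \<and> correct_answer (kE T) k s'"
    using sim[OF T(1,2)] by blast
  have st: "\<forall>(K', s') \<in> set_pmf (steps w ?y t (A, init_state)). K' = [] \<and> extent s' \<le> Z"
    using t(2) by (auto simp: run_def)
  \<comment> \<open>Array \<open>3\<close> is still blank, as the initial memory of the simulated
    program should be.\<close>
  have "a(3 := mem init_state) = a" using a(4) by (auto simp: init_state_def)
  then have rep1: "rep Z v (a(3 := mem init_state)) (reg init_state) s1"
    using s1(1) by (simp add: init_state_def)
  have inp: "\<And>i. i < length ?y \<Longrightarrow> a 2 i = ?y ! i \<and> ?y ! i < 2 ^ w" using a(3) kr.encode_lt by blast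
  have ly: "length ?y \<le> Z" using kr.length_y kr.off_kn ZK by linarith
  obtain sA t2 s2 where sA: "steps w ?y t (A, init_state) = return_pmf ([], sA)" and t2: "t2 \<le> 7 * t"
    and e2: "exec w ?x t2 (?K1, s1) (?K2, s2)" and rep2: "rep Z v (a(3 := mem sA)) (reg sA) s2"
    using exec_simulate[OF A st rep1 inp v(3) ly Z8 W8, of ?x ?K2] by blast
  have cA: "correct_answer (kE T) k sA" using t(2) sA by (simp add: run_def)
  let ?s3 = "set_reg 0 (reg sA 0) s2"
  have "\<And>r. reg s2 (3 * r + 2) = reg sA r" using rep2 by (simp add: rep_def)
  from this[of 0] have r2: "reg s2 2 = reg sA 0" by (simp only: mult_0_right add_0)
  have e3: "exec w ?x 1 (?K2, s2) (compile output_prog, ?s3)" using r2 by (simp add: exec_def bind_return_pmf)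
  let ?v3 = "v(0 := reg sA 0)"
  let ?a3 = "a(3 := mem sA)"
  have rep3: "rep Z ?v3 ?a3 (reg sA) ?s3" using rep2 by (auto simp: rep_def set_reg_def)
  have pre3: "pre ?v3" using v(1) by (simp add: pre_def)
  have "\<exists>t3 v4 a4. v4 0 = reg sA 0 \<and> t3 \<le> (50 * b + 1100) * K + 100 \<and>
      (reg sA 0 \<noteq> 0 \<longrightarrow> k_matching E k
        {{a4 ((2 * i) mod 8) ((2 * i) div 8), a4 ((2 * i + 1) mod 8) ((2 * i + 1) div 8)} | i. i < k}) \<and>
      (\<forall>s K g. rep Z ?v3 ?a3 g s \<longrightarrow> (\<exists>s'. rep Z v4 a4 g s' \<and> exec w ?x t3 (compile output_prog @ K, s) (K, s')))"
  proof (cases "reg sA 0 = 0")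
    case True
    then have "VC output_prog (\<lambda>v' a' n'. v' 0 = reg sA 0 \<and> n' \<le> 0 + (50 * b + 1100) * K + 100) ?v3 ?a3 0"
      by (simp add: output_prog_def vc_simps)
    from vc_sound[OF Z8 W8 this] True show ?thesis unfolding wp_def by auto
  next
    case False
    then have "k_matching (kE T) k {{mem sA (2 * i), mem sA (2 * i + 1)} | i. i < k}"
      using cA by (simp add: correct_answer_def returned_edges_def)
    note f = inj_on_of_k_matching[OF ugraph_kE[OF T(1)] this]
    have "VC output_prog (\<lambda>v' a' n'. v' 0 = ?v3 0 \<and> n' \<le> 0 + (50 * b + 1100) * K + 100 \<and>
      k_matching E k {{a' ((2 * i) mod 8) ((2 * i) div 8), a' ((2 * i + 1) mod 8) ((2 * i + 1) div 8)} | i. i < k}) ?v3 ?a3 0"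
      by (rule kr.vc_output_prog[OF pre3]) (use v(2) a(1,2) f False in auto)
    from vc_sound[OF Z8 W8 this] False show ?thesis unfolding wp_def by (elim ex_forward) simp
  qed
  then obtain t3 v4 a4 where 4: "v4 0 = reg sA 0" "t3 \<le> (50 * b + 1100) * K + 100"
      "reg sA 0 \<noteq> 0 \<Longrightarrow> k_matching E k
        {{a4 ((2 * i) mod 8) ((2 * i) div 8), a4 ((2 * i + 1) mod 8) ((2 * i + 1) div 8)} | i. i < k}"
      "\<And>s K g. rep Z ?v3 ?a3 g s \<Longrightarrow> \<exists>s'. rep Z v4 a4 g s' \<and> exec w ?x t3 (compile output_prog @ K, s) (K, s')"
    by blast
  obtain s4 where s4: "rep Z v4 a4 (reg sA) s4" "exec w ?x t3 (compile output_prog @ [], ?s3) ([], s4)"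
    using 4(4)[OF rep3, of "[]"] by blast
  have "exec w ?x (t1 + (t2 + (1 + t3))) (kernel_prog A, init_state) ([], s4)"
    unfolding kernel_prog_def
    using exec_trans[OF s1(2) exec_trans[OF e2 exec_trans[OF e3]]] s4(2) by simp
  moreover have "extent s4 \<le> 8 * Z" using s4(1) by (simp add: rep_def)
  moreover have "correct_answer E k s4"
  proof -
    have "\<And>r. reg s4 (3 * r) = v4 r" using s4(1) by (simp add: rep_def)
    from this[of 0] have r0: "reg s4 0 = reg sA 0" using 4(1) by simp
    have m4: "mem s4 = (\<lambda>p. a4 (p mod 8) (p div 8))" using s4(1) by (auto simp: rep_def)
    show ?thesis
    proof (cases "reg sA 0 = 0")
      case True
      \<comment> \<open>A matching of the input would yield one of the kernel, contradicting the
        simulated answer.\<close>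
      then show ?thesis using cA kernel_complete[OF T(1,3)] r0 by (auto simp: correct_answer_def)
    next
      case False
      then show ?thesis using 4(3) r0 unfolding correct_answer_def returned_edges_def m4 by simp
    qed
  qed
  moreover have "t1 + (t2 + (1 + t3)) \<le> 350 * (n + 2 * card E) + (25 * b + 60) * (12 * K) + 100 * k + 300 + 7 * tA + 1 +
      ((50 * b + 1100) * K + 100)"
    using 1(2) t2 t(1) 4(2) by linarith
  ultimately show ?thesis by blast
qed

end

section \<open>Choice of the constants and asymptotics\<close>

definition sparse_bound :: "(nat \<Rightarrow> real) \<Rightarrow> prog \<Rightarrow> real \<Rightarrow> real \<Rightarrow> real \<Rightarrow> bool" where
  "sparse_bound \<alpha> A c C \<kappa> \<longleftrightarrow> (\<forall>n E L k w.
     ugraph n E \<and> adjacency_lists n E L \<and> real (card E) \<le> c * real (k\<^sup>2) \<and>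
     (\<forall>v<n. degree E v \<noteq> 0) \<and> word_size_ok \<kappa> n E k w \<longrightarrow>
     (\<exists>t. real t \<le> C * \<alpha> (k\<^sup>2) \<and>
          runs_within w A (encode L k) t (C * (real (k\<^sup>2) + 1)) \<and>
          (\<forall>(K, s) \<in> set_pmf (run w A (encode L k) t). correct_answer E k s)))"

lemma sparse_matching_algorithm_iff:
  "sparse_matching_algorithm \<alpha> A \<longleftrightarrow> deterministic A \<and> (\<forall>c. \<exists>C \<kappa>. sparse_bound \<alpha> A c C \<kappa>)"
  by (simp only: sparse_matching_algorithm_def sparse_bound_def)

lemma sparse_boundD:
  assumes "sparse_bound \<alpha> A c C \<kappa>" "ugraph n E" "adjacency_lists n E L" "real (card E) \<le> c * real (k\<^sup>2)"
    "\<And>v. v < n \<Longrightarrow> degree E v \<noteq> 0" "word_size_ok \<kappa> n E k w"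
  shows "\<exists>t. real t \<le> C * \<alpha> (k\<^sup>2) \<and> runs_within w A (encode L k) t (C * (real (k\<^sup>2) + 1)) \<and>
    (\<forall>(K, s) \<in> set_pmf (run w A (encode L k) t). correct_answer E k s)"
  using assms(1)[unfolded sparse_bound_def, THEN spec, THEN spec, THEN spec, THEN spec, THEN spec, of n E L k w] assms(2-)
  by blast

text \<open>The space bound forces \<open>C\<close> to be nonnegative; the empty program answers the instance \<open>k = 0\<close>
  wrongly, so at least one step is needed and constants can be charged to \<open>\<alpha>\<close>.\<close>

lemma sparse_time_pos:
  assumes C: "sparse_bound \<alpha> A c C \<kappa>" and c: "0 \<le> c"
  shows "0 < C" "1 \<le> C * \<alpha> (k\<^sup>2)"
proof -
  have ex: "\<exists>w t. real t \<le> C * \<alpha> (k\<^sup>2) \<and> runs_within w A (encode [] k) t (C * (real (k\<^sup>2) + 1)) \<and>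
      (\<forall>(K, s) \<in> set_pmf (run w A (encode [] k) t). correct_answer {} k s)" for k
  proof -
    obtain w :: nat where "\<kappa> * log 2 (real (gsize 0 {} + k + 2)) \<le> real w" using real_arch_simple by blast
    then have "word_size_ok \<kappa> 0 {} k w" by (simp add: word_size_ok_def)
    then show ?thesis using sparse_boundD[OF C, of 0 "{}" "[]" k w] c by (auto simp: ugraph_def adjacency_lists_def)
  qed
  have run_Nil: "run w [] x t = return_pmf ([], init_state)" for w x t
    unfolding run_def by (induction t) (simp_all add: bind_return_pmf)
  have "A \<noteq> []"
  proof
    assume "A = []"
    then have "correct_answer {} 0 init_state" using ex[of 0] by (auto simp: run_Nil)
    moreover have "k_matching {} 0 {}" by (simp add: k_matching_def)
    ultimately show False by (auto simp: correct_answer_def init_state_def)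
  qed
  obtain w t where wt: "real t \<le> C * \<alpha> (k\<^sup>2)" "runs_within w A (encode [] k) t (C * (real (k\<^sup>2) + 1))"
    using ex[of k] by blast
  have "t \<noteq> 0"
  proof
    assume "t = 0"
    then show False using wt(2) \<open>A \<noteq> []\<close> by (simp add: runs_within_def run_def)
  qed
  then show a: "1 \<le> C * \<alpha> (k\<^sup>2)" using wt(1) by linarith
  obtain K s where "(K, s) \<in> set_pmf (run w A (encode [] k) t)"
    using set_pmf_not_empty[of "run w A (encode [] k) t"] by auto
  then have "real (space_used A s) \<le> C * (real (k\<^sup>2) + 1)" using wt(2) by (auto simp: runs_within_def)
  then have "0 \<le> C * (real (k\<^sup>2) + 1)" using of_nat_0_le_iff order_trans by blast
  moreover have "0 < real (k\<^sup>2) + 1" by (metis add_nonneg_pos of_nat_0_le_iff zero_less_one)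
  ultimately have "0 \<le> C" by (simp add: zero_le_mult_iff)
  moreover have "C \<noteq> 0" using a by auto
  ultimately show "0 < C" by simp
qed

text \<open>The least power of two above \<open>12 * k\<^sup>2\<close> is at most
  \<open>2 ^ 5 * k\<^sup>2\<close>. The factor \<open>k\<^sup>2\<close> on both sides makes the case
  \<open>k = 0\<close> trivial.\<close>

lemma ex_log_bound: "\<exists>b. 12 * k\<^sup>2 < 2 ^ b \<and> real (k\<^sup>2) * real b \<le> real (k\<^sup>2) * (5 + 2 * log 2 (real k))"
proof (cases "k = 0")
  case True
  then show ?thesis by (intro exI[of _ 1]) simp
next
  case False
  then have "1 \<le> 12 * k\<^sup>2" by (simp add: Suc_le_eq)
  then obtain m where m: "2 ^ m \<le> 12 * k\<^sup>2" "12 * k\<^sup>2 < 2 ^ (m + 1)"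
    using ex_power_ivl1[of 2 "12 * k\<^sup>2"] by auto
  have "(2::nat) ^ (m + 1) \<le> 32 * k\<^sup>2" using m(1) by simp
  then have "real (2 ^ (m + 1)) \<le> real (32 * k\<^sup>2)" by (simp only: of_nat_le_iff)
  then have "2 powr (real (m + 1)) \<le> 32 * (real k)\<^sup>2"
    unfolding powr_realpow[OF zero_less_numeral] by simp
  moreover have k: "0 < real k" using False by simp
  ultimately have "real (m + 1) \<le> log 2 (32 * (real k)\<^sup>2)" by (subst le_log_iff) auto
  also have "\<dots> = log 2 (2 ^ 5) + 2 * log 2 (real k)"
    using k by (simp add: log_mult log_nat_power)
  also have "log 2 (2 ^ 5) = (5::real)" by (subst log_nat_power) auto
  finally show ?thesis using m(2) by (intro exI[of _ "m + 1"] conjI mult_left_mono) auto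
qed

text \<open>The logarithm vanishes at \<open>k = 1\<close>, hence the additive \<open>1\<close>,
  which is later charged to the running time of the given algorithm.\<close>

lemma square_le_log: "real (k\<^sup>2) \<le> real (k\<^sup>2) * log 2 (real k) + 1"
proof (cases "k \<le> 1")
  case True
  then have "k = 0 \<or> k = 1" by auto
  then show ?thesis by auto
next
  case False
  then have "1 \<le> log 2 (real k)" by (subst le_log_iff) auto
  then have "real (k\<^sup>2) * 1 \<le> real (k\<^sup>2) * log 2 (real k)" by (intro mult_left_mono) auto
  then show ?thesis by simp
qed

text \<open>The freely chosen factor of the logarithm acts as an exponent: words can hold any fixed
  power of the input parameters.\<close>

lemma word_size_power:
  assumes "word_size_ok \<kappa> n E k w" "real q \<le> \<kappa>"
  shows "(gsize n E + k + 2) ^ q \<le> 2 ^ w"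
proof -
  let ?M = "real (gsize n E + k + 2)"
  have M: "2 \<le> ?M" by simp
  then have "0 \<le> log 2 ?M" by (subst zero_le_log_cancel_iff) auto
  then have "real q * log 2 ?M \<le> real w"
    using assms mult_right_mono[OF assms(2)] unfolding word_size_ok_def by (meson order_trans)
  then have "2 powr (real q * log 2 ?M) \<le> 2 powr real w" by simp
  moreover have "2 powr (real q * log 2 ?M) = ?M ^ q"
    using M by (simp add: powr_mult_base log_powr[symmetric] powr_realpow mult.commute powr_powr[symmetric])
  ultimately have "real ((gsize n E + k + 2) ^ q) \<le> real (2 ^ w)" by (simp add: powr_realpow)
  then show ?thesis by (simp only: of_nat_le_iff)
qed

theorem theorem3p4:
  fixes \<alpha> :: "nat \<Rightarrow> real"
  assumes "\<exists>A. sparse_matching_algorithm \<alpha> A"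
  shows "\<exists>C \<kappa>. \<forall>\<epsilon>>0. \<exists>B. \<forall>n E L k w.
    ugraph n E \<and> adjacency_lists n E L \<and> word_size_ok \<kappa> n E k w \<longrightarrow>
    (\<exists>t. real t \<le> C * (real (gsize n E) + real (k\<^sup>2) * log 2 (real k)
                        + real k * max 0 (log 2 (1 / \<epsilon>)) + \<alpha> (k\<^sup>2)) \<and>
         runs_within w B (encode L k) t (C * (real (k\<^sup>2) + 1)) \<and>
         success_prob w B (encode L k) t E k \<ge> 1 - \<epsilon>)"
proof -
  obtain A where A: "sparse_matching_algorithm \<alpha> A" using assms by blast
  then have det: "\<forall>c\<in>set A. rand_free c" by (simp add: sparse_matching_algorithm_iff deterministic_def)
  \<comment> \<open>The constant \<open>7\<close>: at most \<open>4 * k\<^sup>2 + 2 * k\<close> cut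
    edges and \<open>k\<close> gadgets, with \<open>k \<le> k\<^sup>2\<close>.\<close>
  obtain C \<kappa> where C: "sparse_bound \<alpha> A 7 C \<kappa>" using A unfolding sparse_matching_algorithm_iff by blast
  note pos = sparse_time_pos[OF C]
  have C0: "0 < C" using pos(1) by simp
  define R where "R = card (\<Union>c\<in>set (kernel_prog A). regs c)"
  \<comment> \<open>The factor \<open>40\<close> serves the arrays of the kernel construction, and
    \<open>C\<close> the memory of the simulated program.\<close>
  define z where "z = max 40 (nat \<lceil>C\<rceil>)"
  have z: "40 \<le> z" "C \<le> real z" unfolding z_def by (simp, linarith)
  \<comment> \<open>A constant factor is absorbed into a power of the input measure
    \<open>M\<close>, because \<open>M \<ge> 2\<close>.\<close>
  define q where "q = 8 * z + 1024"
  have q: "8 * z + 1024 \<le> 2 ^ q" unfolding q_def using less_exp[of "8 * z + 1024"] by simp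
  \<comment> \<open>The measure of the kernel is at most \<open>4 * M \<le> M ^ 3\<close>, so its
    logarithm grows by a factor of at most three. Nothing prevents \<open>\<kappa>\<close> from
    being negative, hence the \<open>max\<close> with \<open>0\<close>.\<close>
  define \<kappa>' where "\<kappa>' = max (3 * max \<kappa> 0) (real (q + 3))"
  \<comment> \<open>The estimate below has \<open>3670 * k\<^sup>2\<close> and the constant
    \<open>401\<close>. By \<open>square_le_log\<close> this gives the coefficient
    \<open>3670 + 700\<close> of \<open>k\<^sup>2 * log 2 k\<close>, and \<open>3670 + 401\<close>
    units that go to \<open>C * \<alpha> (k\<^sup>2)\<close>, which already occurs \<open>7\<close>
    times.\<close>
  define D where "D = 4370 + 4078 * C + real R + 8 * real z"
  have D: "4370 \<le> D" "4078 * C \<le> D" "real R + 8 * real z \<le> D" using C0 by (simp_all add: D_def)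
  have main: "\<exists>t. real t \<le> D * (real (gsize n E) + real (k\<^sup>2) * log 2 (real k)
                        + real k * max 0 (log 2 (1 / \<epsilon>)) + \<alpha> (k\<^sup>2)) \<and>
         runs_within w (kernel_prog A) (encode L k) t (D * (real (k\<^sup>2) + 1)) \<and>
         success_prob w (kernel_prog A) (encode L k) t E k \<ge> 1 - \<epsilon>"
    if \<epsilon>: "0 < \<epsilon>" and G: "ugraph n E" "adjacency_lists n E L" "word_size_ok \<kappa>' n E k w" for \<epsilon> n E L k w
  proof -
    define M where "M = gsize n E + k + 2"
    define Z where "Z = z * (k\<^sup>2 + 1)"
    have "M ^ (q + 3) \<le> 2 ^ w" unfolding M_def by (rule word_size_power[OF G(3)]) (simp add: \<kappa>'_def)
    moreover have "2 ^ q * M ^ 3 \<le> M ^ (q + 3)"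
      unfolding power_add by (intro mult_le_mono1 power_mono) (simp_all add: M_def)
    moreover have "(8 * z + 1024) * M ^ 3 \<le> 2 ^ q * M ^ 3" using q by (rule mult_le_mono1)
    ultimately have W: "(8 * z + 1024) * M ^ 3 \<le> 2 ^ w" by linarith
    have M2: "2 \<le> M" by (simp add: M_def)
    have "(k + 2) * (k + 2) \<le> M * M" by (intro mult_le_mono) (simp_all add: M_def)
    then have kM: "k\<^sup>2 + 1 \<le> M\<^sup>2" by (simp add: power2_eq_square algebra_simps)
    have M23: "M\<^sup>2 \<le> M ^ 3" using M2 by (intro power_increasing) auto
    have M13: "4 * M \<le> M ^ 3" using mult_le_mono[OF M2 M2] by (simp add: power3_eq_cube)
    have "1024 * M ^ 3 \<le> (8 * z + 1024) * M ^ 3" by simp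
    then have W1: "1024 * M ^ 3 \<le> 2 ^ w" using W by linarith
    have "8 * z * (k\<^sup>2 + 1) \<le> (8 * z + 1024) * M ^ 3" using kM M23 by (intro mult_le_mono) auto
    then have Z8: "8 * Z \<le> 2 ^ w" using W by (simp add: Z_def)
    interpret r: ram n E L k w Z
    proof
      show "ugraph n E" "adjacency_lists n E L" by fact+
      show "64 < (2::nat) ^ w" using W1 M13 M2 by linarith
      show "8 * Z \<le> 2 ^ w" by fact
      show "40 * (k\<^sup>2 + 1) \<le> Z" unfolding Z_def using z(1) by (rule mult_le_mono1)
      have nM: "n + 2 * card E \<le> 2 * M" by (simp add: M_def gsize_def)
      have "n + 2 * card E + X < 2 ^ w" if "X \<le> 64 * M ^ 3" for X
        using that nM W1 M13 M2 by linarith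
      then show "n + 2 * card E + 64 * (k\<^sup>2 + 1) < 2 ^ w"
        using mult_le_mono2[OF order_trans[OF kM M23]] by blast
    qed
    define tA where "tA = nat \<lfloor>C * \<alpha> (k\<^sup>2)\<rfloor>"
    have tA: "real tA \<le> C * \<alpha> (k\<^sup>2)" unfolding tA_def using pos(2)[of k] by linarith
    have sim: "\<exists>t\<le>tA. \<forall>(K', s') \<in> set_pmf (run w A (encode (r.kL T) k) t).
        K' = [] \<and> extent s' \<le> Z \<and> correct_answer (r.kE T) k s'"
      if T: "T \<le> n" "card (r.cut_edges T) \<le> 4 * k\<^sup>2 + 2 * k" for T
    proof -
      let ?n = "length (r.kverts T) + 2 * length r.highs"
      have GE: "card (r.cut_edges T) \<le> card E" using r.finite_E by (intro card_mono) (auto simp: r.cut_edges_def)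
      have Hn: "length r.highs \<le> n" unfolding r.highs_def
        using length_filter_le[of "\<lambda>u. \<not> r.low u" "[0..<n]"] by (simp del: length_filter_le)
      have Vn: "length (r.kverts T) \<le> n" unfolding r.kverts_def
        using length_filter_le[of "\<lambda>u. r.low u \<and> r.good_nbrs T u \<noteq> []" "[0..<T]"] T(1) by (simp del: length_filter_le)
      have "card (r.kE T) \<le> 7 * k\<^sup>2"
        using r.card_kE[of T] T(2) r.length_highs r.k_le unfolding r.K_def by linarith
      then have "real (card (r.kE T)) \<le> real (7 * k\<^sup>2)" by (simp only: of_nat_le_iff)
      then have cE: "real (card (r.kE T)) \<le> 7 * real (k\<^sup>2)" by simp
      have "gsize ?n (r.kE T) + k + 2 \<le> 4 * M"
        using r.card_kE[of T] GE Hn Vn by (simp add: M_def gsize_def)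
      then have gM: "gsize ?n (r.kE T) + k + 2 \<le> M ^ 3" using M13 by linarith
      have "word_size_ok \<kappa> ?n (r.kE T) k w"
      proof -
        let ?g = "real (gsize ?n (r.kE T) + k + 2)"
        have g1: "1 \<le> ?g" by simp
        then have l0: "0 \<le> log 2 ?g" by (subst zero_le_log_cancel_iff) auto
        have "?g \<le> real (M ^ 3)" using gM by (simp only: of_nat_le_iff)
        then have "log 2 ?g \<le> log 2 (real M ^ 3)" using g1 M2 by (subst log_le_cancel_iff) auto
        also have "\<dots> = 3 * log 2 (real M)" using M2 by (subst log_nat_power) auto
        finally have lg: "log 2 ?g \<le> 3 * log 2 (real M)" .
        have lM: "0 \<le> log 2 (real M)" using M2 by (subst zero_le_log_cancel_iff) auto
        have "\<kappa> * log 2 ?g \<le> max \<kappa> 0 * log 2 ?g" using l0 by (intro mult_right_mono) auto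
        also have "\<dots> \<le> max \<kappa> 0 * (3 * log 2 (real M))" using lg by (intro mult_left_mono) auto
        also have "\<dots> = (3 * max \<kappa> 0) * log 2 (real M)" by simp
        also have "\<dots> \<le> \<kappa>' * log 2 (real M)" using lM by (intro mult_right_mono) (auto simp: \<kappa>'_def)
        also have "\<dots> \<le> real w" using G(3) by (simp add: word_size_ok_def M_def)
        finally show ?thesis by (simp add: word_size_ok_def)
      qed
      from sparse_boundD[OF C r.ugraph_kE[OF T(1)] r.adjacency_kL[OF T(1)] cE r.degree_kE[OF T(1)] this]
      obtain t where t: "real t \<le> C * \<alpha> (k\<^sup>2)" "runs_within w A (encode (r.kL T) k) t (C * (real (k\<^sup>2) + 1))"
        "\<forall>(K, s) \<in> set_pmf (run w A (encode (r.kL T) k) t). correct_answer (r.kE T) k s" by blast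
      have "t \<le> tA" unfolding tA_def using t(1) by (simp add: le_nat_floor)
      moreover have "K' = [] \<and> extent s' \<le> Z \<and> correct_answer (r.kE T) k s'"
        if st: "(K', s') \<in> set_pmf (run w A (encode (r.kL T) k) t)" for K' s'
      proof -
        have 1: "K' = []" "real (space_used A s') \<le> C * (real (k\<^sup>2) + 1)" "correct_answer (r.kE T) k s'"
          using t(2,3) st unfolding runs_within_def by auto
        have "real (extent s') \<le> real (space_used A s')" by (simp add: space_used_def)
        also have "\<dots> \<le> real z * (real (k\<^sup>2) + 1)"
          using 1(2) mult_right_mono[OF z(2), of "real (k\<^sup>2) + 1"] by auto
        also have "\<dots> = real Z" by (simp add: Z_def algebra_simps)
        finally show ?thesis using 1 by simp
      qed
      ultimately show ?thesis by blast
    qed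
    obtain b where b: "12 * k\<^sup>2 < 2 ^ b" "real (k\<^sup>2) * real b \<le> real (k\<^sup>2) * (5 + 2 * log 2 (real k))"
      using ex_log_bound by blast
    obtain t s where ts: "exec w (encode L k) t (kernel_prog A, init_state) ([], s)" "extent s \<le> 8 * Z" "correct_answer E k s"
      "t \<le> 350 * (n + 2 * card E) + (25 * b + 60) * (12 * r.K) + 100 * k + 300 + 7 * tA + 1 + ((50 * b + 1100) * r.K + 100)"
      using r.kernel_prog_exec[OF b(1) det sim] by blast
    have run: "run w (kernel_prog A) (encode L k) t = return_pmf ([], s)"
      using ts(1) by (simp add: exec_def run_def)
    define N where "N = real (gsize n E)"
    define Q where "Q = real (k\<^sup>2)"
    define l where "l = Q * log 2 (real k)"
    have "real t \<le> real (350 * (n + 2 * card E) + (25 * b + 60) * (12 * r.K) + 100 * k + 300 + 7 * tA + 1 + ((50 * b + 1100) * r.K + 100))"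
      using ts(4) by (simp only: of_nat_le_iff)
    also have "\<dots> = 350 * (real n + 2 * real (card E)) + 350 * (Q * real b) + 1820 * Q + 100 * real k + 401 + 7 * real tA"
      by (simp add: Q_def r.K_def algebra_simps)
    also have "\<dots> \<le> 700 * N + 350 * (Q * (5 + 2 * log 2 (real k))) + 1820 * Q + 100 * Q + 401 + 7 * (C * \<alpha> (k\<^sup>2))"
    proof -
      have "real k \<le> Q" using r.k_le unfolding Q_def r.K_def by (simp only: of_nat_le_iff)
      moreover have "350 * (real n + 2 * real (card E)) \<le> 700 * N" by (simp add: N_def gsize_def)
      moreover have "Q * real b \<le> Q * (5 + 2 * log 2 (real k))" using b(2) by (simp only: Q_def)
      ultimately show ?thesis using tA by linarith
    qed
    also have "\<dots> = 700 * N + 3670 * Q + 700 * l + 401 + 7 * (C * \<alpha> (k\<^sup>2))"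
      by (simp add: l_def algebra_simps)
    also have "\<dots> \<le> 700 * N + 4370 * l + 4078 * (C * \<alpha> (k\<^sup>2))"
    proof -
      have "Q \<le> l + 1" using square_le_log[of k] by (simp only: Q_def l_def)
      then show ?thesis using pos(2)[of k] by linarith
    qed
    also have "\<dots> \<le> D * (N + l + real k * max 0 (log 2 (1 / \<epsilon>)) + \<alpha> (k\<^sup>2))"
    proof -
      have "0 < C * \<alpha> (k\<^sup>2)" using pos(2)[of k] by linarith
      then have a0: "0 \<le> \<alpha> (k\<^sup>2)" using C0 by (simp add: zero_less_mult_iff)
      have l0: "0 \<le> l"
      proof (cases "k = 0")
        case False
        then have "0 \<le> log 2 (real k)" by (subst zero_le_log_cancel_iff) auto
        then show ?thesis by (simp add: l_def Q_def)
      qed (simp add: l_def Q_def)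
      have "700 * N \<le> D * N" using D(1) by (intro mult_right_mono) (simp_all add: N_def)
      moreover have "4370 * l \<le> D * l" using D(1) l0 by (rule mult_right_mono)
      moreover have "4078 * C * \<alpha> (k\<^sup>2) \<le> D * \<alpha> (k\<^sup>2)" using D(2) a0 by (rule mult_right_mono)
      moreover have "0 \<le> D * (real k * max 0 (log 2 (1 / \<epsilon>)))" using D(1) by simp
      ultimately show ?thesis by (simp add: distrib_left)
    qed
    finally have time: "real t \<le> D * (N + l + real k * max 0 (log 2 (1 / \<epsilon>)) + \<alpha> (k\<^sup>2))" .
    have "real (space_used (kernel_prog A) s) \<le> real R + 8 * real Z"
      using ts(2) by (simp add: space_used_def R_def)
    also have "\<dots> \<le> (real R + 8 * real z) * (real (k\<^sup>2) + 1)" by (simp add: Z_def algebra_simps)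
    also have "\<dots> \<le> D * (real (k\<^sup>2) + 1)" using D(3) by (intro mult_right_mono) auto
    finally have "runs_within w (kernel_prog A) (encode L k) t (D * (real (k\<^sup>2) + 1))"
      by (simp add: runs_within_def run)
    moreover have "success_prob w (kernel_prog A) (encode L k) t E k \<ge> 1 - \<epsilon>"
      using ts(3) \<epsilon> by (simp add: success_prob_def run)
    ultimately show ?thesis using time unfolding N_def l_def Q_def by blast
  qed
  \<comment> \<open>Neither the constants nor the program depend on
    \<open>\<epsilon>\<close>.\<close>
  show ?thesis
    by (rule exI[of _ D], rule exI[of _ \<kappa>'], intro allI impI, rule exI[of _ "kernel_prog A"],
        intro allI impI, elim conjE) (rule main)
qed

end
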